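(* Let $d\geq 1$, let $J:\mathbb{Z}^d\times \mathbb{Z}^d \to [0,\infty)$ be a symmetric, integrable, translation-invariant kernel, and suppose that there exist constants $0<\alpha<d$, $c>0$ and $C<\infty$ such that $c \|x-y\|^{-d-\alpha} \leq J(x,y) \leq C\|x-y\|^{-d-\alpha}$ for all distinct $x,y \in \mathbb{Z}^d$. If $\alpha<1$ then $$\mathbb{P}_{\beta_c}(0\leftrightarrow x) \asymp \|x\|^{-d+\alpha}$$ for every $x\in \mathbb{Z}^d \setminus \{0\}$, where the implicit constants depend only on $d$, $\alpha$, $c$ and $C$.
   Context: Long-range percolation: given a symmetric kernel $J$ (i.e. $J(x,y)=J(y,x)$) and $\beta\geq 0$, $\mathbb{P}_\beta$ is the law of the random graph with vertex set $\mathbb{Z}^d$ in which each potential edge $\{x,y\}$ ($x\neq y$) is included (is "open") independently at random with probability $1-\exp(-\beta J(x,y))$. Translation-invariant means $J(x,y)=J(0,y-x)$ for all $x,y$; integrable means $\sum_{x\in\mathbb{Z}^d}J(0,x)<\infty$. $\|\cdot\|$ denotes the $\ell^\infty$ norm. $\{x\leftrightarrow y\}$ is the event that $x$ and $y$ belong to the same connected component (cluster) of the random graph. The critical value is $\beta_c=\inf\{\beta\geq 0:\mathbb{P}_\beta(\text{an infinite cluster exists})>0\}$. The relation $f\asymp g$ means that $f$ and $g$ are each bounded by a positive constant multiple of the other. *)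

theory Defs
  imports "HOL-Probability.Probability"
begin

text \<open>
  Configurations are functions on the set of potential edges, that is, on the two-element subsets
  of the vertex set; \<open>\<omega> e\<close> says that \<open>e\<close> is open.
\<close>

definition potential_edges :: "'v set set" where
  "potential_edges = {{x, y} | x y. x \<noteq> y}"

text \<open>The weight of an unordered pair is well defined only when \<open>J\<close> is symmetric.\<close>

definition edge_weight :: "('v \<Rightarrow> 'v \<Rightarrow> real) \<Rightarrow> 'v set \<Rightarrow> real" where
  "edge_weight J e = (THE w. \<exists>x y. e = {x, y} \<and> w = J x y)"

lemma edge_weight_pair:
  assumes "\<And>x y. J x y = J y x"
  shows "edge_weight J {x, y} = J x y"
  unfolding edge_weight_def
proof (rule the_equality)
  fix w assume "\<exists>x' y'. {x, y} = {x', y'} \<and> w = J x' y'"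
  then show "w = J x y"
    using assms by (auto simp: doubleton_eq_iff)
qed auto

definition percolation :: "('v \<Rightarrow> 'v \<Rightarrow> real) \<Rightarrow> real \<Rightarrow> ('v set \<Rightarrow> bool) measure" where
  "percolation J \<beta> =
     (\<Pi>\<^sub>M e\<in>potential_edges. measure_pmf (bernoulli_pmf (1 - exp (- \<beta> * edge_weight J e))))"

definition open_adjacent :: "('v set \<Rightarrow> bool) \<Rightarrow> 'v \<Rightarrow> 'v \<Rightarrow> bool" where
  "open_adjacent \<omega> x y \<longleftrightarrow> x \<noteq> y \<and> \<omega> {x, y}"

definition connected_in :: "('v set \<Rightarrow> bool) \<Rightarrow> 'v \<Rightarrow> 'v \<Rightarrow> bool" where
  "connected_in \<omega> = (open_adjacent \<omega>)\<^sup>*\<^sup>*"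

definition cluster :: "('v set \<Rightarrow> bool) \<Rightarrow> 'v \<Rightarrow> 'v set" where
  "cluster \<omega> x = {y. connected_in \<omega> x y}"

definition two_point :: "('v \<Rightarrow> 'v \<Rightarrow> real) \<Rightarrow> real \<Rightarrow> 'v \<Rightarrow> 'v \<Rightarrow> real" where
  "two_point J \<beta> x y = \<P>(\<omega> in percolation J \<beta>. connected_in \<omega> x y)"

text \<open>
  This is an infimum in the reals, so it is meaningful only if percolation occurs at some finite
  \<open>\<beta>\<close>. This is the case for every kernel with \<open>J x y \<ge> c \<parallel>x - y\<parallel>\<^sup>-\<^sup>d\<^sup>-\<^sup>\<alpha>\<close>, \<open>c > 0\<close> and \<open>\<alpha> < 1\<close>.
\<close>

definition critical_value :: "('v \<Rightarrow> 'v \<Rightarrow> real) \<Rightarrow> real" where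
  "critical_value J =
     Inf {\<beta>. 0 \<le> \<beta> \<and> \<P>(\<omega> in percolation J \<beta>. \<exists>x. infinite (cluster \<omega> x)) > 0}"

definition linf_norm :: "int ^ 'd \<Rightarrow> real" where
  "linf_norm x = infnorm (\<chi> i. real_of_int (x $ i))"

definition symmetric_kernel :: "('v \<Rightarrow> 'v \<Rightarrow> real) \<Rightarrow> bool" where
  "symmetric_kernel J \<longleftrightarrow> (\<forall>x y. J x y = J y x)"

definition translation_invariant :: "(int ^ 'd \<Rightarrow> int ^ 'd \<Rightarrow> real) \<Rightarrow> bool" where
  "translation_invariant J \<longleftrightarrow> (\<forall>x y. J x y = J 0 (y - x))"

definition integrable_kernel :: "(int ^ 'd \<Rightarrow> int ^ 'd \<Rightarrow> real) \<Rightarrow> bool" where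
  "integrable_kernel J \<longleftrightarrow> (\<lambda>x. J 0 x) summable_on UNIV"

end

theory Submission
  imports Defs
begin

text \<open>
  On a finite vertex set all probabilities are finite sums, and the infinite measure enters only
  through the two-point function and the event that an infinite cluster exists.

  If with probability close to 1 a box of side \<open>s\<close> contains a cluster of size at least a large
  constant times \<open>s\<close> to the power \<open>(d + \<alpha>) / 2\<close>, then these clusters merge from scale to scale
  and there is percolation; this condition is open in \<open>\<beta>\<close>, so it fails at \<open>\<beta>\<^sub>c\<close>. Cutting a
  large cluster into edge-disjoint pieces and applying the van den Berg--Kesten inequality turns this
  failure into an exponential tail for the sizes of the clusters at that scale.

  Joining the clusters of two neighbouring boxes by single edges, the normalised second moment
  of the cluster sizes at scale \<open>2 * s\<close> is at least of the order of its square at scale \<open>s\<close>, up to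
  this tail. It is therefore bounded, which bounds the susceptibility of a ball of radius \<open>r\<close> by
  \<open>r\<close> to the power \<open>\<alpha>\<close>. In the other direction, the expected number of open edges leaving the
  cluster of the origin in a ball is at least 1 at \<open>\<beta>\<^sub>c\<close>, and since \<open>\<alpha> < 1\<close>, averaging over the
  radius bounds the susceptibility from below by the same power.

  The pointwise lower bound joins the truncated clusters of \<open>0\<close> and \<open>x\<close> by a single edge. For
  the upper bound, the edge by which a path from \<open>0\<close> to \<open>x\<close> leaves a ball of random radius has, because
  \<open>\<alpha> < 1\<close>, only a small probability of being short compared with the distance to \<open>x\<close>; short edges
  contribute a small multiple of the bound itself, and long ones only involve averages of the two-point
  function.
\<close>

text \<open>Every constant is chosen before \<open>J\<close> is quantified, which gives the
  uniformity claimed in the theorem. The exponent \<open>(d + \<alpha>) / 2\<close> marks the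
  critical size: between two clusters of that size in a box of side \<open>s\<close> the expected
  number of open edges is of order one, a single edge having probability at least of order
  \<open>s powr - (d + \<alpha>)\<close>. Since \<open>\<alpha> < d\<close>, clusters that occupy
  all but one of \<open>L ^ d\<close> subboxes outgrow this size, so that merging becomes easier at
  larger scales.

  The second-moment argument controls only connections inside a box or a ball, whereas the upper
  bound concerns paths that may leave every ball and return. The obstacle is overcome on an
  arbitrary finite vertex set: there the best constant is finite, and it is bounded by half of
  itself plus a number independent of the set. One quarter comes from short exit edges, once the
  cutoff between short and long is fixed. The other comes from long exit edges, through the
  excursions that enter the local averages of the two-point function; it is made small by a large
  ratio \<open>K\<close> of radii, which again uses \<open>\<alpha> < d\<close>.\<close>

section \<open>Expectations over finitely many independent edges\<close>

definition edge_config_weight :: "('e \<Rightarrow> real) \<Rightarrow> 'e set \<Rightarrow> 'e set \<Rightarrow> real" where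
  "edge_config_weight p E S = (\<Prod>e\<in>S. p e) * (\<Prod>e\<in>E - S. 1 - p e)"

definition expec :: "('e \<Rightarrow> real) \<Rightarrow> 'e set \<Rightarrow> ('e set \<Rightarrow> real) \<Rightarrow> real" where
  "expec p E f = (\<Sum>S\<in>Pow E. edge_config_weight p E S * f S)"

text \<open>Asked for every \<open>e\<close>, so that no edge set has to be carried along;
  \<open>edge_prob\<close> meets this by being 0 off \<open>potential_edges\<close>.\<close>

definition probs :: "('e \<Rightarrow> real) \<Rightarrow> bool" where
  "probs p \<longleftrightarrow> (\<forall>e. 0 \<le> p e \<and> p e \<le> 1)"

lemma probsD: "probs p \<Longrightarrow> 0 \<le> p e" "probs p \<Longrightarrow> p e \<le> 1"
  by (auto simp: probs_def)

lemma edge_config_weight_nonneg: "probs p \<Longrightarrow> 0 \<le> edge_config_weight p E S"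
  unfolding edge_config_weight_def probs_def by (intro mult_nonneg_nonneg prod_nonneg) auto

lemma expec_empty [simp]: "expec p {} f = f {}"
  by (simp add: expec_def edge_config_weight_def)

text \<open>Conditioning on the state of \<open>e\<close>. The inductions on the edge set, including
  the one for the van den Berg--Kesten inequality, run on this recursion.\<close>

lemma expec_insert:
  assumes "finite E" "e \<notin> E"
  shows "expec p (insert e E) f = p e * expec p E (\<lambda>S. f (insert e S)) + (1 - p e) * expec p E f"
proof -
  have "expec p (insert e E) f = (\<Sum>S\<in>Pow E. edge_config_weight p (insert e E) S * f S)
      + (\<Sum>S\<in>insert e ` Pow E. edge_config_weight p (insert e E) S * f S)"
    unfolding expec_def Pow_insert using assms by (intro sum.union_disjoint) auto
  also have "(\<Sum>S\<in>insert e ` Pow E. edge_config_weight p (insert e E) S * f S)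
      = (\<Sum>S\<in>Pow E. edge_config_weight p (insert e E) (insert e S) * f (insert e S))"
    using assms by (subst sum.reindex) (auto simp: inj_on_def)
  also have "\<dots> = p e * expec p E (\<lambda>S. f (insert e S))"
    unfolding expec_def sum_distrib_left
  proof (rule sum.cong[OF refl])
    fix S assume "S \<in> Pow E"
    then have S: "finite S" "e \<notin> S" "insert e E - insert e S = E - S"
      using assms finite_subset by auto
    show "edge_config_weight p (insert e E) (insert e S) * f (insert e S) = p e * (edge_config_weight p E S * f (insert e S))"
      using S by (simp add: edge_config_weight_def)
  qed
  also have "(\<Sum>S\<in>Pow E. edge_config_weight p (insert e E) S * f S) = (1 - p e) * expec p E f"
    unfolding expec_def sum_distrib_left
  proof (rule sum.cong[OF refl])
    fix S assume "S \<in> Pow E"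
    then have S: "insert e E - S = insert e (E - S)" "e \<notin> E - S" "finite (E - S)"
      using assms by auto
    show "edge_config_weight p (insert e E) S * f S = (1 - p e) * (edge_config_weight p E S * f S)"
      unfolding edge_config_weight_def S(1) using S by (subst prod.insert) auto
  qed
  finally show ?thesis by simp
qed

lemma expec_cong: "(\<And>S. S \<subseteq> E \<Longrightarrow> f S = g S) \<Longrightarrow> expec p E f = expec p E g"
  by (simp add: expec_def)

lemma expec_mono: "probs p \<Longrightarrow> (\<And>S. S \<subseteq> E \<Longrightarrow> f S \<le> g S) \<Longrightarrow> expec p E f \<le> expec p E g"
  unfolding expec_def by (intro sum_mono mult_left_mono edge_config_weight_nonneg) auto

lemma expec_cmult: "expec p E (\<lambda>S. c * f S) = c * expec p E f"
  unfolding expec_def sum_distrib_left by (intro sum.cong) auto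

lemma expec_cmult_right: "expec p E (\<lambda>S. f S * c) = expec p E f * c"
  unfolding expec_def sum_distrib_right by (intro sum.cong) auto

lemma expec_add: "expec p E (\<lambda>S. f S + g S) = expec p E f + expec p E g"
  by (simp add: expec_def sum.distrib algebra_simps)

lemma expec_diff: "expec p E (\<lambda>S. f S - g S) = expec p E f - expec p E g"
  by (simp add: expec_def sum_subtractf algebra_simps)

lemma expec_sum: "expec p E (\<lambda>S. \<Sum>i\<in>I. f i S) = (\<Sum>i\<in>I. expec p E (f i))"
  unfolding expec_def sum_distrib_left by (subst sum.swap) simp

lemma expec_const: "finite E \<Longrightarrow> expec p E (\<lambda>_. c) = c"
proof (induction E rule: finite_induct)
  case (insert e E)
  then show ?case by (simp add: expec_insert algebra_simps)
qed simp

lemma expec_nonneg: "probs p \<Longrightarrow> (\<And>S. S \<subseteq> E \<Longrightarrow> 0 \<le> f S) \<Longrightarrow> 0 \<le> expec p E f"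
  unfolding expec_def by (intro sum_nonneg mult_nonneg_nonneg edge_config_weight_nonneg) auto

lemma expec_le_const:
  "probs p \<Longrightarrow> finite E \<Longrightarrow> (\<And>S. S \<subseteq> E \<Longrightarrow> f S \<le> c) \<Longrightarrow> expec p E f \<le> c"
  using expec_mono[of p E f "\<lambda>_. c"] by (simp add: expec_const)

lemma expec_Un:
  assumes "finite A" "finite B" "A \<inter> B = {}"
  shows "expec p (A \<union> B) f = expec p A (\<lambda>S. expec p B (\<lambda>T. f (S \<union> T)))"
  using assms
proof (induction A arbitrary: f rule: finite_induct)
  case (insert e A)
  then have "expec p (insert e A \<union> B) f
      = p e * expec p (A \<union> B) (\<lambda>S. f (insert e S)) + (1 - p e) * expec p (A \<union> B) f"
    using expec_insert[of "A \<union> B" e p f] by auto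
  also have "\<dots> = p e * expec p A (\<lambda>S. expec p B (\<lambda>T. f (insert e S \<union> T)))
      + (1 - p e) * expec p A (\<lambda>S. expec p B (\<lambda>T. f (S \<union> T)))"
    using insert by simp
  also have "\<dots> = expec p (insert e A) (\<lambda>S. expec p B (\<lambda>T. f (S \<union> T)))"
    using insert by (simp add: expec_insert)
  finally show ?case .
qed simp

lemma expec_marginal:
  assumes "finite E" "A \<subseteq> E" "\<And>S. S \<subseteq> E \<Longrightarrow> f S = f (S \<inter> A)"
  shows "expec p E f = expec p A f"
proof -
  have *: "E = A \<union> (E - A)" using assms by auto
  have fin: "finite A" "finite (E - A)" using assms finite_subset by auto
  have "expec p E f = expec p A (\<lambda>S. expec p (E - A) (\<lambda>T. f (S \<union> T)))"
    by (subst *, rule expec_Un) (use fin in auto)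
  also have "\<dots> = expec p A (\<lambda>S. expec p (E - A) (\<lambda>T. f S))"
  proof (intro expec_cong)
    fix S T assume ST: "S \<subseteq> A" "T \<subseteq> E - A"
    then have "(S \<union> T) \<inter> A = S" by auto
    then show "f (S \<union> T) = f S" using assms(3)[of "S \<union> T"] assms(2) ST by auto
  qed
  also have "\<dots> = expec p A f" using fin by (simp add: expec_const)
  finally show ?thesis .
qed

text \<open>Fubini over \<open>E \<inter> A\<close> and \<open>E - A\<close>. \<open>A\<close> and
  \<open>B\<close> may be any disjoint sets, so events can be localised without first being cut down
  to \<open>E\<close>.\<close>

lemma expec_indep:
  assumes "finite E" "A \<inter> B = {}"
    and f: "\<And>S. S \<subseteq> E \<Longrightarrow> f S = f (S \<inter> A)" and g: "\<And>S. S \<subseteq> E \<Longrightarrow> g S = g (S \<inter> B)"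
  shows "expec p E (\<lambda>S. f S * g S) = expec p E f * expec p E g"
proof -
  let ?A = "E \<inter> A" and ?B = "E - A"
  have *: "E = ?A \<union> ?B" by auto
  have fin: "finite ?A" "finite ?B" using assms by auto
  have "expec p E (\<lambda>S. f S * g S) = expec p ?A (\<lambda>S. expec p ?B (\<lambda>T. f (S \<union> T) * g (S \<union> T)))"
    by (subst *, rule expec_Un) (use fin in auto)
  also have "\<dots> = expec p ?A (\<lambda>S. expec p ?B (\<lambda>T. f S * g T))"
  proof (intro expec_cong)
    fix S T assume ST: "S \<subseteq> ?A" "T \<subseteq> ?B"
    have "(S \<union> T) \<inter> A = S" "S \<inter> A = S" using ST by auto
    then have 1: "f (S \<union> T) = f S" using f[of "S \<union> T"] ST by auto
    have "(S \<union> T) \<inter> B = T \<inter> B" using ST assms(2) by auto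
    moreover have "S \<union> T \<subseteq> E" "T \<subseteq> E" using ST by auto
    ultimately have 2: "g (S \<union> T) = g T" using g[of "S \<union> T"] g[of T] by simp
    show "f (S \<union> T) * g (S \<union> T) = f S * g T" by (simp add: 1 2)
  qed
  also have "\<dots> = expec p ?A f * expec p ?B g"
    by (simp add: expec_cmult expec_cmult_right)
  also have "expec p ?A f = expec p E f"
  proof (rule expec_marginal[symmetric])
    fix S assume S: "S \<subseteq> E"
    then have "S \<inter> (E \<inter> A) = S \<inter> A" by auto
    then show "f S = f (S \<inter> (E \<inter> A))" using f[OF S] by simp
  qed (use assms in auto)
  also have "expec p ?B g = expec p E g"
  proof (rule expec_marginal[symmetric])
    fix S assume S: "S \<subseteq> E"
    have "S \<inter> B = (S \<inter> (E - A)) \<inter> B" using S assms(2) by auto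
    then show "g S = g (S \<inter> (E - A))"
      using g[OF S] g[of "S \<inter> (E - A)"] S by (metis Int_lower1 order_trans)
  qed (use assms in auto)
  finally show ?thesis .
qed

lemma expec_avoid:
  assumes "finite E" "F \<subseteq> E"
  shows "expec p E (\<lambda>S. of_bool (S \<inter> F = {})) = (\<Prod>e\<in>F. 1 - p e)"
proof -
  have "expec p E (\<lambda>S. of_bool (S \<inter> F = {})) = expec p F (\<lambda>S. of_bool (S \<inter> F = {}) :: real)"
    using assms by (intro expec_marginal) auto
  also have "\<dots> = (\<Prod>e\<in>F. 1 - p e)"
  proof -
    have "expec p F (\<lambda>S. of_bool (S \<inter> F = {})) = (\<Sum>S\<in>Pow F. if S = {} then edge_config_weight p F S else 0)"
      unfolding expec_def by (intro sum.cong) auto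
    also have "\<dots> = (\<Prod>e\<in>F. 1 - p e)"
      using assms finite_subset[of F E] by (simp add: edge_config_weight_def)
    finally show ?thesis .
  qed
  finally show ?thesis .
qed

lemma expec_edge:
  assumes "finite E" "e \<in> E"
  shows "expec p E (\<lambda>S. of_bool (e \<in> S)) = p e"
proof -
  have "expec p E (\<lambda>S. of_bool (e \<in> S)) = expec p {e} (\<lambda>S. of_bool (e \<in> S) :: real)"
    using assms by (intro expec_marginal) auto
  then show ?thesis using expec_insert[of "{}" e p] by simp
qed

lemma expec_mono_set:
  assumes "probs p" "finite E" "A \<subseteq> E" "\<And>S T. S \<subseteq> T \<Longrightarrow> T \<subseteq> E \<Longrightarrow> f S \<le> f T"
  shows "expec p A f \<le> expec p E f"
proof -
  have "expec p A f = expec p A (\<lambda>S. f (S \<inter> A))" by (rule expec_cong) (simp add: Int_absorb2)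
  also have "\<dots> = expec p E (\<lambda>S. f (S \<inter> A))"
    by (rule expec_marginal[symmetric]) (use assms in \<open>auto simp: Int_assoc\<close>)
  also have "\<dots> \<le> expec p E f" using assms by (intro expec_mono) auto
  finally show ?thesis .
qed

lemma expec_image:
  assumes "finite E" "inj_on h E"
  shows "expec p (h ` E) f = expec (p \<circ> h) E (\<lambda>S. f (h ` S))"
  using assms
proof (induction E arbitrary: f rule: finite_induct)
  case (insert e E)
  then have "h e \<notin> h ` E" by auto
  then show ?case using insert by (simp add: expec_insert)
qed simp

lemma expec_cong_prob: "(\<And>e. e \<in> E \<Longrightarrow> p e = q e) \<Longrightarrow> expec p E f = expec q E f"
  unfolding expec_def edge_config_weight_def by (intro sum.cong arg_cong2[of _ _ _ _ "(*)"] prod.cong) auto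

text \<open>On a finite edge set \<open>expec\<close> is a polynomial in the edge probabilities.
  This is why strict finite-volume inequalities are open conditions in \<beta>.\<close>

lemma continuous_expec:
  assumes "\<And>e. e \<in> E \<Longrightarrow> continuous_on T (\<lambda>t. p t e)"
  shows "continuous_on T (\<lambda>t. expec (p t) E f)"
  unfolding expec_def edge_config_weight_def using assms
  by (intro continuous_intros) auto

lemma expec_of_bool_Ex_le:
  assumes "probs p" "finite I"
  shows "expec p E (\<lambda>S. of_bool (\<exists>i\<in>I. Q i S)) \<le> (\<Sum>i\<in>I. expec p E (\<lambda>S. of_bool (Q i S)))"
proof -
  have "expec p E (\<lambda>S. of_bool (\<exists>i\<in>I. Q i S)) \<le> expec p E (\<lambda>S. \<Sum>i\<in>I. of_bool (Q i S))"
  proof (intro expec_mono assms)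
    fix S
    show "of_bool (\<exists>i\<in>I. Q i S) \<le> (\<Sum>i\<in>I. of_bool (Q i S) :: real)"
    proof (cases "\<exists>i\<in>I. Q i S")
      case True
      then obtain i where i: "i \<in> I" "Q i S" by auto
      have "of_bool (Q i S) \<le> (\<Sum>i\<in>I. of_bool (Q i S) :: real)"
        using i assms by (intro member_le_sum) auto
      then show ?thesis using True i by simp
    qed (simp add: sum_nonneg)
  qed
  then show ?thesis by (simp add: expec_sum)
qed

subsection \<open>The van den Berg--Kesten inequality for increasing events\<close>

text \<open>An increasing event pair is replaced by an up-closed relation \<open>C\<close>: unlike the sets
  \<open>A \<times> B\<close>, such relations are closed under unions, and this is what makes the induction on the
  edge set go through.\<close>

definition upclosed :: "('e set \<Rightarrow> 'e set \<Rightarrow> bool) \<Rightarrow> bool" where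
  "upclosed C \<longleftrightarrow> (\<forall>S T S' T'. C S T \<longrightarrow> S \<subseteq> S' \<longrightarrow> T \<subseteq> T' \<longrightarrow> C S' T')"

text \<open>For \<open>C S T\<close> of the form \<open>A S \<and> B T\<close> with increasing
  \<open>A\<close> and \<open>B\<close> this is disjoint occurrence: by monotonicity two disjoint
  witnesses in \<open>X\<close> can be enlarged to complementary ones.\<close>

definition disjointly :: "('e set \<Rightarrow> 'e set \<Rightarrow> bool) \<Rightarrow> 'e set \<Rightarrow> bool" where
  "disjointly C X \<longleftrightarrow> (\<exists>S\<subseteq>X. C S (X - S))"

lemma upclosedD: "upclosed C \<Longrightarrow> C S T \<Longrightarrow> S \<subseteq> S' \<Longrightarrow> T \<subseteq> T' \<Longrightarrow> C S' T'"
  by (auto simp: upclosed_def)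

lemma upclosed_sections:
  assumes "upclosed C"
  shows "upclosed (\<lambda>S T. C (insert e S) T)" "upclosed (\<lambda>S T. C S (insert e T))"
    "upclosed (\<lambda>S T. C (insert e S) T \<or> C S (insert e T))"
proof -
  have "C (insert e S') T'" if "C (insert e S) T" "S \<subseteq> S'" "T \<subseteq> T'" for S T S' T'
    using upclosedD[OF assms that(1) Set.insert_mono that(3)] that(2) .
  moreover have "C S' (insert e T')" if "C S (insert e T)" "S \<subseteq> S'" "T \<subseteq> T'" for S T S' T'
    using upclosedD[OF assms that(1,2) Set.insert_mono] that(3) .
  ultimately show "upclosed (\<lambda>S T. C (insert e S) T)" "upclosed (\<lambda>S T. C S (insert e T))"
    "upclosed (\<lambda>S T. C (insert e S) T \<or> C S (insert e T))"
    unfolding upclosed_def by blast+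
qed

text \<open>The edge \<open>e\<close> falls on exactly one side of a partition of
  \<open>insert e X\<close>, so the two sections of \<open>C\<close> are united; even for a product
  relation the result is no longer a product.\<close>

lemma disjointly_insert:
  assumes "upclosed C" "e \<notin> X"
  shows "disjointly C (insert e X) \<longleftrightarrow>
    disjointly (\<lambda>S T. C (insert e S) T \<or> C S (insert e T)) X"
proof
  assume "disjointly C (insert e X)"
  then obtain S where S: "S \<subseteq> insert e X" "C S (insert e X - S)" by (auto simp: disjointly_def)
  show "disjointly (\<lambda>S T. C (insert e S) T \<or> C S (insert e T)) X"
  proof (cases "e \<in> S")
    case True
    then have "insert e (S - {e}) = S" "insert e X - S = X - (S - {e})" using assms(2) by auto
    then show ?thesis using S unfolding disjointly_def by (intro exI[of _ "S - {e}"]) auto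
  next
    case False
    then have "insert e X - S = insert e (X - S)" by auto
    then show ?thesis using S False unfolding disjointly_def by (intro exI[of _ S]) auto
  qed
next
  assume "disjointly (\<lambda>S T. C (insert e S) T \<or> C S (insert e T)) X"
  then obtain S where S: "S \<subseteq> X" "C (insert e S) (X - S) \<or> C S (insert e (X - S))"
    by (auto simp: disjointly_def)
  then have "insert e X - insert e S = X - S" "insert e X - S = insert e (X - S)"
    using assms(2) by auto
  then have "insert e S \<subseteq> insert e X \<and> C (insert e S) (insert e X - insert e S)
      \<or> S \<subseteq> insert e X \<and> C S (insert e X - S)" using S by auto
  then show "disjointly C (insert e X)" unfolding disjointly_def by blast
qed

text \<open>In the step, \<open>e\<close> closed leaves \<open>C\<close> and \<open>e\<close> open
  gives the union \<open>?u\<close> of the sections \<open>?a\<close> and \<open>?b\<close>, while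
  two independent copies of \<open>e\<close> give \<open>C\<close>, \<open>?a\<close>,
  \<open>?b\<close> and \<open>?c\<close>. Monotonicity places \<open>C\<close> inside
  \<open>?i\<close> and \<open>?u\<close> inside \<open>?c\<close>, and inclusion-exclusion for
  \<open>?a\<close> and \<open>?b\<close> does the rest.\<close>

theorem BK_inequality:
  assumes "finite E" "probs p" "upclosed C"
  shows "expec p E (\<lambda>X. of_bool (disjointly C X))
    \<le> expec p E (\<lambda>X. expec p E (\<lambda>Y. of_bool (C X Y)))"
  using assms(1,3)
proof (induction E arbitrary: C rule: finite_induct)
  case empty
  then show ?case by (simp add: disjointly_def)
next
  case (insert e E)
  let ?P = "\<lambda>C. expec p E (\<lambda>X. expec p E (\<lambda>Y. of_bool (C X Y) :: real))"
  let ?a = "\<lambda>S T. C (insert e S) T" and ?b = "\<lambda>S T. C S (insert e T)"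
  let ?c = "\<lambda>S T. C (insert e S) (insert e T)"
  let ?u = "\<lambda>S T. ?a S T \<or> ?b S T" and ?i = "\<lambda>S T. ?a S T \<and> ?b S T"
  have up: "upclosed ?u" by (rule upclosed_sections(3)[OF insert.prems])
  have p: "0 \<le> p e" "p e \<le> 1" using assms(2) by (auto simp: probs_def)
  have mono: "?P C1 \<le> ?P C2" if "\<And>S T. C1 S T \<Longrightarrow> C2 S T" for C1 C2 :: "'a set \<Rightarrow> 'a set \<Rightarrow> bool"
    using that assms(2) by (intro expec_mono) auto
  have ui: "?P ?u + ?P ?i = ?P ?a + ?P ?b"
    unfolding expec_add[symmetric] by (intro expec_cong) auto
  have 1: "?P C \<le> ?P ?i"
    by (rule mono) (use upclosedD[OF insert.prems] in blast)
  have 2: "?P ?u \<le> ?P ?c"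
    by (rule mono) (use upclosedD[OF insert.prems] in blast)
  have "expec p (insert e E) (\<lambda>X. of_bool (disjointly C X))
      = p e * expec p E (\<lambda>X. of_bool (disjointly C (insert e X)))
        + (1 - p e) * expec p E (\<lambda>X. of_bool (disjointly C X))"
    using insert by (simp add: expec_insert)
  also have "expec p E (\<lambda>X. of_bool (disjointly C (insert e X)))
      = expec p E (\<lambda>X. of_bool (disjointly ?u X) :: real)"
  proof (rule expec_cong)
    fix X assume "X \<subseteq> E"
    then have "e \<notin> X" using insert by auto
    then show "(of_bool (disjointly C (insert e X)) :: real) = of_bool (disjointly ?u X)"
      using disjointly_insert[OF insert.prems] by simp
  qed
  also have "p e * expec p E (\<lambda>X. of_bool (disjointly ?u X))
        + (1 - p e) * expec p E (\<lambda>X. of_bool (disjointly C X)) \<le> p e * ?P ?u + (1 - p e) * ?P C"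
    using insert.IH[OF up] insert.IH[OF insert.prems] p
    by (intro add_mono mult_left_mono) auto
  \<comment> \<open>Both weights are split by a second, independent copy of \<open>e\<close>. The
    mixed parts carry \<open>?P ?u + ?P C\<close>, at most
    \<open>?P ?u + ?P ?i = ?P ?a + ?P ?b\<close>.\<close>
  also have "\<dots> \<le> (1 - p e)\<^sup>2 * ?P C + p e * (1 - p e) * (?P ?a + ?P ?b) + (p e)\<^sup>2 * ?P ?c"
  proof -
    have "p e * (1 - p e) * ?P C \<le> p e * (1 - p e) * ?P ?i" "(p e)\<^sup>2 * ?P ?u \<le> (p e)\<^sup>2 * ?P ?c"
      using 1 2 p by (auto intro!: mult_left_mono)
    then show ?thesis unfolding ui[symmetric] by (simp add: algebra_simps power2_eq_square)
  qed
  also have "\<dots> = expec p (insert e E) (\<lambda>X. expec p (insert e E) (\<lambda>Y. of_bool (C X Y)))"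
    unfolding expec_insert[OF insert.hyps] expec_add expec_cmult by (simp add: algebra_simps power2_eq_square)
  finally show ?case .
qed

section \<open>Connections and clusters in a set of open edges\<close>

definition conn :: "'v set set \<Rightarrow> 'v \<Rightarrow> 'v \<Rightarrow> bool" where
  "conn S = connected_in (\<lambda>e. e \<in> S)"

definition clus :: "'v set set \<Rightarrow> 'v \<Rightarrow> 'v set" where
  "clus S x = {y. conn S x y}"

definition edges :: "'v set \<Rightarrow> 'v set set" where
  "edges V = {{x, y} | x y. x \<in> V \<and> y \<in> V \<and> x \<noteq> y}"

definition tau :: "('v set \<Rightarrow> real) \<Rightarrow> 'v set \<Rightarrow> 'v \<Rightarrow> 'v \<Rightarrow> real" where
  "tau p V x y = expec p (edges V) (\<lambda>S. of_bool (conn S x y))"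

lemma conn_refl [simp, intro]: "conn S x x"
  by (simp add: conn_def connected_in_def)

lemma conn_trans: "conn S x y \<Longrightarrow> conn S y z \<Longrightarrow> conn S x z"
  unfolding conn_def connected_in_def by (rule rtranclp_trans)

lemma conn_edge: "{x, y} \<in> S \<Longrightarrow> conn S x y"
  by (cases "x = y") (auto simp: conn_def connected_in_def open_adjacent_def)

lemma conn_induct [consumes 1, case_names refl step]:
  assumes "conn S x y" "P x"
    "\<And>y z. conn S x y \<Longrightarrow> P y \<Longrightarrow> y \<noteq> z \<Longrightarrow> {y, z} \<in> S \<Longrightarrow> P z"
  shows "P y"
  using assms(1) unfolding conn_def connected_in_def
proof (induction rule: rtranclp_induct)
  case (step y z)
  then show ?case
    using assms(3)[of y z] by (simp add: conn_def connected_in_def open_adjacent_def)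
qed (rule assms(2))

lemma conn_sym: "conn S x y \<Longrightarrow> conn S y x"
proof (induction rule: conn_induct)
  case (step y z)
  then have "conn S z y" by (intro conn_edge) (simp add: insert_commute)
  then show ?case by (rule conn_trans) (rule step)
qed simp

lemma conn_mono: "conn S x y \<Longrightarrow> S \<subseteq> T \<Longrightarrow> conn T x y"
proof (induction rule: conn_induct)
  case (step y z)
  then show ?case using conn_edge[of y z T] conn_trans[of T x y z] by auto
qed simp

lemma conn_first:
  assumes "conn S x y" "x \<noteq> y"
  obtains w where "w \<noteq> x" "{x, w} \<in> S"
  using assms(1)[unfolded conn_def connected_in_def]
proof (cases rule: converse_rtranclpE)
  case (step w)
  then show ?thesis using that[of w] by (auto simp: open_adjacent_def)
qed (use assms in simp)

lemma conn_inside: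
  assumes "conn S x y" "S \<subseteq> edges V" "x \<in> V"
  shows "y \<in> V"
  using assms(1) by (induction rule: conn_induct) (use assms in \<open>auto simp: edges_def doubleton_eq_iff\<close>)

lemma edgesI: "x \<in> V \<Longrightarrow> y \<in> V \<Longrightarrow> x \<noteq> y \<Longrightarrow> {x, y} \<in> edges V"
  by (auto simp: edges_def)

lemma edges_pair: "{x, y} \<in> edges V \<longleftrightarrow> x \<in> V \<and> y \<in> V \<and> x \<noteq> y"
  by (auto simp: edges_def doubleton_eq_iff)

lemma finite_edges [simp, intro]: "finite V \<Longrightarrow> finite (edges V)"
  by (rule finite_subset[of _ "Pow V"]) (auto simp: edges_def)

lemma edges_mono: "V \<subseteq> W \<Longrightarrow> edges V \<subseteq> edges W"
  by (auto simp: edges_def)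

lemma edges_disjoint: "V \<inter> W = {} \<Longrightarrow> edges V \<inter> edges W = {}"
  by (auto simp: edges_def doubleton_eq_iff)

lemma conn_within_clus:
  assumes "conn S x y"
  shows "conn (S \<inter> edges (clus S x)) x y"
  using assms
proof (induction rule: conn_induct)
  case (step y z)
  have "y \<in> clus S x" "z \<in> clus S x"
    using step conn_edge[of y z S] conn_trans[of S x y z] by (auto simp: clus_def)
  then have "{y, z} \<in> S \<inter> edges (clus S x)" using step by (simp add: edges_pair)
  then show ?case using step.IH conn_edge[of y z] conn_trans[of _ x y z] by auto
qed simp

lemma clus_self [simp]: "x \<in> clus S x"
  by (simp add: clus_def)

lemma clus_eq:
  assumes "y \<in> clus S x"
  shows "clus S y = clus S x"
proof -
  have xy: "conn S x y" "conn S y x" using assms conn_sym by (auto simp: clus_def)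
  then have "conn S y z \<longleftrightarrow> conn S x z" for z
    using conn_trans[OF xy(1), of z] conn_trans[OF xy(2), of z] by auto
  then show ?thesis by (simp add: clus_def)
qed

lemma clus_subset: "S \<subseteq> edges V \<Longrightarrow> x \<in> V \<Longrightarrow> clus S x \<subseteq> V"
  using conn_inside[of S x _ V] by (auto simp: clus_def)

lemma clus_mono: "S \<subseteq> T \<Longrightarrow> clus S x \<subseteq> clus T x"
  using conn_mono by (auto simp: clus_def)

subsection \<open>Splitting large clusters into disjoint pieces\<close>

text \<open>Phrased through a finite subset \<open>U\<close> because \<open>card\<close> of an
  infinite cluster is 0.\<close>

definition big :: "nat \<Rightarrow> 'v set set \<Rightarrow> bool" where
  "big n S \<longleftrightarrow> (\<exists>U u. finite U \<and> n < card U \<and> U \<subseteq> clus S u)"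

text \<open>The recursion is shaped for \<open>BK_inequality\<close>:
  \<open>pieces n (Suc m)\<close> is by definition the disjoint occurrence of \<open>big n\<close>
  and \<open>pieces n m\<close>.\<close>

fun pieces :: "nat \<Rightarrow> nat \<Rightarrow> 'v set set \<Rightarrow> bool" where
  "pieces n 0 S \<longleftrightarrow> True"
| "pieces n (Suc m) S \<longleftrightarrow> (\<exists>T\<subseteq>S. big n T \<and> pieces n m (S - T))"

lemma big_mono: "big n S \<Longrightarrow> S \<subseteq> T \<Longrightarrow> big n T"
  unfolding big_def using clus_mono[of S T] by blast

lemma pieces_mono: "pieces n m S \<Longrightarrow> S \<subseteq> T \<Longrightarrow> pieces n m T"
proof (induction m arbitrary: S T)
  case (Suc m)
  then obtain X where X: "X \<subseteq> S" "big n X" "pieces n m (S - X)" by auto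
  then have "pieces n m (T - X)" using Suc.IH[of "S - X" "T - X"] Suc.prems by auto
  then show ?case using X Suc.prems by auto
qed simp

lemma pieces_le: "pieces n m S \<Longrightarrow> k \<le> m \<Longrightarrow> pieces n k S"
proof (induction k arbitrary: m S)
  case (Suc k)
  then obtain m' where m: "m = Suc m'" "k \<le> m'" by (cases m) auto
  then obtain T where "T \<subseteq> S" "big n T" "pieces n m' (S - T)" using Suc.prems by auto
  moreover from this have "pieces n k (S - T)" using Suc.IH m by simp
  ultimately show ?case by auto
qed simp

lemma pieces_Un: "pieces n a S \<Longrightarrow> pieces n b T \<Longrightarrow> S \<inter> T = {} \<Longrightarrow> pieces n (a + b) (S \<union> T)"
proof (induction a arbitrary: S)
  case 0
  then show ?case using pieces_mono[of n b T "S \<union> T"] by auto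
next
  case (Suc a)
  then obtain X where X: "X \<subseteq> S" "big n X" "pieces n a (S - X)" by auto
  then have "pieces n (a + b) ((S - X) \<union> T)" using Suc.IH[of "S - X"] Suc.prems by auto
  moreover have "(S - X) \<union> T = (S \<union> T) - X" using X Suc.prems by auto
  ultimately show ?case using X by auto
qed

text \<open>A greedy decomposition from the root \<open>u\<close>. Cutting off the component of a
  neighbour \<open>w\<close> leaves two smaller connected sets, each of which yields pieces and a
  leftover of at most \<open>n\<close> vertices attached to its root. The edge \<open>{u, w}\<close>
  joins the leftovers; as soon as their union exceeds \<open>n\<close> vertices it becomes a piece,
  so a piece costs at most \<open>2 * n\<close> vertices.\<close>

lemma connected_split:
  assumes "finite W" "u \<in> W" "\<And>x. x \<in> W \<Longrightarrow> conn (S \<inter> edges W) u x" "1 \<le> n"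
  shows "\<exists>m T P U. T \<subseteq> S \<inter> edges W \<and> P \<subseteq> S \<inter> edges W \<and> T \<inter> P = {} \<and> pieces n m T \<and>
    U \<subseteq> W \<and> u \<in> U \<and> U \<subseteq> clus P u \<and> card U \<le> n \<and> card W \<le> 2 * n * m + card U"
  using assms(1-3)
proof (induction "card W" arbitrary: W u rule: less_induct)
  case (less W)
  show ?case
  proof (cases "W = {u}")
    case True
    then show ?thesis using assms(4)
      by (intro exI[of _ 0] exI[of _ "{}"] exI[of _ "{u}"]) auto
  next
    case False
    then obtain x where "x \<in> W" "x \<noteq> u" using less.prems by auto
    then obtain w where w: "w \<noteq> u" "{u, w} \<in> S \<inter> edges W"
      using less.prems(3) conn_first by metis
    let ?T = "S \<inter> edges (W - {u})"
    define C where "C = clus ?T w"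
    define D where "D = W - C"
    have wW: "w \<in> W - {u}" using w by (auto simp: edges_pair)
    have CW: "C \<subseteq> W - {u}" unfolding C_def by (rule clus_subset) (use wW in auto)
    have "w \<in> C" by (simp add: C_def)
    have uD: "u \<in> D" using CW less.prems by (auto simp: D_def)
    have fin: "finite C" "finite D"
      using finite_subset[OF CW] less.prems(1) by (auto simp: D_def)
    have cW: "card W = card C + card D"
      using CW less.prems fin by (subst card_Un_disjoint[symmetric]) (auto simp: D_def intro: arg_cong[of _ _ card])
    have CD: "C \<inter> D = {}" by (auto simp: D_def)
    have "0 < card C" "0 < card D" using fin \<open>w \<in> C\<close> uD by (auto simp: card_gt_0_iff)
    then have small: "card C < card W" "card D < card W" using cW by auto
    have connC: "conn (S \<inter> edges C) w x" if "x \<in> C" for x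
    proof -
      have "conn (?T \<inter> edges C) w x" using that conn_within_clus[of ?T w x] by (auto simp: C_def clus_def)
      then show ?thesis by (rule conn_mono) auto
    qed
    \<comment> \<open>Removing \<open>C\<close> does not separate \<open>D\<close> from
      \<open>u\<close>: within \<open>W\<close> an edge from \<open>C\<close> to its complement can
      only end at \<open>u\<close>, so a path can be restarted there.\<close>
    have connD: "conn (S \<inter> edges D) u x" if "x \<in> D" for x
    proof -
      have "x \<notin> C \<longrightarrow> conn (S \<inter> edges D) u x"
        using less.prems(3)[of x] that unfolding D_def
      proof -
        assume "x \<in> W \<Longrightarrow> conn (S \<inter> edges W) u x" "x \<in> W - C"
        then have "conn (S \<inter> edges W) u x" by auto
        then show "x \<notin> C \<longrightarrow> conn (S \<inter> edges (W - C)) u x"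
        proof (induction rule: conn_induct)
          case (step y z)
          show ?case
          proof
            assume z: "z \<notin> C"
            have yz: "y \<in> W" "z \<in> W" "{y, z} \<in> S" using step by (auto simp: edges_pair)
            show "conn (S \<inter> edges (W - C)) u z"
            proof (cases "y \<in> C")
              case False
              then have "{y, z} \<in> S \<inter> edges (W - C)" using yz z step by (auto simp: edges_pair)
              then show ?thesis using step.IH False conn_edge[of y z] conn_trans[of _ u y z] by auto
            next
              case True
              have "z = u"
              proof (rule ccontr)
                assume "z \<noteq> u"
                then have "{y, z} \<in> ?T" using yz True CW step by (auto simp: edges_pair)
                then have "conn ?T w z" using True conn_edge[of y z ?T] conn_trans[of ?T w y z]
                  by (simp add: C_def clus_def)
                then show False using z by (simp add: C_def clus_def)
              qed
              then show ?thesis by simp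
            qed
          qed
        qed simp
      qed
      then show ?thesis using that by (simp add: D_def)
    qed
    obtain m1 T1 P1 U1 where 1: "T1 \<subseteq> S \<inter> edges D" "P1 \<subseteq> S \<inter> edges D" "T1 \<inter> P1 = {}" "pieces n m1 T1"
      "U1 \<subseteq> D" "u \<in> U1" "U1 \<subseteq> clus P1 u" "card U1 \<le> n" "card D \<le> 2 * n * m1 + card U1"
      using less.hyps[OF small(2) fin(2) uD connD] by blast
    obtain m2 T2 P2 U2 where 2: "T2 \<subseteq> S \<inter> edges C" "P2 \<subseteq> S \<inter> edges C" "T2 \<inter> P2 = {}" "pieces n m2 T2"
      "U2 \<subseteq> C" "w \<in> U2" "U2 \<subseteq> clus P2 w" "card U2 \<le> n" "card C \<le> 2 * n * m2 + card U2"
      using less.hyps[OF small(1) fin(1) \<open>w \<in> C\<close> connC] by blast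
    have eCD: "edges C \<inter> edges D = {}" using CD by (rule edges_disjoint)
    have eW: "edges C \<subseteq> edges W" "edges D \<subseteq> edges W"
      using CW by (auto intro!: edges_mono simp: D_def)
    have uw: "{u, w} \<notin> edges C" "{u, w} \<notin> edges D"
      using uD \<open>w \<in> C\<close> CD by (auto simp: edges_pair)
    define P where "P = insert {u, w} (P1 \<union> P2)"
    define U where "U = U1 \<union> U2"
    have T: "pieces n (m1 + m2) (T1 \<union> T2)" using 1 2 eCD by (intro pieces_Un) auto
    have TW: "T1 \<union> T2 \<subseteq> S \<inter> edges W" and PW: "P \<subseteq> S \<inter> edges W"
      using 1 2 eW w by (auto simp: P_def)
    have TP: "(T1 \<union> T2) \<inter> P = {}" using 1 2 eCD uw unfolding P_def by blast
    have UP: "U \<subseteq> clus P u"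
    proof
      fix x assume "x \<in> U"
      then consider "x \<in> U1" | "x \<in> U2" by (auto simp: U_def)
      then show "x \<in> clus P u"
      proof cases
        case 1
        then have "conn P1 u x" using \<open>U1 \<subseteq> clus P1 u\<close> by (auto simp: clus_def)
        then show ?thesis using conn_mono[of P1 u x P] by (auto simp: P_def clus_def)
      next
        case 2
        then have "conn P2 w x" using \<open>U2 \<subseteq> clus P2 w\<close> by (auto simp: clus_def)
        then have "conn P w x" using conn_mono[of P2 w x P] by (auto simp: P_def)
        moreover have "conn P u w" by (rule conn_edge) (simp add: P_def)
        ultimately show ?thesis using conn_trans[of P u w x] by (simp add: clus_def)
      qed
    qed
    have finU: "finite U1" "finite U2" using 1 2 fin finite_subset by blast+
    have cU: "card U = card U1 + card U2"
      unfolding U_def using finU 1 2 CD by (intro card_Un_disjoint) auto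
    have UW: "U \<subseteq> W" using 1 2 CW by (auto simp: U_def D_def)
    show ?thesis
    proof (cases "card U \<le> n")
      case True
      have "card W \<le> 2 * n * (m1 + m2) + card U" using cW cU 1 2 by (simp add: algebra_simps)
      moreover have "u \<in> U" using \<open>u \<in> U1\<close> by (simp add: U_def)
      ultimately show ?thesis using T TW PW TP UP UW True
        by (intro exI[of _ "m1 + m2"] exI[of _ "T1 \<union> T2"] exI[of _ P] exI[of _ U]) simp
    next
      case False
      \<comment> \<open>The joined leftovers are now too large and are spent as one more piece; the
        root alone remains as leftover, with no edges.\<close>
      have "big n P" unfolding big_def using False UP finU by (intro exI[of _ U] exI[of _ u]) (auto simp: U_def)
      moreover have "(P \<union> (T1 \<union> T2)) - P = T1 \<union> T2" using TP by auto
      ultimately have "pieces n (Suc (m1 + m2)) (P \<union> (T1 \<union> T2))"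
        unfolding pieces.simps using T by (intro exI[of _ P]) auto
      moreover have "card W \<le> 2 * n * Suc (m1 + m2) + card {u}"
        using cW cU 1 2 by (simp add: algebra_simps)
      ultimately show ?thesis using TW PW less.prems assms(4)
        by (intro exI[of _ "Suc (m1 + m2)"] exI[of _ "P \<union> (T1 \<union> T2)"] exI[of _ "{}"] exI[of _ "{u}"])
          (auto simp del: pieces.simps)
    qed
  qed
qed

lemma cluster_pieces:
  assumes "finite V" "S \<subseteq> edges V" "x \<in> V" "1 \<le> n"
  obtains m where "pieces n m (S \<inter> edges (clus S x))" "card (clus S x) \<le> 2 * n * m + n"
proof -
  have "finite (clus S x)" using clus_subset assms finite_subset by metis
  moreover have "conn (S \<inter> edges (clus S x)) x y" if "y \<in> clus S x" for y
    using that conn_within_clus[of S x y] by (simp add: clus_def)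
  ultimately have "\<exists>m T P U. T \<subseteq> S \<inter> edges (clus S x) \<and> P \<subseteq> S \<inter> edges (clus S x) \<and>
      T \<inter> P = {} \<and> pieces n m T \<and> U \<subseteq> clus S x \<and> x \<in> U \<and> U \<subseteq> clus P x \<and> card U \<le> n \<and>
      card (clus S x) \<le> 2 * n * m + card U"
    by (intro connected_split assms(4) clus_self)
  then obtain m T U where "T \<subseteq> S \<inter> edges (clus S x)" "pieces n m T" "card (U::'a set) \<le> n"
    "card (clus S x) \<le> 2 * n * m + card U"
    by (elim exE conjE) (rule that)
  then show ?thesis using that[of m] pieces_mono[of n m T] by auto
qed

text \<open>Cutting the cluster gives \<open>k\<close> pieces with
  \<open>3 * n * m < 2 * n * k + n\<close>, hence \<open>m \<le> k\<close>; the factor 3 instead of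
  2 absorbs the leftover.\<close>

lemma big_pieces:
  assumes "finite V" "S \<subseteq> edges V" "1 \<le> n" "big (3 * n * m) S"
  shows "pieces n m S"
proof (cases m)
  case (Suc m0)
  obtain U u where U: "finite U" "3 * n * m < card U" "U \<subseteq> clus S u"
    using assms(4) by (auto simp: big_def)
  have "\<exists>v\<in>V. U \<subseteq> clus S v"
  proof (cases "u \<in> V")
    case False
    have "clus S u = {u}"
    proof (rule ccontr)
      assume "clus S u \<noteq> {u}"
      then obtain x where "conn S u x" "u \<noteq> x" by (auto simp: clus_def)
      then obtain w where "{u, w} \<in> S" using conn_first by metis
      then show False using assms False by (auto simp: edges_def doubleton_eq_iff)
    qed
    then have "card U \<le> 1" using U card_mono[of "{u}" U] by simp
    then have False using U Suc assms(3) by simp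
    then show ?thesis ..
  qed (use U in auto)
  then obtain v where v: "v \<in> V" "U \<subseteq> clus S v" by auto
  obtain k where k: "pieces n k (S \<inter> edges (clus S v))" "card (clus S v) \<le> 2 * n * k + n"
    using cluster_pieces[OF assms(1,2) v(1) assms(3)] .
  have "finite (clus S v)" using clus_subset[OF assms(2) v(1)] assms(1) finite_subset by metis
  then have "card U \<le> card (clus S v)" using v by (simp add: card_mono)
  then have "3 * n * m < 2 * n * k + n" using U k by linarith
  then have "m \<le> k"
  proof (rule contrapos_pp)
    assume "\<not> m \<le> k"
    then have "Suc k \<le> m" by simp
    then have "2 * n * Suc k \<le> 2 * n * m" by (intro mult_le_mono) auto
    then show "\<not> 3 * n * m < 2 * n * k + n" using assms(3) by (simp add: algebra_simps)
  qed
  then show ?thesis using pieces_mono[OF pieces_le[OF k(1)] Int_lower1] by simp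
qed simp

text \<open>Distinct clusters have disjoint edges, so their pieces add up. A cluster with more than
  \<open>n\<close> vertices has at least one piece, and its leftover is paid for by replacing 2 by
  3.\<close>

lemma large_clusters_pieces:
  assumes "finite V" "S \<subseteq> edges V" "1 \<le> n"
  shows "\<exists>m. pieces n m S \<and> card {x \<in> V. n < card (clus S x)} \<le> 3 * n * m"
proof -
  have main: "\<exists>m. pieces n m (S \<inter> (\<Union>K\<in>\<K>. edges K)) \<and> (\<Sum>K\<in>\<K>. card K) \<le> 3 * n * m"
    if "finite \<K>" "\<K> \<subseteq> {K \<in> clus S ` V. n < card K}" for \<K>
    using that
  proof (induction \<K> rule: finite_induct)
    case empty
    show ?case by (intro exI[of _ 0]) simp
  next
    case (insert K \<K>)
    then obtain x where x: "x \<in> V" "K = clus S x" "n < card K" by auto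
    obtain k where k: "pieces n k (S \<inter> edges K)" "card K \<le> 2 * n * k + n"
      using cluster_pieces[OF assms(1,2) x(1) assms(3)] x by metis
    have "k \<noteq> 0" using k x by (cases k) auto
    then have k3: "card K \<le> 3 * n * k" using k by (cases k) auto
    obtain m where m: "pieces n m (S \<inter> (\<Union>K\<in>\<K>. edges K))" "(\<Sum>K\<in>\<K>. card K) \<le> 3 * n * m"
      using insert by auto
    have "edges K \<inter> edges L = {}" if L: "L \<in> \<K>" for L
    proof -
      obtain y where y: "L = clus S y" using insert.prems L by auto
      have "K \<inter> L = {}"
      proof (rule ccontr)
        assume "K \<inter> L \<noteq> {}"
        then obtain z where "z \<in> clus S x" "z \<in> clus S y" using x y by auto
        then have "K = L" using clus_eq x y by metis
        then show False using insert L by auto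
      qed
      then show ?thesis by (rule edges_disjoint)
    qed
    then have "pieces n (k + m) (S \<inter> edges K \<union> S \<inter> (\<Union>K\<in>\<K>. edges K))"
      using k m by (intro pieces_Un) auto
    moreover have "S \<inter> edges K \<union> S \<inter> (\<Union>K\<in>\<K>. edges K) = S \<inter> (\<Union>K\<in>insert K \<K>. edges K)"
      by auto
    ultimately show ?case using k3 m insert
      by (intro exI[of _ "k + m"]) (auto simp: algebra_simps)
  qed
  let ?K = "{K \<in> clus S ` V. n < card K}"
  obtain m where m: "pieces n m (S \<inter> (\<Union>K\<in>?K. edges K))" "(\<Sum>K\<in>?K. card K) \<le> 3 * n * m"
    using main[of ?K] assms(1) by auto
  have fin: "finite K" if "K \<in> ?K" for K
    using that clus_subset[OF assms(2)] assms(1) finite_subset by blast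
  have "{x \<in> V. n < card (clus S x)} \<subseteq> \<Union> ?K" by auto
  moreover have "finite (\<Union> ?K)"
    using assms(1) by (intro finite_Union fin) simp_all
  ultimately have "card {x \<in> V. n < card (clus S x)} \<le> card (\<Union> ?K)"
    by (intro card_mono)
  also have "\<dots> \<le> (\<Sum>K\<in>?K. card K)"
    by (rule card_Union_le_sum_card)
  also note m(2)
  finally show ?thesis using pieces_mono[OF m(1) Int_lower1] by blast
qed

lemma expec_pieces_le:
  assumes "finite E" "probs p"
  shows "expec p E (\<lambda>S. of_bool (pieces n m S)) \<le> (expec p E (\<lambda>S. of_bool (big n S))) ^ m"
proof (induction m)
  case 0
  show ?case using assms by (simp add: expec_const)
next
  case (Suc m)
  let ?C = "\<lambda>S T. big n S \<and> pieces n m T"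
  have up: "upclosed ?C" unfolding upclosed_def using big_mono pieces_mono by metis
  have "expec p E (\<lambda>S. of_bool (pieces n (Suc m) S)) = expec p E (\<lambda>S. of_bool (disjointly ?C S))"
    by (simp add: disjointly_def)
  also have "\<dots> \<le> expec p E (\<lambda>S. expec p E (\<lambda>T. of_bool (?C S T)))"
    using assms up by (rule BK_inequality)
  also have "\<dots> = expec p E (\<lambda>S. of_bool (big n S)) * expec p E (\<lambda>S. of_bool (pieces n m S))"
    by (simp add: of_bool_conj expec_cmult expec_cmult_right)
  also have "\<dots> \<le> expec p E (\<lambda>S. of_bool (big n S)) * (expec p E (\<lambda>S. of_bool (big n S))) ^ m"
    using Suc assms by (intro mult_left_mono expec_nonneg) auto
  finally show ?case by simp
qed

text \<open>The odd weights come from writing a square \<open>k ^ 2\<close> as the sum of the first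
  \<open>k\<close> odd numbers.\<close>

lemma sum_odd_geometric_le:
  fixes b :: real
  assumes "0 \<le> b" "b < 1"
  shows "(\<Sum>m<M. (2 * real m + 1) * b ^ m) \<le> 2 / (1 - b)\<^sup>2"
proof -
  \<comment> \<open>The second summand is the closed form of the omitted tail of the series.\<close>
  have eq: "(\<Sum>m<M. (2 * real m + 1) * b ^ m) + (2 * real M / (1 - b) + (1 + b) / (1 - b)\<^sup>2) * b ^ M
      = (1 + b) / (1 - b)\<^sup>2"
  proof (induction M)
    case (Suc M)
    have "(2 * real M + 1) + (2 * real (Suc M) / a + (2 - a) / a\<^sup>2) * (1 - a)
       = 2 * real M / a + (2 - a) / a\<^sup>2" if "a \<noteq> 0" for a :: real
      using that by (simp add: field_simps power2_eq_square)
    from this[of "1 - b"]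
    have "(2 * real M + 1) + (2 * real (Suc M) / (1 - b) + (1 + b) / (1 - b)\<^sup>2) * b
       = 2 * real M / (1 - b) + (1 + b) / (1 - b)\<^sup>2"
      using assms by simp
    then have "(2 * real M + 1) * b ^ M + (2 * real (Suc M) / (1 - b) + (1 + b) / (1 - b)\<^sup>2) * b ^ Suc M
       = (2 * real M / (1 - b) + (1 + b) / (1 - b)\<^sup>2) * b ^ M"
      by (metis (no_types, lifting) distrib_right mult.assoc power_Suc)
    then show ?case using Suc by simp
  qed simp
  have "0 \<le> (2 * real M / (1 - b) + (1 + b) / (1 - b)\<^sup>2) * b ^ M" using assms by simp
  then have "(\<Sum>m<M. (2 * real m + 1) * b ^ m) \<le> (1 + b) / (1 - b)\<^sup>2" using eq by linarith
  also have "\<dots> \<le> 2 / (1 - b)\<^sup>2" using assms by (intro divide_right_mono) auto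
  finally show ?thesis .
qed

definition bigprob :: "('v set \<Rightarrow> real) \<Rightarrow> 'v set \<Rightarrow> nat \<Rightarrow> real" where
  "bigprob p V n = expec p (edges V) (\<lambda>S. of_bool (big n S))"

lemma bigprob_bounds: "finite V \<Longrightarrow> probs p \<Longrightarrow> 0 \<le> bigprob p V n \<and> bigprob p V n \<le> 1"
  unfolding bigprob_def by (auto intro!: expec_nonneg expec_le_const)

text \<open>A cluster with more than \<open>3 * n * m\<close> vertices yields \<open>m\<close>
  edge-disjoint pieces that each pass the threshold \<open>n\<close>. Probability bounded away from
  1 thus becomes exponential decay.\<close>

lemma bigprob_tail:
  assumes "finite V" "probs p" "1 \<le> n"
  shows "bigprob p V (3 * n * m) \<le> bigprob p V n ^ m"
proof -
  have "bigprob p V (3 * n * m) \<le> expec p (edges V) (\<lambda>S. of_bool (pieces n m S))"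
    unfolding bigprob_def using big_pieces assms by (intro expec_mono) auto
  also have "\<dots> \<le> bigprob p V n ^ m"
    unfolding bigprob_def using assms by (intro expec_pieces_le) auto
  finally show ?thesis .
qed

text \<open>The sum is at most the square of the number of vertices in large clusters. That number
  is at most \<open>3 * n * k\<close> for some \<open>k\<close> with \<open>pieces n k S\<close>;
  expanding \<open>k ^ 2\<close> into odd numbers and using the geometric bound for
  \<open>pieces\<close> gives \<open>18 = 9 * 2\<close>.\<close>

lemma tail_second_moment:
  assumes "finite V" "probs p" "1 \<le> n" "bigprob p V n < 1"
  shows "expec p (edges V) (\<lambda>S. \<Sum>x\<in>V. real (card (clus S x)) * of_bool (n < card (clus S x)))
    \<le> 18 * (real n)\<^sup>2 * bigprob p V n / (1 - bigprob p V n)\<^sup>2"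
proof -
  let ?b = "bigprob p V n"
  let ?E = "edges V"
  have b: "0 \<le> ?b" using bigprob_bounds assms by blast
  have pt: "(\<Sum>x\<in>V. real (card (clus S x)) * of_bool (n < card (clus S x)))
      \<le> 9 * (real n)\<^sup>2 * (\<Sum>m<card V. (2 * real m + 1) * of_bool (pieces n (Suc m) S))"
    if S: "S \<subseteq> ?E" for S
  proof -
    let ?L = "{x \<in> V. n < card (clus S x)}"
    obtain m where m: "pieces n m S" "card ?L \<le> 3 * n * m"
      using large_clusters_pieces[OF assms(1) S assms(3)] by blast
    \<comment> \<open>The least admissible \<open>k\<close>, which is at most \<open>card V\<close>;
      the range of summation is then the same for all \<open>S\<close>.\<close>
    define k where "k = (LEAST k. card ?L \<le> 3 * n * k)"
    have kL: "card ?L \<le> 3 * n * k" unfolding k_def using m(2) by (rule LeastI)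
    have km: "k \<le> m" unfolding k_def using m(2) by (rule Least_le)
    have "card ?L \<le> card V" using assms(1) by (intro card_mono) auto
    also have "card V \<le> 3 * n * card V" using assms(3) by simp
    finally have kV: "k \<le> card V" unfolding k_def by (rule Least_le)
    have "(\<Sum>x\<in>V. real (card (clus S x)) * of_bool (n < card (clus S x)))
        = (\<Sum>x\<in>?L. real (card (clus S x)))"
      using assms(1) by (simp add: sum.inter_filter[symmetric] of_bool_def if_distrib cong: if_cong)
    also have "\<dots> \<le> (\<Sum>x\<in>?L. real (card ?L))"
    proof (rule sum_mono)
      fix x assume x: "x \<in> ?L"
      have "clus S x \<subseteq> ?L"
      proof
        fix y assume y: "y \<in> clus S x"
        then show "y \<in> ?L" using clus_eq[OF y] clus_subset[OF S, of x] x by auto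
      qed
      then show "real (card (clus S x)) \<le> real (card ?L)"
        using assms(1) by (simp add: card_mono)
    qed
    also have "\<dots> = (real (card ?L))\<^sup>2" by (simp add: power2_eq_square)
    also have "\<dots> \<le> (real (3 * n * k))\<^sup>2" using kL by (intro power_mono of_nat_mono) auto
    also have "\<dots> = 9 * (real n)\<^sup>2 * (real k)\<^sup>2" by (simp add: power_mult_distrib)
    also have "(real k)\<^sup>2 = (\<Sum>m<k. 2 * real m + 1)"
      by (induction k) (auto simp: power2_eq_square algebra_simps)
    also have "\<dots> = (\<Sum>m<k. (2 * real m + 1) * of_bool (pieces n (Suc m) S))"
    proof (rule sum.cong[OF refl])
      fix i assume "i \<in> {..<k}"
      then have "pieces n (Suc i) S" using km by (intro pieces_le[OF m(1)]) simp
      then show "2 * real i + 1 = (2 * real i + 1) * of_bool (pieces n (Suc i) S)" by simp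
    qed
    also have "\<dots> \<le> (\<Sum>m<card V. (2 * real m + 1) * of_bool (pieces n (Suc m) S))"
      using kV by (intro sum_mono2) auto
    finally show ?thesis by (simp add: mult_left_mono)
  qed
  have "expec p ?E (\<lambda>S. \<Sum>x\<in>V. real (card (clus S x)) * of_bool (n < card (clus S x)))
    \<le> expec p ?E (\<lambda>S. 9 * (real n)\<^sup>2 * (\<Sum>m<card V. (2 * real m + 1) * of_bool (pieces n (Suc m) S)))"
    using pt assms by (intro expec_mono) auto
  also have "\<dots> = 9 * (real n)\<^sup>2 * (\<Sum>m<card V. (2 * real m + 1) * expec p ?E (\<lambda>S. of_bool (pieces n (Suc m) S)))"
    by (simp only: expec_cmult expec_sum)
  also have "\<dots> \<le> 9 * (real n)\<^sup>2 * (\<Sum>m<card V. (2 * real m + 1) * ?b ^ Suc m)"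
    unfolding bigprob_def using assms
    by (intro mult_left_mono sum_mono expec_pieces_le) auto
  also have "(\<Sum>m<card V. (2 * real m + 1) * ?b ^ Suc m) = ?b * (\<Sum>m<card V. (2 * real m + 1) * ?b ^ m)"
    by (simp add: sum_distrib_left algebra_simps)
  also have "9 * (real n)\<^sup>2 * (?b * (\<Sum>m<card V. (2 * real m + 1) * ?b ^ m))
      \<le> 9 * (real n)\<^sup>2 * (?b * (2 / (1 - ?b)\<^sup>2))"
    using b assms by (intro mult_left_mono sum_odd_geometric_le) auto
  finally show ?thesis by (simp add: algebra_simps)
qed

section \<open>The two-point function on a finite vertex set\<close>

lemma tau_nonneg: "probs p \<Longrightarrow> 0 \<le> tau p V x y"
  unfolding tau_def by (intro expec_nonneg) auto

lemma tau_le_1: "probs p \<Longrightarrow> finite V \<Longrightarrow> tau p V x y \<le> 1"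
  unfolding tau_def by (intro expec_le_const) auto

lemma tau_self [simp]: "finite V \<Longrightarrow> tau p V x x = 1"
  unfolding tau_def by (simp add: expec_const)

lemma tau_mono:
  assumes "probs p" "finite V" "W \<subseteq> V"
  shows "tau p W x y \<le> tau p V x y"
  unfolding tau_def
proof (rule expec_mono_set)
  fix S T :: "'a set set" assume "S \<subseteq> T"
  then show "(of_bool (conn S x y) :: real) \<le> of_bool (conn T x y)" using conn_mono by auto
qed (use assms edges_mono in auto)

lemma tau_sym: "tau p V x y = tau p V y x"
  unfolding tau_def using conn_sym[of _ x y] conn_sym[of _ y x] by (intro expec_cong) (auto simp: of_bool_def)

lemma tau_outside:
  assumes "x \<in> W" "y \<notin> W"
  shows "tau p W x y = 0"
proof -
  have "tau p W x y = expec p (edges W) (\<lambda>S. 0 * 0)"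
    unfolding tau_def using conn_inside[of _ x y W] assms by (intro expec_cong) auto
  then show ?thesis by (simp only: expec_cmult)
qed

lemma sum_tau_eq:
  assumes "finite V" "x \<in> V"
  shows "(\<Sum>y\<in>V. tau p V x y) = expec p (edges V) (\<lambda>S. real (card (clus S x)))"
  unfolding tau_def expec_sum[symmetric]
proof (rule expec_cong)
  fix S assume "S \<subseteq> edges V"
  then have "V \<inter> {y. conn S x y} = clus S x" using clus_subset[of S V x] assms by (auto simp: clus_def)
  then show "(\<Sum>y\<in>V. of_bool (conn S x y)) = real (card (clus S x))"
    using assms by simp
qed

text \<open>Exploring a cluster inspects only the edges that meet it. Hence the event that
  \<open>C\<close> is the cluster of \<open>x\<close> is independent of the edges avoiding
  \<open>C\<close>.\<close>

lemma clus_touching: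
  "clus T x = C \<longleftrightarrow> clus {e \<in> T. e \<inter> C \<noteq> {}} x = C"
proof -
  let ?T = "{e \<in> T. e \<inter> C \<noteq> {}}"
  have "conn ?T x y" if "clus T x = C \<or> clus ?T x = C" "conn T x y" for y
    using that(2)
  proof (induction rule: conn_induct)
    case (step y z)
    then have "y \<in> C" using that(1) by (auto simp: clus_def)
    then have "conn ?T y z" using step by (intro conn_edge) auto
    then show ?case using conn_trans[OF step.IH] by simp
  qed simp
  moreover have "conn T x y" if "conn ?T x y" for y using conn_mono[OF that] by auto
  ultimately show ?thesis unfolding clus_def by blast
qed

text \<open>The last vertex of a path from \<open>x\<close> to \<open>y\<close> in the cluster \<open>C\<close> of \<open>x\<close> inside \<open>W\<close>
  is followed by an edge leaving \<open>W\<close> and then by a path avoiding \<open>C\<close>; given \<open>C\<close>, these last two are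
  independent of each other and of the edges explored so far.\<close>

lemma last_exit:
  assumes "S \<subseteq> edges V" "C = clus (S \<inter> edges W) x" "conn S x y" "y \<notin> C" "x \<in> W"
  shows "\<exists>a\<in>C. \<exists>b\<in>V - W. {a, b} \<in> S \<and> conn {e \<in> S. e \<inter> C = {}} b y"
proof -
  have "y \<in> C \<or> (\<exists>a\<in>C. \<exists>b. b \<notin> C \<and> {a, b} \<in> S \<and> a \<noteq> b \<and> conn {e \<in> S. e \<inter> C = {}} b y)"
    using assms(3)
  proof (induction rule: conn_induct)
    case refl
    then show ?case using assms(2) by simp
  next
    case (step y z)
    show ?case
    proof (cases "z \<in> C \<or> y \<in> C")
      case True
      then show ?thesis using step conn_refl by blast
    next
      case False
      then obtain a b where ab: "a \<in> C" "b \<notin> C" "{a, b} \<in> S" "a \<noteq> b" "conn {e \<in> S. e \<inter> C = {}} b y"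
        using step by blast
      have "conn {e \<in> S. e \<inter> C = {}} y z" using step False by (intro conn_edge) auto
      then show ?thesis using ab conn_trans[OF ab(5)] by blast
    qed
  qed
  then obtain a b where ab: "a \<in> C" "b \<notin> C" "{a, b} \<in> S" "a \<noteq> b" "conn {e \<in> S. e \<inter> C = {}} b y"
    using assms(4) by blast
  have CW: "C \<subseteq> W" unfolding assms(2) using assms(5) by (intro clus_subset) auto
  have "b \<notin> W"
  proof
    assume "b \<in> W"
    then have "conn (S \<inter> edges W) a b" using ab CW by (intro conn_edge) (auto simp: edges_pair)
    then have "b \<in> C" using ab(1) conn_trans[of "S \<inter> edges W" x a b] assms(2) by (auto simp: clus_def)
    then show False using ab by simp
  qed
  moreover have "b \<in> V" using ab assms(1) edges_pair[of a b V] by auto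
  ultimately show ?thesis using ab by blast
qed

lemma sum_clusters_eq:
  assumes "finite W" "x \<in> W" "T \<subseteq> edges W"
  shows "(\<Sum>C\<in>Pow W. of_bool (a \<in> C) * of_bool (clus T x = C)) = (of_bool (conn T x a) :: real)"
proof -
  have CW: "clus T x \<in> Pow W" using clus_subset[OF assms(3,2)] by simp
  have "(\<Sum>C\<in>Pow W. of_bool (a \<in> C) * of_bool (clus T x = C))
      = (\<Sum>C\<in>Pow W. if C = clus T x then of_bool (a \<in> C) else (0::real))"
    by (intro sum.cong) auto
  also have "\<dots> = of_bool (a \<in> clus T x)" using CW assms(1) by simp
  finally show ?thesis by (simp add: clus_def)
qed

text \<open>Obtained by summing \<open>last_exit\<close> over the values \<open>C\<close> of the
  cluster of \<open>x\<close> in \<open>W\<close>. For fixed \<open>C\<close> the three events live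
  on disjoint sets: the edges of \<open>W\<close> meeting \<open>C\<close>, the edge
  \<open>{a, b}\<close>, and the edges avoiding \<open>C\<close>. Dropping the last restriction
  gives \<open>tau p V b y\<close>.\<close>

lemma tau_decomposition:
  assumes "finite V" "W \<subseteq> V" "probs p" "x \<in> W"
  shows "tau p V x y \<le> tau p W x y + (\<Sum>a\<in>W. \<Sum>b\<in>V - W. tau p W x a * p {a, b} * tau p V b y)"
proof -
  let ?E = "edges V"
  let ?f = "\<lambda>C S. of_bool (clus (S \<inter> edges W) x = C) :: real"
  let ?g = "\<lambda>a b S. of_bool ({a, b} \<in> S) :: real"
  let ?h = "\<lambda>C b S. of_bool (conn {e \<in> S. e \<inter> C = {}} b y) :: real"
  have finW: "finite W" using finite_subset[OF assms(2,1)] .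
  have EW: "edges W \<subseteq> ?E" using assms edges_mono by auto
  have pt: "of_bool (conn S x y) \<le> of_bool (conn (S \<inter> edges W) x y)
      + (\<Sum>C\<in>Pow W. \<Sum>a\<in>W. \<Sum>b\<in>V - W. of_bool (a \<in> C) * (?f C S * (?g a b S * ?h C b S)))"
    if S: "S \<subseteq> ?E" for S
  proof -
    define C where "C = clus (S \<inter> edges W) x"
    let ?F = "\<lambda>C a b. of_bool (a \<in> C) * (?f C S * (?g a b S * ?h C b S))"
    have nn: "0 \<le> (\<Sum>C\<in>Pow W. \<Sum>a\<in>W. \<Sum>b\<in>V - W. ?F C a b)"
      by (intro sum_nonneg) auto
    show ?thesis
    proof (cases "conn S x y \<and> y \<notin> C")
      case True
      then obtain a b where ab: "a \<in> C" "b \<in> V - W" "{a, b} \<in> S" "conn {e \<in> S. e \<inter> C = {}} b y"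
        using last_exit[OF S C_def, of y] assms by blast
      have CW: "C \<subseteq> W" unfolding C_def using assms by (intro clus_subset) auto
      have "1 = ?F C a b" using ab by (simp add: C_def)
      also have "\<dots> \<le> (\<Sum>b\<in>V - W. ?F C a b)" using ab assms(1) by (intro member_le_sum) auto
      also have "\<dots> \<le> (\<Sum>a\<in>W. \<Sum>b\<in>V - W. ?F C a b)"
        using ab CW finW by (intro member_le_sum[of a W "\<lambda>a. \<Sum>b\<in>V - W. ?F C a b"]) (auto intro!: sum_nonneg)
      also have "\<dots> \<le> (\<Sum>C\<in>Pow W. \<Sum>a\<in>W. \<Sum>b\<in>V - W. ?F C a b)"
        using CW finW by (intro member_le_sum[of C "Pow W" "\<lambda>C. \<Sum>a\<in>W. \<Sum>b\<in>V - W. ?F C a b"]) (auto intro!: sum_nonneg)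
      finally show ?thesis using True by simp
    next
      case False
      then have "conn S x y \<Longrightarrow> conn (S \<inter> edges W) x y" by (auto simp: C_def clus_def)
      then show ?thesis using nn by auto
    qed
  qed
  have summand: "expec p ?E (\<lambda>S. ?f C S * (?g a b S * ?h C b S)) \<le> expec p ?E (?f C) * (p {a, b} * tau p V b y)"
    if C: "C \<subseteq> W" "a \<in> C" "b \<in> V - W" for C a b
  proof -
    let ?A = "{e \<in> edges W. e \<inter> C \<noteq> {}}" and ?B = "{e \<in> ?E. e \<inter> C = {}}"
    have ab: "{a, b} \<notin> edges W" "{a, b} \<in> ?E" "{a, b} \<inter> C \<noteq> {}"
      using C assms(2) by (auto simp: edges_pair)
    have "expec p ?E (\<lambda>S. ?f C S * (?g a b S * ?h C b S)) = expec p ?E (?f C) * expec p ?E (\<lambda>S. ?g a b S * ?h C b S)"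
    proof (rule expec_indep[where A = ?A and B = "insert {a, b} ?B"])
      fix S :: "'a set set" assume "S \<subseteq> ?E"
      have "S \<inter> ?A \<inter> edges W = {e \<in> S \<inter> edges W. e \<inter> C \<noteq> {}}" by auto
      then show "?f C S = ?f C (S \<inter> ?A)"
        using clus_touching[of "S \<inter> edges W" x C] by simp
    next
      fix S :: "'a set set" assume "S \<subseteq> ?E"
      then have "{e \<in> S \<inter> insert {a, b} ?B. e \<inter> C = {}} = {e \<in> S. e \<inter> C = {}}" using ab by auto
      then show "?g a b S * ?h C b S = ?g a b (S \<inter> insert {a, b} ?B) * ?h C b (S \<inter> insert {a, b} ?B)"
        by simp
    qed (use assms ab in auto)
    also have "expec p ?E (\<lambda>S. ?g a b S * ?h C b S) = expec p ?E (?g a b) * expec p ?E (?h C b)"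
    proof (rule expec_indep[where A = "{{a, b}}" and B = ?B])
      fix S :: "'a set set" assume "S \<subseteq> ?E"
      then have "{e \<in> S \<inter> ?B. e \<inter> C = {}} = {e \<in> S. e \<inter> C = {}}" by auto
      then show "?h C b S = ?h C b (S \<inter> ?B)" by simp
    qed (use assms ab in auto)
    also have "expec p ?E (?g a b) = p {a, b}" using ab assms by (intro expec_edge) auto
    also have "expec p ?E (?f C) * (p {a, b} * expec p ?E (?h C b)) \<le> expec p ?E (?f C) * (p {a, b} * tau p V b y)"
    proof -
      have "expec p ?E (?h C b) \<le> tau p V b y"
        unfolding tau_def
      proof (rule expec_mono[OF assms(3)])
        fix S show "?h C b S \<le> of_bool (conn S b y)"
          using conn_mono[of "{e \<in> S. e \<inter> C = {}}" b y S] by auto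
      qed
      then show ?thesis using assms
        by (intro mult_left_mono expec_nonneg) (auto simp: probs_def)
    qed
    finally show ?thesis .
  qed
  \<comment> \<open>The values of the cluster partition the event that \<open>x\<close> is joined to
    \<open>a\<close> inside \<open>W\<close>, so the sum over \<open>C\<close> can be
    undone.\<close>
  have tW: "tau p W x a = (\<Sum>C\<in>Pow W. of_bool (a \<in> C) * expec p ?E (?f C))" for a
  proof -
    have "(\<Sum>C\<in>Pow W. of_bool (a \<in> C) * expec p ?E (?f C)) =
        expec p ?E (\<lambda>S. \<Sum>C\<in>Pow W. of_bool (a \<in> C) * ?f C S)"
      by (simp only: expec_sum expec_cmult)
    also have "\<dots> = expec p ?E (\<lambda>S. of_bool (conn (S \<inter> edges W) x a))"
      using sum_clusters_eq[OF finW assms(4), of "_ \<inter> edges W" a] by (intro expec_cong) auto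
    also have "\<dots> = expec p (edges W) (\<lambda>S. of_bool (conn (S \<inter> edges W) x a))"
      using assms EW by (intro expec_marginal) auto
    also have "\<dots> = tau p W x a"
      unfolding tau_def by (intro expec_cong) (simp add: Int_absorb2)
    finally show ?thesis ..
  qed
  have "tau p V x y \<le> expec p ?E (\<lambda>S. of_bool (conn (S \<inter> edges W) x y)
      + (\<Sum>C\<in>Pow W. \<Sum>a\<in>W. \<Sum>b\<in>V - W. of_bool (a \<in> C) * (?f C S * (?g a b S * ?h C b S))))"
    unfolding tau_def using pt assms by (intro expec_mono) auto
  also have "\<dots> = expec p ?E (\<lambda>S. of_bool (conn (S \<inter> edges W) x y))
      + (\<Sum>C\<in>Pow W. \<Sum>a\<in>W. \<Sum>b\<in>V - W. of_bool (a \<in> C) * expec p ?E (\<lambda>S. ?f C S * (?g a b S * ?h C b S)))"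
    by (simp only: expec_add expec_sum expec_cmult)
  also have "expec p ?E (\<lambda>S. of_bool (conn (S \<inter> edges W) x y)) = expec p (edges W) (\<lambda>S. of_bool (conn (S \<inter> edges W) x y))"
    using assms EW by (intro expec_marginal) auto
  also have "\<dots> = tau p W x y"
    unfolding tau_def by (intro expec_cong) (simp add: Int_absorb2)
  also have "(\<Sum>C\<in>Pow W. \<Sum>a\<in>W. \<Sum>b\<in>V - W. of_bool (a \<in> C) * expec p ?E (\<lambda>S. ?f C S * (?g a b S * ?h C b S)))
     \<le> (\<Sum>C\<in>Pow W. \<Sum>a\<in>W. \<Sum>b\<in>V - W. of_bool (a \<in> C) * (expec p ?E (?f C) * (p {a, b} * tau p V b y)))"
  proof (intro sum_mono)
    fix C a b assume "C \<in> Pow W" "a \<in> W" "b \<in> V - W"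
    then show "of_bool (a \<in> C) * expec p ?E (\<lambda>S. ?f C S * (?g a b S * ?h C b S))
      \<le> of_bool (a \<in> C) * (expec p ?E (?f C) * (p {a, b} * tau p V b y))"
      using summand[of C a b] by (cases "a \<in> C") auto
  qed
  also have "\<dots> = (\<Sum>a\<in>W. \<Sum>b\<in>V - W. tau p W x a * p {a, b} * tau p V b y)"
    unfolding tW sum_distrib_right
    by (subst sum.swap, rule sum.cong[OF refl], subst sum.swap) (simp add: mult.assoc)
  finally show ?thesis by simp
qed

section \<open>Truncated cluster sizes and joining two clusters by an edge\<close>

text \<open>Truncating at \<open>n\<close> keeps the mean number of open edges between two clusters
  of order at most \<open>j * n ^ 2\<close>, so that the joining probability stays comparable to
  this mean.\<close>

definition trunc_mean :: "('v set \<Rightarrow> real) \<Rightarrow> 'v set \<Rightarrow> nat \<Rightarrow> 'v \<Rightarrow> real" where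
  "trunc_mean p V n u = expec p (edges V) (\<lambda>S. real (min (card (clus S u)) n))"

lemma trunc_mean_mono:
  assumes "probs p" "finite V" "W \<subseteq> V" "u \<in> W"
  shows "trunc_mean p W n u \<le> trunc_mean p V n u"
  unfolding trunc_mean_def
proof (rule expec_mono_set)
  fix S T assume "S \<subseteq> T" "T \<subseteq> edges V"
  then have "clus S u \<subseteq> clus T u" "clus T u \<subseteq> V"
    using clus_mono[of S T u] clus_subset[of T V u] assms(3,4) by auto
  moreover from this have "finite (clus T u)" using assms(2) by (auto intro: finite_subset)
  ultimately show "real (min (card (clus S u)) n) \<le> real (min (card (clus T u)) n)"
    using card_mono by (metis min.mono order_refl of_nat_le_iff)
qed (use assms edges_mono in auto)

lemma sum_trunc_mean_ge:
  assumes "probs p" "finite V"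
  shows "(\<Sum>u\<in>V. \<Sum>w\<in>V. tau p V u w) -
      expec p (edges V) (\<lambda>S. \<Sum>x\<in>V. real (card (clus S x)) * of_bool (n < card (clus S x)))
    \<le> (\<Sum>u\<in>V. trunc_mean p V n u)"
proof -
  have "(\<Sum>u\<in>V. \<Sum>w\<in>V. tau p V u w) = expec p (edges V) (\<lambda>S. \<Sum>u\<in>V. real (card (clus S u)))"
    using assms by (simp add: sum_tau_eq expec_sum)
  also have "\<dots> - expec p (edges V) (\<lambda>S. \<Sum>x\<in>V. real (card (clus S x)) * of_bool (n < card (clus S x)))
    = expec p (edges V) (\<lambda>S. (\<Sum>u\<in>V. real (card (clus S u))) - (\<Sum>x\<in>V. real (card (clus S x)) * of_bool (n < card (clus S x))))"
    by (simp only: expec_diff)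
  also have "\<dots> \<le> expec p (edges V) (\<lambda>S. \<Sum>u\<in>V. real (min (card (clus S u)) n))"
    unfolding sum_subtractf[symmetric] using assms by (intro expec_mono sum_mono) auto
  finally show ?thesis by (simp add: trunc_mean_def expec_sum)
qed

lemma one_minus_exp_ge:
  assumes "0 \<le> (t::real)" shows "t / (1 + t) \<le> 1 - exp (- t)"
proof -
  have "1 + t \<le> exp t" by (rule exp_ge_add_one_self)
  then have "exp (- t) \<le> 1 / (1 + t)" using assms by (simp add: exp_minus field_simps)
  moreover have "1 - 1 / (1 + t) = t / (1 + t)" using assms by (simp add: field_simps)
  ultimately show ?thesis by linarith
qed

lemma prod_cross_le:
  assumes "finite A" "finite B" "A \<inter> B = {}" "probs p"
    and j: "\<And>a b. a \<in> A \<Longrightarrow> b \<in> B \<Longrightarrow> 1 - p {a, b} \<le> exp (- j)"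
  shows "(\<Prod>e\<in>(\<lambda>(a, b). {a, b}) ` (A \<times> B). 1 - p e) \<le> exp (- (j * real (card A * card B)))"
proof -
  let ?F = "(\<lambda>(a, b). {a, b}) ` (A \<times> B)"
  have inj: "inj_on (\<lambda>(a, b). {a, b}) (A \<times> B)"
    using assms(3) by (auto simp: inj_on_def doubleton_eq_iff)
  have "(\<Prod>e\<in>?F. 1 - p e) \<le> (\<Prod>e\<in>?F. exp (- j))"
    using j assms(4) by (intro prod_mono) (auto simp: probs_def)
  also have "\<dots> = exp (- j) ^ (card A * card B)"
    using inj by (simp add: card_image card_cartesian_product)
  also have "\<dots> = exp (- (j * real (card A * card B)))"
    by (simp add: exp_of_nat_mult[symmetric] mult.commute)
  finally show ?thesis .
qed

text \<open>The cluster of \<open>u\<close> in \<open>V1\<close>, that of \<open>w\<close> in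
  \<open>V2\<close> and the edges between \<open>V1\<close> and \<open>V2\<close> are independent.
  Given the clusters, a direct edge fails to exist with probability at most
  \<open>exp (- j * |A| * |B|)\<close>.\<close>

lemma tau_ge_trunc_mean:
  assumes "finite V" "V1 \<subseteq> V" "V2 \<subseteq> V" "V1 \<inter> V2 = {}" "u \<in> V1" "w \<in> V2" "probs p" "0 \<le> j"
    and j: "\<And>a b. a \<in> V1 \<Longrightarrow> b \<in> V2 \<Longrightarrow> 1 - p {a, b} \<le> exp (- j)"
  shows "j / (1 + j * (real n)\<^sup>2) * (trunc_mean p V1 n u * trunc_mean p V2 n w) \<le> tau p V u w"
proof -
  let ?E0 = "edges V1 \<union> edges V2" and ?X = "(\<lambda>(a, b). {a, b}) ` (V1 \<times> V2)"
  have fin: "finite V1" "finite V2"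
    using finite_subset[OF assms(2,1)] finite_subset[OF assms(3,1)] by auto
  have dis: "edges V1 \<inter> edges V2 = {}" using assms by (intro edges_disjoint)
  have X0: "?E0 \<inter> ?X = {}" using assms(4) by (auto simp: edges_def doubleton_eq_iff)
  have XV: "?X \<subseteq> edges V" using assms by (auto intro!: edgesI)
  let ?A = "\<lambda>S. clus (S \<inter> edges V1) u" and ?B = "\<lambda>S. clus (S \<inter> edges V2) w"
  let ?m = "\<lambda>S. real (min (card (?A S)) n) * real (min (card (?B S)) n)"
  have pt: "j / (1 + j * (real n)\<^sup>2) * ?m S \<le> expec p ?X (\<lambda>T. of_bool (conn (S \<union> T) u w))" for S
  proof -
    have AV: "?A S \<subseteq> V1" "?B S \<subseteq> V2"
      by (rule clus_subset[OF Int_lower2], rule assms)+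
    have finAB: "finite (?A S)" "finite (?B S)"
      using finite_subset[OF AV(1) fin(1)] finite_subset[OF AV(2) fin(2)] by auto
    let ?F = "(\<lambda>(a, b). {a, b}) ` (?A S \<times> ?B S)"
    have FX: "?F \<subseteq> ?X" using AV by auto
    let ?t = "j * real (card (?A S) * card (?B S))"
    let ?t' = "j * ?m S"
    \<comment> \<open>The truncation is used here: the variable denominator in
      \<open>t / (1 + t)\<close> is replaced by the constant \<open>1 + j * n ^ 2\<close>, leaving a
      bound linear in the product of the sizes.\<close>
    have "?m S \<le> real n * real n" by (intro mult_mono) auto
    then have "?t' \<le> j * (real n)\<^sup>2" unfolding power2_eq_square using assms by (intro mult_left_mono)
    moreover have t'0: "0 \<le> ?t'" using assms by simp
    ultimately have "?t' / (1 + j * (real n)\<^sup>2) \<le> ?t' / (1 + ?t')"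
      by (intro divide_left_mono mult_pos_pos) auto
    also have "\<dots> \<le> 1 - exp (- ?t')" using t'0 by (rule one_minus_exp_ge)
    also have "\<dots> \<le> 1 - exp (- ?t)"
    proof -
      have "?m S \<le> real (card (?A S)) * real (card (?B S))" by (intro mult_mono) auto
      then have "?t' \<le> ?t" unfolding of_nat_mult using assms by (intro mult_left_mono) 
      then show ?thesis by simp
    qed
    also have "\<dots> \<le> 1 - (\<Prod>e\<in>?F. 1 - p e)"
      using prod_cross_le[OF finAB, of p j] AV assms(4,7) j by fastforce
    also have "(\<Prod>e\<in>?F. 1 - p e) = expec p ?X (\<lambda>T. of_bool (T \<inter> ?F = {}))"
      using fin FX by (intro expec_avoid[symmetric]) auto
    also have "1 - \<dots> = expec p ?X (\<lambda>T. 1 - of_bool (T \<inter> ?F = {}))"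
      using fin by (simp add: expec_diff expec_const)
    also have "\<dots> \<le> expec p ?X (\<lambda>T. of_bool (conn (S \<union> T) u w))"
    proof (rule expec_mono[OF assms(7)])
      fix T
      have "conn (S \<union> T) u w" if "T \<inter> ?F \<noteq> {}"
      proof -
        obtain a b where ab: "a \<in> ?A S" "b \<in> ?B S" "{a, b} \<in> T" using \<open>T \<inter> ?F \<noteq> {}\<close> by auto
        have "conn (S \<union> T) u a" using ab(1) conn_mono[of _ u a "S \<union> T"] by (auto simp: clus_def)
        moreover have "conn (S \<union> T) a b" using ab by (intro conn_edge) auto
        moreover have "conn (S \<union> T) w b" using ab(2) conn_mono[of _ w b "S \<union> T"] by (auto simp: clus_def)
        ultimately show ?thesis using conn_trans conn_sym by metis
      qed
      then show "1 - (of_bool (T \<inter> ?F = {}) :: real) \<le> of_bool (conn (S \<union> T) u w)" by auto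
    qed
    finally show ?thesis by (simp add: algebra_simps)
  qed
  have "j / (1 + j * (real n)\<^sup>2) * (trunc_mean p V1 n u * trunc_mean p V2 n w)
    = j / (1 + j * (real n)\<^sup>2) * expec p ?E0 ?m"
  proof -
    have "expec p ?E0 ?m = expec p ?E0 (\<lambda>S. real (min (card (?A S)) n)) * expec p ?E0 (\<lambda>S. real (min (card (?B S)) n))"
      using fin dis by (intro expec_indep[where A = "edges V1" and B = "edges V2"]) (auto simp: Int_assoc)
    also have "expec p ?E0 (\<lambda>S. real (min (card (?A S)) n)) = expec p (edges V1) (\<lambda>S. real (min (card (?A S)) n))"
      using fin by (intro expec_marginal) (auto simp: Int_assoc)
    also have "\<dots> = trunc_mean p V1 n u"
      unfolding trunc_mean_def by (intro expec_cong) (simp add: Int_absorb2)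
    also have "expec p ?E0 (\<lambda>S. real (min (card (?B S)) n)) = expec p (edges V2) (\<lambda>S. real (min (card (?B S)) n))"
      using fin by (intro expec_marginal) (auto simp: Int_assoc)
    also have "\<dots> = trunc_mean p V2 n w"
      unfolding trunc_mean_def by (intro expec_cong) (simp add: Int_absorb2)
    finally show ?thesis by simp
  qed
  also have "\<dots> = expec p ?E0 (\<lambda>S. j / (1 + j * (real n)\<^sup>2) * ?m S)" by (rule expec_cmult[symmetric])
  also have "\<dots> \<le> expec p ?E0 (\<lambda>S. expec p ?X (\<lambda>T. of_bool (conn (S \<union> T) u w)))"
    using assms pt by (intro expec_mono) auto
  also have "\<dots> = expec p (?E0 \<union> ?X) (\<lambda>S. of_bool (conn S u w))"
    using fin X0 by (intro expec_Un[symmetric]) auto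
  also have "\<dots> \<le> tau p V u w"
    unfolding tau_def
  proof (rule expec_mono_set)
    fix S T :: "'a set set" assume "S \<subseteq> T"
    then show "(of_bool (conn S u w) :: real) \<le> of_bool (conn T u w)" using conn_mono by auto
  next
    show "?E0 \<union> ?X \<subseteq> edges V" using XV assms edges_mono by (metis Un_least)
  qed (use assms in auto)
  finally show ?thesis .
qed

subsection \<open>Relabelling the vertices\<close>

lemma edges_image:
  assumes "inj t"
  shows "edges (t ` V) = (`) t ` edges V"
proof -
  have "e \<in> (`) t ` edges V" if e: "e \<in> edges (t ` V)" for e
  proof -
    obtain x y where xy: "e = {t x, t y}" "x \<in> V" "y \<in> V" "t x \<noteq> t y"
      using e by (auto simp: edges_def)
    then have "{x, y} \<in> edges V" by (intro edgesI) auto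
    moreover have "e = t ` {x, y}" using xy by simp
    ultimately show ?thesis by (rule rev_image_eqI)
  qed
  moreover have "t ` e \<in> edges (t ` V)" if e: "e \<in> edges V" for e
  proof -
    obtain x y where xy: "e = {x, y}" "x \<in> V" "y \<in> V" "x \<noteq> y"
      using e by (auto simp: edges_def)
    then have "t x \<noteq> t y" using assms by (auto dest: injD)
    then show ?thesis using xy edgesI[of "t x" "t ` V" "t y"] by simp
  qed
  ultimately show ?thesis by blast
qed

lemma conn_image_aux: "conn S x y \<Longrightarrow> conn ((`) t ` S) (t x) (t y)"
proof (induction rule: conn_induct)
  case (step y z)
  then have "conn ((`) t ` S) (t y) (t z)" by (intro conn_edge) (auto simp: image_iff intro!: bexI[of _ "{y, z}"])
  then show ?case using conn_trans[OF step.IH] by simp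
qed simp

lemma conn_image:
  assumes "inj t" shows "conn ((`) t ` S) (t x) (t y) \<longleftrightarrow> conn S x y"
proof
  assume "conn ((`) t ` S) (t x) (t y)"
  then have "conn ((`) (inv t) ` (`) t ` S) (inv t (t x)) (inv t (t y))" by (rule conn_image_aux)
  moreover have "(`) (inv t) ` (`) t ` S = S" using assms by (simp add: image_image image_comp)
  ultimately show "conn S x y" using assms by simp
qed (rule conn_image_aux)

lemma clus_image:
  assumes "bij t" shows "clus ((`) t ` S) (t x) = t ` clus S x"
proof -
  have i: "inj t" and s: "surj t" using assms bij_is_inj bij_is_surj by auto
  show ?thesis
  proof (intro set_eqI)
    fix y
    obtain z where z: "y = t z" using s by (auto simp: surj_def)
    show "y \<in> clus ((`) t ` S) (t x) \<longleftrightarrow> y \<in> t ` clus S x"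
      using conn_image[OF i, of S x z] z injD[OF i] by (auto simp: clus_def)
  qed
qed

lemma big_image:
  assumes "bij t" shows "big n ((`) t ` S) \<longleftrightarrow> big n S"
proof -
  have i: "inj t" and s: "surj t" using assms bij_is_inj bij_is_surj by auto
  show ?thesis
  proof
    assume "big n S"
    then obtain U u where "finite U" "n < card U" "U \<subseteq> clus S u" by (auto simp: big_def)
    then show "big n ((`) t ` S)"
      unfolding big_def using i clus_image[OF assms, of S u]
      by (intro exI[of _ "t ` U"] exI[of _ "t u"]) (auto simp: card_image inj_on_subset)
  next
    assume "big n ((`) t ` S)"
    then obtain U u where U: "finite U" "n < card U" "U \<subseteq> clus ((`) t ` S) u" by (auto simp: big_def)
    obtain v where v: "u = t v" using s by (auto simp: surj_def)
    have U': "U \<subseteq> t ` clus S v" using U v clus_image[OF assms] by simp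
    then obtain W where W: "W \<subseteq> clus S v" "U = t ` W" by (meson subset_imageE)
    have "card U = card W" using W i by (simp add: card_image inj_on_subset)
    moreover have "finite W" using U W i by (metis finite_imageD inj_on_subset subset_UNIV)
    ultimately show "big n S" using U W unfolding big_def by auto
  qed
qed

lemma expec_relabel:
  assumes "bij t" "finite V" "\<And>e. e \<in> edges V \<Longrightarrow> p (t ` e) = p e"
  shows "expec p (edges (t ` V)) f = expec p (edges V) (\<lambda>S. f ((`) t ` S))"
proof -
  have i: "inj t" using assms bij_is_inj by auto
  then have "inj_on ((`) t) (edges V)" by (auto simp: inj_on_def inj_image_eq_iff)
  then have "expec p ((`) t ` edges V) f = expec (p \<circ> (`) t) (edges V) (\<lambda>S. f ((`) t ` S))"
    using assms(2) by (intro expec_image) auto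
  also have "\<dots> = expec p (edges V) (\<lambda>S. f ((`) t ` S))"
    using assms by (intro expec_cong_prob) auto
  finally show ?thesis by (simp add: edges_image i)
qed

lemma tau_relabel:
  assumes "bij t" "finite V" "\<And>e. e \<in> edges V \<Longrightarrow> p (t ` e) = p e"
  shows "tau p (t ` V) (t x) (t y) = tau p V x y"
  unfolding tau_def using conn_image[OF bij_is_inj[OF assms(1)], of _ x y]
  by (subst expec_relabel[where f = "\<lambda>S. of_bool (conn S (t x) (t y))"]) (use assms in auto)

lemma trunc_mean_relabel:
  assumes "bij t" "finite V" "\<And>e. e \<in> edges V \<Longrightarrow> p (t ` e) = p e"
  shows "trunc_mean p (t ` V) n (t x) = trunc_mean p V n x"
proof -
  have "card (clus ((`) t ` S) (t x)) = card (clus S x)" for S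
    using bij_is_inj[OF assms(1)] clus_image[OF assms(1), of S x] by (simp add: card_image inj_on_subset)
  then show ?thesis unfolding trunc_mean_def
    by (subst expec_relabel[where f = "\<lambda>S. real (min (card (clus S (t x))) n)"]) (use assms in auto)
qed

lemma bigprob_relabel:
  assumes "bij t" "finite V" "\<And>e. e \<in> edges V \<Longrightarrow> p (t ` e) = p e"
  shows "bigprob p (t ` V) n = bigprob p V n"
  unfolding bigprob_def using big_image[OF assms(1), of n]
  by (subst expec_relabel[where f = "\<lambda>S. of_bool (big n S)"]) (use assms in auto)

subsection \<open>The lattice\<close>

text \<open>A version of \<open>linf_norm\<close> with values in the naturals (see
  \<open>linf_norm_eq\<close>), so that balls have integer radii and can be counted.\<close>

definition sup_norm :: "int ^ 'd::finite \<Rightarrow> nat" where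
  "sup_norm x = Max (range (\<lambda>i. nat \<bar>x $ i\<bar>))"

lemma sup_norm_le_iff: "sup_norm x \<le> k \<longleftrightarrow> (\<forall>i. \<bar>x $ i\<bar> \<le> int k)"
proof -
  have "sup_norm x \<le> k \<longleftrightarrow> (\<forall>i. nat \<bar>x $ i\<bar> \<le> k)" unfolding sup_norm_def by simp
  then show ?thesis by (simp add: nat_le_iff)
qed

lemma sup_norm_component: "\<bar>x $ i\<bar> \<le> int (sup_norm x)"
  using sup_norm_le_iff[of x "sup_norm x"] by simp

lemma linf_norm_eq: "linf_norm x = real (sup_norm x)"
proof (rule antisym)
  let ?y = "\<chi> i. real_of_int (x $ i)"
  have inf: "linf_norm x = Max (range (\<lambda>i. \<bar>?y $ i\<bar>))"
  proof -
    have "linf_norm x = Max ((\<lambda>i. \<bar>?y \<bullet> i\<bar>) ` Basis)" unfolding linf_norm_def infnorm_Max ..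
    also have "(\<lambda>i. \<bar>?y \<bullet> i\<bar>) ` Basis = range (\<lambda>i. \<bar>?y $ i\<bar>)"
      by (auto simp: Basis_vec_def inner_axis image_iff)
    finally show ?thesis .
  qed
  show "linf_norm x \<le> real (sup_norm x)"
    unfolding inf
  proof (rule Max.boundedI)
    fix a assume "a \<in> range (\<lambda>i. \<bar>?y $ i\<bar>)"
    then obtain i where "a = real_of_int \<bar>x $ i\<bar>" by auto
    then show "a \<le> real (sup_norm x)" using sup_norm_component[of x i] by linarith
  qed auto
  obtain i where "sup_norm x = nat \<bar>x $ i\<bar>"
    using Max_in[of "range (\<lambda>i. nat \<bar>x $ i\<bar>)"] unfolding sup_norm_def by fastforce
  then have "real (sup_norm x) = \<bar>?y $ i\<bar>" by simp
  also have "\<dots> \<le> linf_norm x" unfolding inf by (rule Max_ge) auto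
  finally show "real (sup_norm x) \<le> linf_norm x" .
qed

lemma sup_norm_0 [simp]: "sup_norm 0 = 0"
  using sup_norm_le_iff[of 0 0] by simp

lemma sup_norm_eq_0_iff [simp]: "sup_norm x = 0 \<longleftrightarrow> x = 0"
  using sup_norm_le_iff[of x 0] by (auto simp: vec_eq_iff)

lemma sup_norm_minus: "sup_norm (x - y) = sup_norm (y - x)"
proof -
  have "sup_norm (x - y) \<le> k \<longleftrightarrow> sup_norm (y - x) \<le> k" for k
    unfolding sup_norm_le_iff by (simp add: abs_minus_commute)
  then show ?thesis by (metis order_antisym order_refl)
qed

lemma sup_norm_add: "sup_norm (x + y) \<le> sup_norm x + sup_norm y"
  unfolding sup_norm_le_iff
proof
  fix i show "\<bar>(x + y) $ i\<bar> \<le> int (sup_norm x + sup_norm y)"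
    using sup_norm_component[of x i] sup_norm_component[of y i] by simp
qed

lemma sup_norm_triangle: "sup_norm (x - z) \<le> sup_norm (x - y) + sup_norm (y - z)"
  using sup_norm_add[of "x - y" "y - z"] by simp

lemma sup_norm_pos: "x \<noteq> y \<Longrightarrow> 1 \<le> sup_norm (x - y)"
  using sup_norm_eq_0_iff[of "x - y"] by (metis One_nat_def Suc_leI eq_iff_diff_eq_0 neq0_conv)

lemma vec_box_card:
  fixes A :: "'d::finite \<Rightarrow> int set"
  assumes "\<And>i. finite (A i)"
  shows "card {x. \<forall>i. x $ i \<in> A i} = (\<Prod>i\<in>UNIV. card (A i))" "finite {x. \<forall>i. x $ i \<in> A i}"
proof -
  have eq: "{x. \<forall>i. x $ i \<in> A i} = vec_lambda ` Pi\<^sub>E UNIV A"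
  proof
    show "{x. \<forall>i. x $ i \<in> A i} \<subseteq> vec_lambda ` Pi\<^sub>E UNIV A"
    proof
      fix x assume "x \<in> {x. \<forall>i. x $ i \<in> A i}"
      then have "vec_nth x \<in> Pi\<^sub>E UNIV A" by (auto simp: PiE_def)
      then show "x \<in> vec_lambda ` Pi\<^sub>E UNIV A" by (intro image_eqI[of _ _ "vec_nth x"]) auto
    qed
  qed auto
  have inj: "inj_on vec_lambda (Pi\<^sub>E UNIV A)" by (auto simp: inj_on_def vec_lambda_inject)
  show "card {x. \<forall>i. x $ i \<in> A i} = (\<Prod>i\<in>UNIV. card (A i))"
    unfolding eq by (simp add: card_image[OF inj] card_PiE)
  show "finite {x. \<forall>i. x $ i \<in> A i}"
    unfolding eq using assms by (intro finite_imageI finite_PiE) auto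
qed

definition lball :: "nat \<Rightarrow> int ^ 'd::finite \<Rightarrow> (int ^ 'd) set" where
  "lball r v = {x. sup_norm (x - v) \<le> r}"

text \<open>Half-open and anchored at the least corner, so that boxes of side \<open>s\<close> tile
  a box of side \<open>L * s\<close>.\<close>

definition lbox :: "nat \<Rightarrow> int ^ 'd::finite \<Rightarrow> (int ^ 'd) set" where
  "lbox s v = {x. \<forall>i. v $ i \<le> x $ i \<and> x $ i < v $ i + int s}"

lemma box_card: "card (lbox s (v :: int ^ 'd::finite)) = s ^ CARD('d)" and finite_box [simp]: "finite (lbox s v)"
proof -
  have *: "lbox s v = {x. \<forall>i. x $ i \<in> {v $ i..<v $ i + int s}}" by (auto simp: lbox_def)
  show "card (lbox s v) = s ^ CARD('d)" "finite (lbox s v)"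
    unfolding * by (subst vec_box_card(1), simp, simp) (rule vec_box_card(2), simp)
qed

lemma lball_eq_box: "lball r (v :: int ^ 'd::finite) = lbox (2 * r + 1) (v - vec (int r))"
  unfolding lball_def lbox_def sup_norm_le_iff by (auto simp: abs_le_iff) (smt (verit))+

lemma finite_lball [simp]: "finite (lball r v)"
  by (simp add: lball_eq_box)

lemma card_lball: "card (lball r (v :: int ^ 'd::finite)) = (2 * r + 1) ^ CARD('d)"
  by (simp add: lball_eq_box box_card)

lemma center_in_lball [simp]: "v \<in> lball r v"
  by (simp add: lball_def)

lemma lball_mono: "r \<le> s \<Longrightarrow> lball r v \<subseteq> lball s v"
  by (auto simp: lball_def)

lemma box_sup_norm_less:
  assumes "x \<in> lbox s v" "y \<in> lbox s v" shows "sup_norm (x - y) < s"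
proof -
  have "sup_norm (x - y) \<le> s - 1"
    unfolding sup_norm_le_iff
  proof
    fix i
    have "v $ i \<le> x $ i \<and> x $ i < v $ i + int s" "v $ i \<le> y $ i \<and> y $ i < v $ i + int s"
      using assms by (auto simp: lbox_def)
    then show "\<bar>(x - y) $ i\<bar> \<le> int (s - 1)" by simp linarith
  qed
  moreover have "0 < s"
  proof -
    obtain i :: 'a where True by simp
    have "v $ i \<le> x $ i \<and> x $ i < v $ i + int s" using assms by (auto simp: lbox_def)
    then show ?thesis by auto
  qed
  ultimately show ?thesis by simp
qed

lemma box_translate: "(\<lambda>x. x + z) ` lbox s v = lbox s (v + z)"
proof
  show "lbox s (v + z) \<subseteq> (\<lambda>x. x + z) ` lbox s v"
  proof
    fix x assume x: "x \<in> lbox s (v + z)"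
    have "x - z \<in> lbox s v" unfolding lbox_def
    proof (intro CollectI allI)
      fix i
      have "(v + z) $ i \<le> x $ i \<and> x $ i < (v + z) $ i + int s" using x by (auto simp: lbox_def)
      then show "v $ i \<le> (x - z) $ i \<and> (x - z) $ i < v $ i + int s" by simp
    qed
    then show "x \<in> (\<lambda>x. x + z) ` lbox s v" by (intro image_eqI[of _ _ "x - z"]) auto
  qed
qed (auto simp: lbox_def)

lemma lball_translate: "(\<lambda>x. x + z) ` lball s v = lball s (v + z)"
  by (simp add: lball_eq_box box_translate algebra_simps)

lemma bij_translate: "bij (\<lambda>x::int^'d. x + z)"
  by (rule o_bij[of "\<lambda>x. x - z"]) auto

text \<open>Stated for real radii because this is hypothesis \<open>H\<close> of the dyadic lemmas
  for the constant weight.\<close>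

lemma count_le:
  fixes F :: "(int ^ 'd::finite) set" and \<rho> :: real
  assumes "finite F" "1 \<le> \<rho>"
  shows "real (card {z \<in> F. real (sup_norm (z - a)) \<le> \<rho>}) \<le> 3 ^ CARD('d) * \<rho> powr CARD('d)"
proof -
  have "{z \<in> F. real (sup_norm (z - a)) \<le> \<rho>} \<subseteq> lball (nat \<lfloor>\<rho>\<rfloor>) a"
    by (auto simp: lball_def le_nat_floor)
  then have "card {z \<in> F. real (sup_norm (z - a)) \<le> \<rho>} \<le> (2 * nat \<lfloor>\<rho>\<rfloor> + 1) ^ CARD('d)"
    unfolding card_lball[of _ a, symmetric] by (rule card_mono[OF finite_lball])
  then have "real (card {z \<in> F. real (sup_norm (z - a)) \<le> \<rho>}) \<le> real ((2 * nat \<lfloor>\<rho>\<rfloor> + 1) ^ CARD('d))"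
    by (rule of_nat_mono)
  also have "\<dots> = (2 * real (nat \<lfloor>\<rho>\<rfloor>) + 1) ^ CARD('d)" by (simp add: add.commute)
  also have "\<dots> \<le> (3 * \<rho>) ^ CARD('d)"
  proof (rule power_mono)
    have "real (nat \<lfloor>\<rho>\<rfloor>) \<le> \<rho>" using assms by simp
    then show "2 * real (nat \<lfloor>\<rho>\<rfloor>) + 1 \<le> 3 * \<rho>" using assms by linarith
  qed simp
  also have "\<dots> = 3 ^ CARD('d) * \<rho> powr CARD('d)"
    using assms by (simp add: power_mult_distrib powr_realpow)
  finally show ?thesis .
qed

subsection \<open>Dyadic sums\<close>

lemma two_powr_less_one: "x < 0 \<Longrightarrow> 2 powr x < (1::real)"
  using powr_less_mono[of x 0 2] by simp

lemma geometric_sum_le: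
  fixes q :: real assumes "0 \<le> q" "q < 1"
  shows "(\<Sum>i<M. q ^ i) \<le> 1 / (1 - q)"
proof -
  have "(\<Sum>i<M. q ^ i) = (1 - q ^ M) / (1 - q)" using assms by (simp add: sum_gp_strict)
  also have "\<dots> \<le> 1 / (1 - q)" using assms by (intro divide_right_mono) auto
  finally show ?thesis .
qed

lemma sum_UN_le:
  fixes h :: "'a \<Rightarrow> real"
  assumes "finite I" "\<And>i. i \<in> I \<Longrightarrow> finite (A i)" "\<And>i x. i \<in> I \<Longrightarrow> x \<in> A i \<Longrightarrow> 0 \<le> h x"
  shows "(\<Sum>x\<in>(\<Union>i\<in>I. A i). h x) \<le> (\<Sum>i\<in>I. \<Sum>x\<in>A i. h x)"
  using assms
proof (induction I rule: finite_induct)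
  case (insert i I)
  have "0 \<le> (\<Sum>x\<in>A i \<inter> (\<Union>i\<in>I. A i). h x)" using insert.prems by (intro sum_nonneg) auto
  moreover have "(\<Sum>x\<in>A i \<union> (\<Union>i\<in>I. A i). h x) + (\<Sum>x\<in>A i \<inter> (\<Union>i\<in>I. A i). h x)
      = (\<Sum>x\<in>A i. h x) + (\<Sum>x\<in>(\<Union>i\<in>I. A i). h x)"
    using insert by (intro sum.union_inter) auto
  moreover have "(\<Sum>x\<in>(\<Union>i\<in>I. A i). h x) \<le> (\<Sum>i\<in>I. \<Sum>x\<in>A i. h x)"
    using insert by auto
  ultimately show ?case using insert by simp
qed simp

lemma two_pow_unbounded: "\<exists>M. x < 2 ^ M * (k::real)" if "0 < k"
proof -
  obtain M where "x / k < 2 ^ M" using real_arch_pow[of 2 "x / k"] by auto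
  then show ?thesis using that by (auto simp: field_simps)
qed

text \<open>On the shell between \<open>2 ^ i * k\<close> and twice that the sum is at most a
  constant times the power \<open>\<gamma> - p < 0\<close> of the inner radius, so the shells form a
  geometric series. The weight \<open>g\<close> is either 1 (counting lattice points) or a two-point
  function.\<close>

lemma dyadic_tail:
  fixes N :: "'a \<Rightarrow> nat" and g :: "'a \<Rightarrow> real"
  assumes "finite F" "\<And>z. z \<in> F \<Longrightarrow> 0 \<le> g z" "\<gamma> < p" "0 \<le> p" "1 \<le> k" "0 \<le> B"
    and H: "\<And>\<rho>. 1 \<le> \<rho> \<Longrightarrow> (\<Sum>z\<in>{z\<in>F. real (N z) \<le> \<rho>}. g z) \<le> B * \<rho> powr \<gamma>"
  shows "(\<Sum>z\<in>{z\<in>F. k \<le> real (N z)}. g z * real (N z) powr - p)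
    \<le> 2 powr \<gamma> / (1 - 2 powr (\<gamma> - p)) * B * k powr (\<gamma> - p)"
proof -
  let ?sh = "\<lambda>i. {z\<in>F. 2 ^ i * k \<le> real (N z) \<and> real (N z) < 2 ^ Suc i * k}"
  let ?h = "\<lambda>z. g z * real (N z) powr - p"
  let ?q = "2 powr (\<gamma> - p)"
  have q: "0 \<le> ?q" "?q < 1" using assms by (auto intro!: two_powr_less_one)
  obtain M where M: "Max (insert 0 ((real \<circ> N) ` F)) < 2 ^ M * k"
    using two_pow_unbounded[of k "Max (insert 0 ((real \<circ> N) ` F))"] assms(5) by (auto simp del: Max_less_iff)
  have NM: "real (N z) < 2 ^ M * k" if "z \<in> F" for z
  proof -
    have "real (N z) \<le> Max (insert 0 ((real \<circ> N) ` F))" using that assms(1) by (intro Max_ge) auto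
    then show ?thesis using M by simp
  qed
  have cover: "{z\<in>F. k \<le> real (N z)} \<subseteq> (\<Union>i\<in>{..<M}. ?sh i)"
  proof
    fix z assume z: "z \<in> {z\<in>F. k \<le> real (N z)}"
    define i where "i = (LEAST i. real (N z) < 2 ^ i * k)"
    have i: "real (N z) < 2 ^ i * k" unfolding i_def by (rule LeastI[of _ M]) (use NM z in auto)
    have iM: "i \<le> M" unfolding i_def by (rule Least_le) (use NM z in auto)
    obtain j where j: "i = Suc j" using i z by (cases i) auto
    have "\<not> real (N z) < 2 ^ j * k" using j not_less_Least[of j "\<lambda>i. real (N z) < 2 ^ i * k"] by (simp add: i_def)
    then show "z \<in> (\<Union>i\<in>{..<M}. ?sh i)" using z i j iM by (intro UN_I[of j]) auto
  qed
  have shell: "(\<Sum>z\<in>?sh i. ?h z) \<le> 2 powr \<gamma> * B * k powr (\<gamma> - p) * ?q ^ i" for i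
  proof -
    let ?r = "2 ^ i * k"
    have r: "1 \<le> ?r" using assms(5) mult_mono[of 1 "2^i" 1 k] by simp
    have "(\<Sum>z\<in>?sh i. ?h z) \<le> (\<Sum>z\<in>?sh i. g z * ?r powr - p)"
      using assms r by (intro sum_mono mult_left_mono powr_mono2') auto
    also have "\<dots> = (\<Sum>z\<in>?sh i. g z) * ?r powr - p" by (simp add: sum_distrib_right)
    also have "\<dots> \<le> (\<Sum>z\<in>{z\<in>F. real (N z) \<le> 2 * ?r}. g z) * ?r powr - p"
      using assms by (intro mult_right_mono sum_mono2) auto
    also have "\<dots> \<le> (B * (2 * ?r) powr \<gamma>) * ?r powr - p"
      using r by (intro mult_right_mono H) auto
    also have "\<dots> = 2 powr \<gamma> * B * ?r powr (\<gamma> - p)"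
      using r by (simp add: powr_mult powr_diff powr_minus field_simps)
    also have "?r powr (\<gamma> - p) = k powr (\<gamma> - p) * ?q ^ i"
      using assms by (simp add: powr_mult powr_realpow[symmetric] powr_powr mult.commute)
    finally show ?thesis by (simp add: algebra_simps)
  qed
  have "(\<Sum>z\<in>{z\<in>F. k \<le> real (N z)}. ?h z) \<le> (\<Sum>z\<in>(\<Union>i\<in>{..<M}. ?sh i). ?h z)"
    using assms cover by (intro sum_mono2) auto
  also have "\<dots> \<le> (\<Sum>i<M. \<Sum>z\<in>?sh i. ?h z)"
    using assms by (intro sum_UN_le) auto
  also have "\<dots> \<le> (\<Sum>i<M. 2 powr \<gamma> * B * k powr (\<gamma> - p) * ?q ^ i)"
    using shell by (intro sum_mono) auto
  also have "\<dots> = 2 powr \<gamma> * B * k powr (\<gamma> - p) * (\<Sum>i<M. ?q ^ i)"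
    by (simp add: sum_distrib_left)
  also have "\<dots> \<le> 2 powr \<gamma> * B * k powr (\<gamma> - p) * (1 / (1 - ?q))"
    using q assms by (intro mult_left_mono geometric_sum_le) auto
  finally show ?thesis by (simp add: algebra_simps)
qed

text \<open>The counterpart for \<open>p < \<gamma>\<close>: the shells shrink from \<open>k\<close>
  downwards and the outermost one dominates.\<close>

lemma dyadic_near:
  fixes N :: "'a \<Rightarrow> nat" and g :: "'a \<Rightarrow> real"
  assumes "finite F" "\<And>z. z \<in> F \<Longrightarrow> 0 \<le> g z" "p < \<gamma>" "0 \<le> p" "0 < k" "0 \<le> B"
    and H: "\<And>\<rho>. 1 \<le> \<rho> \<Longrightarrow> (\<Sum>z\<in>{z\<in>F. real (N z) \<le> \<rho>}. g z) \<le> B * \<rho> powr \<gamma>"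
  shows "(\<Sum>z\<in>{z\<in>F. 1 \<le> N z \<and> real (N z) \<le> k}. g z * real (N z) powr - p)
    \<le> 2 powr p / (1 - 2 powr (p - \<gamma>)) * B * k powr (\<gamma> - p)"
proof -
  let ?sh = "\<lambda>i. {z\<in>F. 1 \<le> N z \<and> k / 2 ^ Suc i < real (N z) \<and> real (N z) \<le> k / 2 ^ i}"
  let ?h = "\<lambda>z. g z * real (N z) powr - p"
  let ?q = "2 powr (p - \<gamma>)"
  have q: "0 \<le> ?q" "?q < 1" using assms by (auto intro!: two_powr_less_one)
  obtain M where M: "k < 2 ^ M * 1" using two_pow_unbounded[of 1 k] by auto
  have cover: "{z\<in>F. 1 \<le> N z \<and> real (N z) \<le> k} \<subseteq> (\<Union>i\<in>{..<M}. ?sh i)"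
  proof
    fix z assume z: "z \<in> {z\<in>F. 1 \<le> N z \<and> real (N z) \<le> k}"
    have zM: "k / 2 ^ M < real (N z)"
    proof -
      have "k / 2 ^ M < 1" using M by (simp add: field_simps)
      moreover have "1 \<le> real (N z)" using z by simp
      ultimately show ?thesis by linarith
    qed
    define i where "i = (LEAST i. k / 2 ^ i < real (N z))"
    have i: "k / 2 ^ i < real (N z)" unfolding i_def by (rule LeastI[of _ M]) (use zM in auto)
    have iM: "i \<le> M" unfolding i_def by (rule Least_le) (use zM in auto)
    obtain j where j: "i = Suc j" using i z by (cases i) auto
    have "\<not> k / 2 ^ j < real (N z)" using j not_less_Least[of j "\<lambda>i. k / 2 ^ i < real (N z)"] by (simp add: i_def)
    then show "z \<in> (\<Union>i\<in>{..<M}. ?sh i)" using z i j iM by (intro UN_I[of j]) auto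
  qed
  have shell: "(\<Sum>z\<in>?sh i. ?h z) \<le> 2 powr p * B * k powr (\<gamma> - p) * ?q ^ i" for i
  \<comment> \<open>\<open>H\<close> speaks only of radii at least 1. A shell of smaller outer
    radius is empty because \<open>N z\<close> is a positive integer on it.\<close>
  proof (cases "1 \<le> k / 2 ^ i")
    case False
    have "z \<notin> ?sh i" for z
    proof
      assume "z \<in> ?sh i"
      then have "1 \<le> N z" "real (N z) \<le> k / 2 ^ i" by blast+
      then show False using False of_nat_mono[of 1 "N z", where 'a = real] by simp
    qed
    then have e: "?sh i = {}" by blast
    show ?thesis unfolding e using assms q by simp
  next
    case r: True
    let ?r = "k / 2 ^ i"
    have "(\<Sum>z\<in>?sh i. ?h z) \<le> (\<Sum>z\<in>?sh i. g z * (?r / 2) powr - p)"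
      using assms r by (intro sum_mono mult_left_mono powr_mono2') auto
    also have "\<dots> = (\<Sum>z\<in>?sh i. g z) * (?r / 2) powr - p" by (simp add: sum_distrib_right)
    also have "\<dots> \<le> (\<Sum>z\<in>{z\<in>F. real (N z) \<le> ?r}. g z) * (?r / 2) powr - p"
      using assms by (intro mult_right_mono sum_mono2) auto
    also have "\<dots> \<le> (B * ?r powr \<gamma>) * (?r / 2) powr - p"
      using r by (intro mult_right_mono H) auto
    also have "\<dots> = 2 powr p * B * ?r powr (\<gamma> - p)"
    proof -
      have half: "(t / 2) powr - p = 2 powr p * t powr - p" if "0 < t" for t :: real
        using that by (simp add: powr_divide powr_minus field_simps)
      have "(?r / 2) powr - p = 2 powr p * ?r powr - p" by (rule half) (use assms in simp)
      moreover have "?r powr (\<gamma> - p) = ?r powr \<gamma> * ?r powr - p" using powr_add[of ?r \<gamma> "- p"] by simp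
      ultimately show ?thesis by simp
    qed
    also have "?r powr (\<gamma> - p) = k powr (\<gamma> - p) * ?q ^ i"
    proof -
      have "(2 ^ i :: real) powr (\<gamma> - p) = 2 powr (real i * (\<gamma> - p))"
        by (simp add: powr_realpow[symmetric] powr_powr)
      moreover have "?q ^ i = 2 powr (real i * (p - \<gamma>))"
        by (simp add: powr_realpow[symmetric] powr_powr mult.commute)
      moreover have "2 powr (real i * (p - \<gamma>)) = 1 / 2 powr (real i * (\<gamma> - p))"
        by (simp add: powr_minus_divide[symmetric] algebra_simps)
      ultimately show ?thesis using assms by (simp add: powr_divide)
    qed
    finally show ?thesis by (simp add: algebra_simps)
  qed
  have "(\<Sum>z\<in>{z\<in>F. 1 \<le> N z \<and> real (N z) \<le> k}. ?h z) \<le> (\<Sum>z\<in>(\<Union>i\<in>{..<M}. ?sh i). ?h z)"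
    using assms cover by (intro sum_mono2) auto
  also have "\<dots> \<le> (\<Sum>i<M. \<Sum>z\<in>?sh i. ?h z)"
    using assms by (intro sum_UN_le) auto
  also have "\<dots> \<le> (\<Sum>i<M. 2 powr p * B * k powr (\<gamma> - p) * ?q ^ i)"
    using shell by (intro sum_mono) auto
  also have "\<dots> = 2 powr p * B * k powr (\<gamma> - p) * (\<Sum>i<M. ?q ^ i)"
    by (simp add: sum_distrib_left)
  also have "\<dots> \<le> 2 powr p * B * k powr (\<gamma> - p) * (1 / (1 - ?q))"
    using q assms by (intro mult_left_mono geometric_sum_le) auto
  finally show ?thesis by (simp add: algebra_simps)
qed

lemma sum_powr_le:
  fixes \<alpha> :: real
  assumes "0 < \<alpha>" "\<alpha> < 1" "1 \<le> (n::nat)"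
  shows "(\<Sum>j=1..n. real j powr - \<alpha>) \<le> 2 / (1 - 2 powr (\<alpha> - 1)) * real n powr (1 - \<alpha>)"
proof -
  have "(\<Sum>z\<in>{z\<in>{1..n}. 1 \<le> id z \<and> real (id z) \<le> real n}. 1 * real (id z) powr - \<alpha>)
    \<le> 2 powr \<alpha> / (1 - 2 powr (\<alpha> - 1)) * 1 * real n powr (1 - \<alpha>)"
  proof (rule dyadic_near)
    fix \<rho> :: real assume \<rho>: "1 \<le> \<rho>"
    have "{z\<in>{1..n}. real (id z) \<le> \<rho>} \<subseteq> {1..nat \<lfloor>\<rho>\<rfloor>}" by (auto simp: le_nat_floor)
    then have "card {z\<in>{1..n}. real (id z) \<le> \<rho>} \<le> nat \<lfloor>\<rho>\<rfloor>"
      using card_mono[of "{1..nat \<lfloor>\<rho>\<rfloor>}"] by fastforce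
    then have "real (card {z\<in>{1..n}. real (id z) \<le> \<rho>}) \<le> \<rho>" using \<rho> by linarith
    then show "(\<Sum>z\<in>{z\<in>{1..n}. real (id z) \<le> \<rho>}. 1) \<le> 1 * \<rho> powr 1" using \<rho> by simp
  qed (use assms in auto)
  also have "\<dots> \<le> 2 / (1 - 2 powr (\<alpha> - 1)) * real n powr (1 - \<alpha>)"
  proof -
    have "2 powr \<alpha> \<le> 2 powr (1::real)" "2 powr (\<alpha> - 1) < (1::real)"
      using assms powr_mono[of \<alpha> 1 2] by (auto intro!: two_powr_less_one)
    then show ?thesis by (intro mult_right_mono) (auto intro!: divide_right_mono)
  qed
  moreover have "{z\<in>{1..n}. 1 \<le> id z \<and> real (id z) \<le> real n} = {1..n}" by auto
  ultimately show ?thesis by simp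
qed

subsection \<open>Finite-volume events under the percolation measure\<close>

text \<open>The guard matters because \<open>edge_weight\<close> is unspecified outside \<open>potential_edges\<close>.\<close>

definition edge_prob :: "('v \<Rightarrow> 'v \<Rightarrow> real) \<Rightarrow> real \<Rightarrow> 'v set \<Rightarrow> real" where
  "edge_prob J \<beta> e = (if e \<in> potential_edges then 1 - exp (- \<beta> * edge_weight J e) else 0)"

definition good_kernel :: "('v \<Rightarrow> 'v \<Rightarrow> real) \<Rightarrow> bool" where
  "good_kernel J \<longleftrightarrow> (\<forall>x y. 0 \<le> J x y) \<and> symmetric_kernel J"

lemma edges_potential: "edges V \<subseteq> potential_edges"
  by (auto simp: edges_def potential_edges_def)

lemma weight_pair: "good_kernel J \<Longrightarrow> edge_weight J {x, y} = J x y"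
  by (rule edge_weight_pair) (simp add: good_kernel_def symmetric_kernel_def)

lemma pair_potential: "{x, y} \<in> potential_edges \<longleftrightarrow> x \<noteq> y"
  by (auto simp: potential_edges_def doubleton_eq_iff)

lemma edge_prob_pair: "good_kernel J \<Longrightarrow> x \<noteq> y \<Longrightarrow> edge_prob J \<beta> {x, y} = 1 - exp (- \<beta> * J x y)"
  by (simp add: edge_prob_def pair_potential weight_pair)

lemma weight_nonneg: "good_kernel J \<Longrightarrow> e \<in> potential_edges \<Longrightarrow> 0 \<le> edge_weight J e"
  by (auto simp: potential_edges_def weight_pair) (simp add: good_kernel_def)

lemma probs_edge_prob: "good_kernel J \<Longrightarrow> 0 \<le> \<beta> \<Longrightarrow> probs (edge_prob J \<beta>)"
  using weight_nonneg[of J] by (auto simp: probs_def edge_prob_def)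

lemma edge_prob_le: "good_kernel J \<Longrightarrow> 0 \<le> \<beta> \<Longrightarrow> edge_prob J \<beta> {x, y} \<le> \<beta> * J x y"
proof (cases "x = y")
  case True
  assume "good_kernel J" "0 \<le> \<beta>"
  then show ?thesis using True pair_potential[of y y] by (simp add: edge_prob_def good_kernel_def)
next
  case False
  assume "good_kernel J" "0 \<le> \<beta>"
  then have "edge_prob J \<beta> {x, y} = 1 - exp (- (\<beta> * J x y))" using False by (simp add: edge_prob_pair)
  then show ?thesis using exp_ge_add_one_self[of "- (\<beta> * J x y)"] by linarith
qed

context
  fixes J :: "'v \<Rightarrow> 'v \<Rightarrow> real" and \<beta> :: real
  assumes J: "good_kernel J" and \<beta>: "0 \<le> \<beta>"
begin

lemma prob_space_percolation: "prob_space (percolation J \<beta>)"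
  unfolding percolation_def by (rule prob_space_PiM) (rule measure_pmf.prob_space_axioms)

abbreviation (input) "cyl E S \<equiv> {\<omega> \<in> space (percolation J \<beta>). {e \<in> E. \<omega> e} = S}"

lemma cylinder:
  assumes "finite E" "E \<subseteq> potential_edges" "S \<subseteq> E"
  shows "cyl E S \<in> sets (percolation J \<beta>)" "measure (percolation J \<beta>) (cyl E S) = edge_config_weight (edge_prob J \<beta>) E S"
proof -
  let ?M = "\<lambda>e. measure_pmf (bernoulli_pmf (1 - exp (- \<beta> * edge_weight J e)))"
  let ?X = "\<lambda>e. {e \<in> S}"
  interpret product_prob_space ?M potential_edges by unfold_locales
  have eq: "cyl E S = prod_emb potential_edges ?M E (Pi\<^sub>E E ?X)"
    using assms by (auto simp: prod_emb_def percolation_def space_PiM PiE_def Pi_def extensional_def)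
  show "cyl E S \<in> sets (percolation J \<beta>)"
    unfolding eq unfolding percolation_def using assms by (intro sets_PiM_I) auto
  have "measure (percolation J \<beta>) (cyl E S) = (\<Prod>e\<in>E. measure (?M e) (?X e))"
    unfolding eq unfolding percolation_def using assms by (intro measure_PiM_emb) auto
  also have "\<dots> = (\<Prod>e\<in>E. if e \<in> S then edge_prob J \<beta> e else 1 - edge_prob J \<beta> e)"
  proof (rule prod.cong[OF refl])
    fix e assume "e \<in> E"
    then have e: "e \<in> potential_edges" using assms by auto
    then have "0 \<le> \<beta> * edge_weight J e" using weight_nonneg[OF J] \<beta> by simp
    then show "measure (?M e) (?X e) = (if e \<in> S then edge_prob J \<beta> e else 1 - edge_prob J \<beta> e)"
      using e by (auto simp: measure_pmf_single edge_prob_def)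
  qed
  also have "\<dots> = edge_config_weight (edge_prob J \<beta>) E S"
    unfolding edge_config_weight_def using assms by (simp add: prod.If_cases Int_absorb1 Diff_eq)
  finally show "measure (percolation J \<beta>) (cyl E S) = edge_config_weight (edge_prob J \<beta>) E S" .
qed

text \<open>The event is a finite disjoint union of cylinders, one for each configuration on
  \<open>E\<close> that satisfies \<open>Q\<close>.\<close>

lemma finite_event:
  assumes "finite E" "E \<subseteq> potential_edges"
  shows "{\<omega> \<in> space (percolation J \<beta>). Q {e \<in> E. \<omega> e}} \<in> sets (percolation J \<beta>)"
    and "measure (percolation J \<beta>) {\<omega> \<in> space (percolation J \<beta>). Q {e \<in> E. \<omega> e}}
      = expec (edge_prob J \<beta>) E (\<lambda>S. of_bool (Q S))"
proof -
  interpret P: prob_space "percolation J \<beta>" by (rule prob_space_percolation)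
  let ?I = "{S \<in> Pow E. Q S}"
  have eq: "{\<omega> \<in> space (percolation J \<beta>). Q {e \<in> E. \<omega> e}} = (\<Union>S\<in>?I. cyl E S)" by auto
  show "{\<omega> \<in> space (percolation J \<beta>). Q {e \<in> E. \<omega> e}} \<in> sets (percolation J \<beta>)"
    unfolding eq using assms cylinder by (intro sets.finite_UN) auto
  have "measure (percolation J \<beta>) (\<Union>S\<in>?I. cyl E S) = (\<Sum>S\<in>?I. measure (percolation J \<beta>) (cyl E S))"
    using assms cylinder by (intro P.finite_measure_finite_Union) (auto simp: disjoint_family_on_def)
  also have "\<dots> = (\<Sum>S\<in>?I. edge_config_weight (edge_prob J \<beta>) E S)"
    using assms cylinder by (intro sum.cong) auto
  also have "\<dots> = expec (edge_prob J \<beta>) E (\<lambda>S. of_bool (Q S))"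
    unfolding expec_def using assms
    by (subst sum.inter_filter) (auto simp: of_bool_def intro!: sum.cong)
  finally show "measure (percolation J \<beta>) {\<omega> \<in> space (percolation J \<beta>). Q {e \<in> E. \<omega> e}}
      = expec (edge_prob J \<beta>) E (\<lambda>S. of_bool (Q S))" unfolding eq .
qed

end

definition perc_prob :: "('v \<Rightarrow> 'v \<Rightarrow> real) \<Rightarrow> real \<Rightarrow> real" where
  "perc_prob J \<beta> = \<P>(\<omega> in percolation J \<beta>. \<exists>x. infinite (cluster \<omega> x))"

subsection \<open>Exhausting the lattice\<close>

definition restr :: "('v set \<Rightarrow> bool) \<Rightarrow> 'v set \<Rightarrow> 'v set set" where
  "restr \<omega> V = {e \<in> edges V. \<omega> e}"

lemma connected_in_conn: "connected_in \<omega> = conn {e. \<omega> e}"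
  by (simp add: conn_def)

lemma cluster_clus: "cluster \<omega> x = clus {e. \<omega> e} x"
  by (simp add: cluster_def clus_def connected_in_conn)

lemma restr_mono: "V \<subseteq> W \<Longrightarrow> restr \<omega> V \<subseteq> restr \<omega> W"
  unfolding restr_def using edges_mono[of V W] by auto

lemma restr_subset: "restr \<omega> V \<subseteq> edges V" "restr \<omega> V \<subseteq> {e. \<omega> e}"
  by (auto simp: restr_def)

lemma conn_restr_lball:
  assumes "conn {e. \<omega> e} x (y :: int ^ 'd::finite)"
  shows "\<exists>n. conn (restr \<omega> (lball n 0)) x y"
  using assms
proof (induction rule: conn_induct)
  case (step y z)
  then obtain n where n: "conn (restr \<omega> (lball n 0)) x y" by auto
  let ?m = "max n (max (sup_norm y) (sup_norm z))"
  have "conn (restr \<omega> (lball ?m 0)) x y"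
    by (rule conn_mono[OF n]) (intro restr_mono lball_mono; simp)
  moreover have "conn (restr \<omega> (lball ?m 0)) y z"
    using step by (intro conn_edge) (auto simp: restr_def edges_pair lball_def)
  ultimately show ?case using conn_trans by metis
qed (auto simp: clus_def)

lemma conn_restr: "conn (restr \<omega> V) x y \<Longrightarrow> conn {e. \<omega> e} x y"
  by (rule conn_mono) (auto simp: restr_def)

lemma clus_exhaust: "clus {e. \<omega> e} (x :: int ^ 'd::finite) = (\<Union>n. clus (restr \<omega> (lball n 0)) x)"
  using conn_restr_lball[of \<omega> x] conn_restr[of \<omega> _ x] by (auto simp: clus_def)

lemma finite_clus_restr: "finite V \<Longrightarrow> finite (clus (restr \<omega> V) x)"
proof -
  assume V: "finite V"
  have "clus (restr \<omega> V) x \<subseteq> insert x V"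
  proof (rule clus_subset)
    show "restr \<omega> V \<subseteq> edges (insert x V)" using restr_subset edges_mono[of V "insert x V"] by blast
  qed simp
  then show ?thesis using V by (meson finite_insert finite_subset)
qed

text \<open>Expresses infinitude by countably many finite-volume events, which gives measurability
  and lets it be estimated by cluster sizes in balls.\<close>

lemma infinite_cluster_iff:
  "infinite (clus {e. \<omega> e} (x :: int ^ 'd::finite)) \<longleftrightarrow> (\<forall>m. \<exists>n. m < card (clus (restr \<omega> (lball n 0)) x))"
proof
  assume inf: "infinite (clus {e. \<omega> e} x)"
  show "\<forall>m. \<exists>n. m < card (clus (restr \<omega> (lball n 0)) x)"
  proof
    fix m
    obtain U where U: "U \<subseteq> clus {e. \<omega> e} x" "finite U" "card U = Suc m"
      using infinite_arbitrarily_large[OF inf, of "Suc m"] by blast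
    \<comment> \<open>A finite subset of the union of a chain lies in a single member of the
      chain.\<close>
    have "\<exists>n. U \<subseteq> clus (restr \<omega> (lball n 0)) x"
    proof (rule finite_subset_Union_chain[where \<B> = "range (\<lambda>n. clus (restr \<omega> (lball n 0)) x)" and A = U])
      show "subset.chain UNIV (range (\<lambda>n. clus (restr \<omega> (lball n 0)) x))"
      proof -
        have "clus (restr \<omega> (lball k 0)) x \<subseteq> clus (restr \<omega> (lball l 0)) x" if "k \<le> l" for k l
          by (intro clus_mono restr_mono lball_mono that)
        then have "clus (restr \<omega> (lball k 0)) x \<subseteq> clus (restr \<omega> (lball l 0)) x
            \<or> clus (restr \<omega> (lball l 0)) x \<subseteq> clus (restr \<omega> (lball k 0)) x" for k l
          using nat_le_linear[of k l] by blast
        then show ?thesis unfolding subset_chain_def by (simp add: ball_simps)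
      qed
    qed (use U clus_exhaust[of \<omega> x] in auto)
    then obtain n where "U \<subseteq> clus (restr \<omega> (lball n 0)) x" by auto
    then have "card U \<le> card (clus (restr \<omega> (lball n 0)) x)"
      by (intro card_mono finite_clus_restr) auto
    then show "\<exists>n. m < card (clus (restr \<omega> (lball n 0)) x)" using U by (intro exI[of _ n]) simp
  qed
next
  assume large: "\<forall>m. \<exists>n. m < card (clus (restr \<omega> (lball n 0)) x)"
  show "infinite (clus {e. \<omega> e} x)"
  proof
    assume fin: "finite (clus {e. \<omega> e} x)"
    obtain n where n: "card (clus {e. \<omega> e} x) < card (clus (restr \<omega> (lball n 0)) x)" using large by auto
    moreover have "card (clus (restr \<omega> (lball n 0)) x) \<le> card (clus {e. \<omega> e} x)"
      using fin by (intro card_mono clus_mono restr_subset) 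
    ultimately show False by simp
  qed
qed

context
  fixes J :: "int ^ 'd::finite \<Rightarrow> int ^ 'd \<Rightarrow> real" and \<beta> :: real
  assumes J: "good_kernel J" and \<beta>: "0 \<le> \<beta>"
begin

lemma restr_event:
  assumes "finite V"
  shows "{\<omega> \<in> space (percolation J \<beta>). Q (restr \<omega> V)} \<in> sets (percolation J \<beta>)"
    and "measure (percolation J \<beta>) {\<omega> \<in> space (percolation J \<beta>). Q (restr \<omega> V)}
      = expec (edge_prob J \<beta>) (edges V) (\<lambda>S. of_bool (Q S))"
  unfolding restr_def using finite_event[OF J \<beta> finite_edges[OF assms] edges_potential, of Q] .

text \<open>Any open path is finite, so the connection event is the increasing union of its versions
  in the balls \<open>lball n 0\<close>, and continuity from below applies.\<close>

lemma two_point_bounds: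
  shows two_point_ge: "finite V \<Longrightarrow> tau (edge_prob J \<beta>) V x y \<le> two_point J \<beta> x y"
    and two_point_le: "(\<And>n. tau (edge_prob J \<beta>) (lball n 0) x y \<le> K) \<Longrightarrow> two_point J \<beta> x y \<le> K"
proof -
  interpret P: prob_space "percolation J \<beta>" by (rule prob_space_percolation[OF J \<beta>])
  let ?A = "\<lambda>n. {\<omega> \<in> space (percolation J \<beta>). conn (restr \<omega> (lball n 0)) x y}"
  let ?B = "{\<omega> \<in> space (percolation J \<beta>). connected_in \<omega> x y}"
  have meas: "range ?A \<subseteq> sets (percolation J \<beta>)" using restr_event(1)[OF finite_lball] by auto
  have eq: "?B = (\<Union>n. ?A n)"
    unfolding connected_in_conn using conn_restr_lball[of _ x y] conn_restr[of _ _ x y] by blast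
  have B: "?B \<in> sets (percolation J \<beta>)" unfolding eq using meas by auto
  show "tau (edge_prob J \<beta>) V x y \<le> two_point J \<beta> x y" if "finite V"
  proof -
    have "tau (edge_prob J \<beta>) V x y = measure (percolation J \<beta>) {\<omega> \<in> space (percolation J \<beta>). conn (restr \<omega> V) x y}"
      using restr_event(2)[OF that, of "\<lambda>S. conn S x y"] by (simp add: tau_def)
    also have "\<dots> \<le> measure (percolation J \<beta>) ?B"
      using conn_restr[of _ V x y] by (intro P.finite_measure_mono B) (auto simp: connected_in_conn)
    finally show ?thesis by (simp add: two_point_def)
  qed
  show "two_point J \<beta> x y \<le> K" if "\<And>n. tau (edge_prob J \<beta>) (lball n 0) x y \<le> K"
  proof -
    have "incseq ?A"
    proof (intro incseq_SucI subsetI)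
      fix n \<omega> assume "\<omega> \<in> ?A n"
      moreover have "restr \<omega> (lball n 0) \<subseteq> restr \<omega> (lball (Suc n) 0)" by (intro restr_mono lball_mono) simp
      ultimately show "\<omega> \<in> ?A (Suc n)" using conn_mono by auto
    qed
    then have "(\<lambda>n. measure (percolation J \<beta>) (?A n)) \<longlonglongrightarrow> measure (percolation J \<beta>) (\<Union>n. ?A n)"
      by (rule P.finite_Lim_measure_incseq[OF meas])
    moreover have "measure (percolation J \<beta>) (?A n) \<le> K" for n
      using that[of n] restr_event(2)[OF finite_lball, of "\<lambda>S. conn S x y" n 0] by (simp add: tau_def)
    ultimately have "measure (percolation J \<beta>) (\<Union>n. ?A n) \<le> K"
      by (intro LIMSEQ_le_const2) auto
    then show ?thesis unfolding two_point_def eq .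
  qed
qed

lemma infinite_event:
  shows "{\<omega> \<in> space (percolation J \<beta>). infinite (cluster \<omega> x)} \<in> sets (percolation J \<beta>)"
    and "{\<omega> \<in> space (percolation J \<beta>). \<exists>x. infinite (cluster \<omega> x)} \<in> sets (percolation J \<beta>)"
proof -
  have *: "{\<omega> \<in> space (percolation J \<beta>). infinite (cluster \<omega> x)} =
    {\<omega> \<in> space (percolation J \<beta>). \<forall>m. \<exists>n. m < card (clus (restr \<omega> (lball n 0)) x)}" for x
    by (simp only: cluster_clus infinite_cluster_iff)
  have m: "{\<omega> \<in> space (percolation J \<beta>). infinite (cluster \<omega> x)} \<in> sets (percolation J \<beta>)" for x
    unfolding * using restr_event(1)[OF finite_lball]
    by (intro sets.sets_Collect_countable_All sets.sets_Collect_countable_Ex) auto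
  show "{\<omega> \<in> space (percolation J \<beta>). infinite (cluster \<omega> x)} \<in> sets (percolation J \<beta>)" by (rule m)
  show "{\<omega> \<in> space (percolation J \<beta>). \<exists>x. infinite (cluster \<omega> x)} \<in> sets (percolation J \<beta>)"
    using m by (intro sets.sets_Collect_countable_Ex) auto
qed

text \<open>Markov's inequality in each ball gives probability at most \<open>K / (m + 1)\<close>
  for a cluster of more than \<open>m\<close> vertices at \<open>x\<close>; letting \<open>m\<close>
  grow makes an infinite cluster at \<open>x\<close> null, and there are countably many
  \<open>x\<close>.\<close>

lemma no_percolation:
  assumes K: "\<And>x n. expec (edge_prob J \<beta>) (edges (lball n 0)) (\<lambda>S. real (card (clus S x))) \<le> K"
  shows "perc_prob J \<beta> = 0"
proof -
  interpret P: prob_space "percolation J \<beta>" by (rule prob_space_percolation[OF J \<beta>])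
  let ?I = "\<lambda>x. {\<omega> \<in> space (percolation J \<beta>). infinite (cluster \<omega> x)}"
  have p: "probs (edge_prob J \<beta>)" using J \<beta> by (rule probs_edge_prob)
  have null: "?I x \<in> null_sets (percolation J \<beta>)" for x
  proof -
    have small: "measure (percolation J \<beta>) (?I x) \<le> K / real (Suc m)" for m
    proof -
      let ?A = "\<lambda>n. {\<omega> \<in> space (percolation J \<beta>). m < card (clus (restr \<omega> (lball n 0)) x)}"
      have meas: "range ?A \<subseteq> sets (percolation J \<beta>)" using restr_event(1)[OF finite_lball] by auto
      have inc: "incseq ?A"
      proof (intro incseq_SucI subsetI)
        fix n \<omega> assume "\<omega> \<in> ?A n"
        moreover have "card (clus (restr \<omega> (lball n 0)) x) \<le> card (clus (restr \<omega> (lball (Suc n) 0)) x)"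
          by (intro card_mono finite_clus_restr clus_mono restr_mono lball_mono) auto
        ultimately show "\<omega> \<in> ?A (Suc n)" by auto
      qed
      have le: "measure (percolation J \<beta>) (?A n) \<le> K / real (Suc m)" for n
      proof -
        have "real (Suc m) * measure (percolation J \<beta>) (?A n)
          = expec (edge_prob J \<beta>) (edges (lball n 0)) (\<lambda>S. real (Suc m) * of_bool (m < card (clus S x)))"
          unfolding expec_cmult using restr_event(2)[OF finite_lball, of "\<lambda>S. m < card (clus S x)" n 0] by simp
        also have "\<dots> \<le> expec (edge_prob J \<beta>) (edges (lball n 0)) (\<lambda>S. real (card (clus S x)))"
          by (intro expec_mono p) auto
        also have "\<dots> \<le> K" by (rule K)
        finally show ?thesis by (simp add: field_simps)
      qed
      have "(\<lambda>n. measure (percolation J \<beta>) (?A n)) \<longlonglongrightarrow> measure (percolation J \<beta>) (\<Union>n. ?A n)"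
        using inc by (rule P.finite_Lim_measure_incseq[OF meas])
      then have "measure (percolation J \<beta>) (\<Union>n. ?A n) \<le> K / real (Suc m)"
        using le by (intro LIMSEQ_le_const2) auto
      moreover have "measure (percolation J \<beta>) (?I x) \<le> measure (percolation J \<beta>) (\<Union>n. ?A n)"
        using meas by (intro P.finite_measure_mono) (auto simp: cluster_clus infinite_cluster_iff)
      ultimately show ?thesis by simp
    qed
    have "(\<lambda>m. K / real (Suc m)) \<longlonglongrightarrow> 0" using LIMSEQ_Suc[OF lim_const_over_n] .
    then have "measure (percolation J \<beta>) (?I x) \<le> 0"
      using small by (intro LIMSEQ_le_const) auto
    then have "measure (percolation J \<beta>) (?I x) = 0" by (intro antisym measure_nonneg)
    then show ?thesis using infinite_event(1) by (simp add: null_sets_def P.emeasure_eq_measure)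
  qed
  have "(\<Union>x. ?I x) \<in> null_sets (percolation J \<beta>)"
    using null by (intro null_sets_UN) 
  moreover have "{\<omega> \<in> space (percolation J \<beta>). \<exists>x. infinite (cluster \<omega> x)} = (\<Union>x. ?I x)" by auto
  ultimately show ?thesis unfolding perc_prob_def by (simp add: null_sets_def P.emeasure_eq_measure)
qed

text \<open>By the union bound all the events \<open>Q k\<close> hold simultaneously with
  probability at least 1/2, and \<open>inf\<close> is a deterministic statement on that
  event.\<close>

lemma percolates:
  assumes V: "\<And>k::nat. finite (V k)"
    and \<epsilon>: "\<And>k. expec (edge_prob J \<beta>) (edges (V k)) (\<lambda>S. of_bool (\<not> Q k S)) \<le> \<epsilon> k"
    and sum: "\<And>M. (\<Sum>k<M. \<epsilon> k) \<le> 1 / 2"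
    and inf: "\<And>\<omega>. (\<And>k. Q k (restr \<omega> (V k))) \<Longrightarrow> \<exists>x. infinite (cluster \<omega> x)"
  shows "0 < perc_prob J \<beta>"
proof -
  interpret P: prob_space "percolation J \<beta>" by (rule prob_space_percolation[OF J \<beta>])
  let ?A = "\<lambda>k. {\<omega> \<in> space (percolation J \<beta>). \<not> Q k (restr \<omega> (V k))}"
  let ?U = "\<lambda>M. \<Union>k<M. ?A k"
  let ?G = "{\<omega> \<in> space (percolation J \<beta>). \<exists>x. infinite (cluster \<omega> x)}"
  have A: "?A k \<in> sets (percolation J \<beta>)" for k using restr_event(1)[OF V, of "\<lambda>S. \<not> Q k S"] .
  have mU: "range ?U \<subseteq> sets (percolation J \<beta>)" using A by (auto intro!: sets.finite_UN)
  have "incseq ?U" by (force simp: incseq_def)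
  then have lim: "(\<lambda>n. measure (percolation J \<beta>) (?U n)) \<longlonglongrightarrow> measure (percolation J \<beta>) (\<Union>n. ?U n)"
    by (rule P.finite_Lim_measure_incseq[OF mU])
  have "measure (percolation J \<beta>) (?U M) \<le> 1 / 2" for M
  proof -
    have "measure (percolation J \<beta>) (?U M) \<le> (\<Sum>k<M. measure (percolation J \<beta>) (?A k))"
      by (rule P.finite_measure_subadditive_finite) (use A in auto)
    also have "\<dots> \<le> (\<Sum>k<M. \<epsilon> k)"
      using \<epsilon> restr_event(2)[OF V, of "\<lambda>S. \<not> Q _ S"] by (intro sum_mono) simp
    finally show ?thesis using sum[of M] by simp
  qed
  then have half: "measure (percolation J \<beta>) (\<Union>n. ?U n) \<le> 1 / 2"
    using lim by (intro LIMSEQ_le_const2) auto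
  have "space (percolation J \<beta>) - (\<Union>n. ?U n) \<subseteq> ?G" using inf by auto
  then have "measure (percolation J \<beta>) (space (percolation J \<beta>) - (\<Union>n. ?U n)) \<le> measure (percolation J \<beta>) ?G"
    using infinite_event(2) by (intro P.finite_measure_mono) auto
  moreover have "measure (percolation J \<beta>) (space (percolation J \<beta>) - (\<Union>n. ?U n))
      = 1 - measure (percolation J \<beta>) (\<Union>n. ?U n)"
    using mU by (intro P.prob_compl) auto
  ultimately show ?thesis unfolding perc_prob_def using half by simp
qed

end

section \<open>The critical value as an infimum\<close>

lemma below_critical:
  assumes "0 \<le> \<beta>" "\<beta> < critical_value J"
  shows "\<not> 0 < perc_prob J \<beta>"
proof
  assume "0 < perc_prob J \<beta>"
  then have "critical_value J \<le> \<beta>"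
    unfolding critical_value_def perc_prob_def using assms by (intro cInf_lower bdd_belowI[of _ 0]) auto
  then show False using assms by simp
qed

text \<open>An infimum need not be attained: it only supplies percolating parameters arbitrarily
  close from above. The parameter \<open>\<beta>0\<close> makes the set nonempty.\<close>

lemma above_critical:
  assumes "0 \<le> \<beta>0" "0 < perc_prob J \<beta>0" "critical_value J < \<beta>"
  obtains \<beta>' where "critical_value J \<le> \<beta>'" "\<beta>' < \<beta>" "0 \<le> \<beta>'" "0 < perc_prob J \<beta>'"
proof -
  let ?P = "{\<beta>. 0 \<le> \<beta> \<and> 0 < perc_prob J \<beta>}"
  have eq: "critical_value J = Inf ?P" unfolding critical_value_def perc_prob_def ..
  have "\<exists>\<beta>'\<in>?P. \<beta>' < \<beta>" using assms eq by (intro cInf_lessD) auto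
  then obtain \<beta>' where b: "\<beta>' \<in> ?P" "\<beta>' < \<beta>" by auto
  moreover have "critical_value J \<le> \<beta>'" unfolding eq using b by (intro cInf_lower bdd_belowI[of _ 0]) auto
  ultimately show ?thesis using that by auto
qed

lemma critical_nonneg:
  assumes "0 \<le> \<beta>0" "0 < perc_prob J \<beta>0"
  shows "0 \<le> critical_value J" "critical_value J \<le> \<beta>0"
proof -
  have eq: "critical_value J = Inf {\<beta>. 0 \<le> \<beta> \<and> 0 < perc_prob J \<beta>}"
    unfolding critical_value_def perc_prob_def ..
  show "0 \<le> critical_value J" unfolding eq using assms by (intro cInf_greatest) auto
  show "critical_value J \<le> \<beta>0" unfolding eq using assms by (intro cInf_lower bdd_belowI[of _ 0]) auto
qed

section \<open>Kernels with power-law bounds\<close>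

definition lr_kernel :: "real \<Rightarrow> real \<Rightarrow> real \<Rightarrow> (int ^ 'd::finite \<Rightarrow> int ^ 'd \<Rightarrow> real) \<Rightarrow> bool" where
  "lr_kernel \<alpha> c C J \<longleftrightarrow> good_kernel J \<and> translation_invariant J \<and>
    (\<forall>x y. x \<noteq> y \<longrightarrow>
       c * real (sup_norm (x - y)) powr - (real CARD('d) + \<alpha>) \<le> J x y \<and>
       J x y \<le> C * real (sup_norm (x - y)) powr - (real CARD('d) + \<alpha>))"

lemma lr_good: "lr_kernel \<alpha> c C J \<Longrightarrow> good_kernel J"
  by (simp add: lr_kernel_def)

lemma lr_lower:
  fixes J :: "int ^ 'd::finite \<Rightarrow> int ^ 'd \<Rightarrow> real"
  assumes "lr_kernel \<alpha> c C J" "0 < \<alpha>" "0 \<le> c" "x \<noteq> y" "real (sup_norm (x - y)) \<le> s"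
  shows "c * s powr - (real CARD('d) + \<alpha>) \<le> J x y"
proof -
  have "s powr - (real CARD('d) + \<alpha>) \<le> real (sup_norm (x - y)) powr - (real CARD('d) + \<alpha>)"
    using assms sup_norm_pos[of x y] by (intro powr_mono2') auto
  then have "c * s powr - (real CARD('d) + \<alpha>) \<le> c * real (sup_norm (x - y)) powr - (real CARD('d) + \<alpha>)"
    using assms by (intro mult_left_mono)
  also have "\<dots> \<le> J x y" using assms by (simp add: lr_kernel_def)
  finally show ?thesis .
qed

lemma lr_upper:
  fixes J :: "int ^ 'd::finite \<Rightarrow> int ^ 'd \<Rightarrow> real"
  shows "lr_kernel \<alpha> c C J \<Longrightarrow> x \<noteq> y \<Longrightarrow> J x y \<le> C * real (sup_norm (x - y)) powr - (real CARD('d) + \<alpha>)"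
  by (simp add: lr_kernel_def)

lemma edge_prob_translate:
  assumes "lr_kernel \<alpha> c C J" "e \<in> edges V"
  shows "edge_prob J \<beta> ((\<lambda>x. x + z) ` e) = edge_prob J \<beta> e"
proof -
  obtain x y where e: "e = {x, y}" "x \<noteq> y" using assms(2) by (auto simp: edges_def)
  have "J a b = J 0 (b - a)" for a b
    using assms(1) unfolding lr_kernel_def translation_invariant_def by blast
  then have "J (x + z) (y + z) = J x y" by (metis add_diff_cancel_right)
  then show ?thesis using e lr_good[OF assms(1)] by (simp add: edge_prob_pair)
qed

lemma translate_invariance:
  assumes "lr_kernel \<alpha> c C J" "finite V"
  shows tau_translate: "tau (edge_prob J \<beta>) ((\<lambda>x. x + z) ` V) (x + z) (y + z) = tau (edge_prob J \<beta>) V x y"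
    and trunc_mean_translate: "trunc_mean (edge_prob J \<beta>) ((\<lambda>x. x + z) ` V) n (x + z) = trunc_mean (edge_prob J \<beta>) V n x"
    and bigprob_translate: "bigprob (edge_prob J \<beta>) ((\<lambda>x. x + z) ` V) n = bigprob (edge_prob J \<beta>) V n"
  using tau_relabel[of "\<lambda>x. x + z" V "edge_prob J \<beta>" x y] trunc_mean_relabel[of "\<lambda>x. x + z" V "edge_prob J \<beta>" n x]
    bigprob_relabel[of "\<lambda>x. x + z" V "edge_prob J \<beta>" n] bij_translate[of z] assms(2)
    edge_prob_translate[OF assms(1), of _ V \<beta> z] by blast+

subsection \<open>A finite-size criterion for percolation\<close>

text \<open>Despite the name, only the least corner of the subbox with index \<open>z\<close>; the
  subbox itself is \<open>lbox s (subbox s v z)\<close>.\<close>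

definition subbox :: "nat \<Rightarrow> int ^ 'd::finite \<Rightarrow> int ^ 'd \<Rightarrow> int ^ 'd" where
  "subbox s v z = (\<chi> i. v $ i + int s * z $ i)"

lemma subbox_0 [simp]: "subbox s v 0 = v"
  by (simp add: subbox_def vec_eq_iff)

lemma subbox_subset:
  assumes "z \<in> lbox L 0" shows "lbox s (subbox s v z) \<subseteq> lbox (L * s) v"
proof
  fix x assume x: "x \<in> lbox s (subbox s v z)"
  show "x \<in> lbox (L * s) v" unfolding lbox_def
  proof (intro CollectI allI)
    fix i
    have "0 \<le> z $ i \<and> z $ i < int L" using assms by (auto simp: lbox_def)
    then have z: "0 \<le> z $ i" "z $ i + 1 \<le> int L" by auto
    have "v $ i + int s * z $ i \<le> x $ i" "x $ i < v $ i + int s * z $ i + int s"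
      using x by (auto simp: lbox_def subbox_def)
    moreover have "0 \<le> int s * z $ i" using z by simp
    moreover have "int s * (z $ i + 1) \<le> int s * int L" using z by (intro mult_left_mono) auto
    ultimately show "v $ i \<le> x $ i \<and> x $ i < v $ i + int (L * s)" by (simp add: algebra_simps)
  qed
qed

lemma subbox_disjoint:
  assumes "z \<noteq> z'" shows "lbox s (subbox s v z) \<inter> lbox s (subbox s v z') = {}"
proof (rule ccontr)
  assume "\<not> ?thesis"
  then obtain x where x: "x \<in> lbox s (subbox s v z)" "x \<in> lbox s (subbox s v z')" by auto
  have "z $ i = z' $ i" for i
  proof -
    have 1: "int s * z $ i \<le> x $ i - v $ i" "x $ i - v $ i < int s * z $ i + int s"
      "int s * z' $ i \<le> x $ i - v $ i" "x $ i - v $ i < int s * z' $ i + int s"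
      using x by (auto simp: lbox_def subbox_def algebra_simps)
    then have "int s * z $ i < int s * (z' $ i + 1)" "int s * z' $ i < int s * (z $ i + 1)"
      by (simp_all add: algebra_simps)
    then show ?thesis by (simp add: mult_less_cancel_left)
  qed
  then show False using assms by (simp add: vec_eq_iff)
qed

text \<open>A connected set of vertices in the box of side \<open>L ^ k * s\<close> at \<open>v\<close>, merging those of its
  subboxes at scale \<open>k\<close>; it is empty if more than one subbox fails to provide one or if two of them
  are not joined by an open edge.\<close>

fun merged_cluster :: "nat \<Rightarrow> nat \<Rightarrow> nat \<Rightarrow> nat \<Rightarrow> int ^ 'd::finite \<Rightarrow> (int ^ 'd) set set \<Rightarrow> (int ^ 'd) set" where
  "merged_cluster L s n 0 v S =
    (let P = (\<lambda>U. U \<subseteq> lbox s v \<and> n \<le> card U \<and> (\<forall>x\<in>U. \<forall>y\<in>U. conn (S \<inter> edges (lbox s v)) x y))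
     in if \<exists>U. P U then SOME U. P U else {})"
| "merged_cluster L s n (Suc k) v S =
    (let G = {z \<in> lbox L 0. merged_cluster L s n k (subbox (L ^ k * s) v z) S \<noteq> {}}
     in if L ^ CARD('d) - 1 \<le> card G \<and>
        (\<forall>z\<in>G. \<forall>z'\<in>G. z \<noteq> z' \<longrightarrow> (\<exists>a\<in>merged_cluster L s n k (subbox (L ^ k * s) v z) S.
           \<exists>b\<in>merged_cluster L s n k (subbox (L ^ k * s) v z') S. {a, b} \<in> S))
        then \<Union>z\<in>G. merged_cluster L s n k (subbox (L ^ k * s) v z) S else {})"

lemma merged_cluster_0:
  assumes "merged_cluster L s n 0 v S \<noteq> {}"
  shows "merged_cluster L s n 0 v S \<subseteq> lbox s v" "n \<le> card (merged_cluster L s n 0 v S)"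
    "\<And>x y. x \<in> merged_cluster L s n 0 v S \<Longrightarrow> y \<in> merged_cluster L s n 0 v S \<Longrightarrow> conn (S \<inter> edges (lbox s v)) x y"
proof -
  let ?P = "\<lambda>U. U \<subseteq> lbox s v \<and> n \<le> card U \<and> (\<forall>x\<in>U. \<forall>y\<in>U. conn (S \<inter> edges (lbox s v)) x y)"
  have ex: "\<exists>U. ?P U" using assms by (auto simp: Let_def split: if_splits)
  then have "merged_cluster L s n 0 v S = (SOME U. ?P U)" by (simp add: Let_def)
  then have "?P (merged_cluster L s n 0 v S)" using someI_ex[OF ex] by simp
  then show "merged_cluster L s n 0 v S \<subseteq> lbox s v" "n \<le> card (merged_cluster L s n 0 v S)"
    "\<And>x y. x \<in> merged_cluster L s n 0 v S \<Longrightarrow> y \<in> merged_cluster L s n 0 v S \<Longrightarrow> conn (S \<inter> edges (lbox s v)) x y"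
    by blast+
qed

lemma merged_cluster_Suc:
  fixes v :: "int ^ 'd::finite"
  assumes "merged_cluster L s n (Suc k) v S \<noteq> {}"
  defines "D \<equiv> \<lambda>z. merged_cluster L s n k (subbox (L ^ k * s) v z) S"
  defines "G \<equiv> {z \<in> lbox L 0. D z \<noteq> {}}"
  shows "L ^ CARD('d) - 1 \<le> card G" "merged_cluster L s n (Suc k) v S = (\<Union>z\<in>G. D z)"
    "\<And>z z'. z \<in> G \<Longrightarrow> z' \<in> G \<Longrightarrow> z \<noteq> z' \<Longrightarrow> \<exists>a\<in>D z. \<exists>b\<in>D z'. {a, b} \<in> S"
proof -
  have eq: "merged_cluster L s n (Suc k) v S = (if L ^ CARD('d) - 1 \<le> card G \<and>
      (\<forall>z\<in>G. \<forall>z'\<in>G. z \<noteq> z' \<longrightarrow> (\<exists>a\<in>D z. \<exists>b\<in>D z'. {a, b} \<in> S)) then \<Union>z\<in>G. D z else {})"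
    unfolding G_def D_def merged_cluster.simps(2) Let_def ..
  then have cond: "L ^ CARD('d) - 1 \<le> card G \<and>
      (\<forall>z\<in>G. \<forall>z'\<in>G. z \<noteq> z' \<longrightarrow> (\<exists>a\<in>D z. \<exists>b\<in>D z'. {a, b} \<in> S))"
    using assms(1) by presburger
  then show "L ^ CARD('d) - 1 \<le> card G" "merged_cluster L s n (Suc k) v S = (\<Union>z\<in>G. D z)"
    "\<And>z z'. z \<in> G \<Longrightarrow> z' \<in> G \<Longrightarrow> z \<noteq> z' \<Longrightarrow> \<exists>a\<in>D z. \<exists>b\<in>D z'. {a, b} \<in> S"
    unfolding eq by simp_all
qed

lemma merged_cluster_subset: "merged_cluster L s n k v S \<subseteq> lbox (L ^ k * s) v"
proof (induction k arbitrary: v)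
  case 0
  then show ?case using merged_cluster_0(1)[of L s n v S] by (cases "merged_cluster L s n 0 v S = {}") auto
next
  case (Suc k)
  show ?case
  proof (cases "merged_cluster L s n (Suc k) v S = {}")
    case False
    have "lbox (L ^ k * s) (subbox (L ^ k * s) v z) \<subseteq> lbox (L ^ Suc k * s) v" if "z \<in> lbox L 0" for z
      using subbox_subset[OF that, of "L ^ k * s" v] by (simp add: mult.assoc)
    then show ?thesis unfolding merged_cluster_Suc(2)[OF False] using Suc by blast
  qed simp
qed

text \<open>Locality makes the constructions in disjoint subboxes independent of each other and of
  the edges between them.\<close>

lemma merged_cluster_local:
  assumes "lbox (L ^ k * s) v \<subseteq> V"
  shows "merged_cluster L s n k v (S \<inter> edges V) = merged_cluster L s n k v S"
  using assms
proof (induction k arbitrary: v)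
  case 0
  then have "S \<inter> edges V \<inter> edges (lbox s v) = S \<inter> edges (lbox s v)" using edges_mono[of "lbox s v" V] by auto
  then show ?case by simp
next
  case (Suc k)
  let ?s = "subbox (L ^ k * s) v"
  have sub: "lbox (L ^ k * s) (?s z) \<subseteq> V" if "z \<in> lbox L 0" for z
    using subbox_subset[OF that, of "L ^ k * s" v] Suc.prems by (simp add: mult.assoc)
  then have IH: "merged_cluster L s n k (?s z) (S \<inter> edges V) = merged_cluster L s n k (?s z) S" if "z \<in> lbox L 0" for z
    using Suc.IH that by blast
  then have G: "{z \<in> lbox L 0. merged_cluster L s n k (?s z) (S \<inter> edges V) \<noteq> {}} = {z \<in> lbox L 0. merged_cluster L s n k (?s z) S \<noteq> {}}"
    by auto
  let ?G = "{z \<in> lbox L 0. merged_cluster L s n k (?s z) S \<noteq> {}}"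
  have edge: "{a, b} \<in> S \<inter> edges V \<longleftrightarrow> {a, b} \<in> S"
    if "z \<in> ?G" "z' \<in> ?G" "z \<noteq> z'" "a \<in> merged_cluster L s n k (?s z) S" "b \<in> merged_cluster L s n k (?s z') S" for z z' a b
  proof -
    have "a \<in> lbox (L ^ k * s) (?s z)" "b \<in> lbox (L ^ k * s) (?s z')" using that merged_cluster_subset by blast+
    moreover have "z \<in> lbox L 0" "z' \<in> lbox L 0" using that by auto
    ultimately have "a \<in> V" "b \<in> V" "a \<noteq> b"
      using sub subbox_disjoint[OF that(3), of "L ^ k * s" v] by blast+
    then show ?thesis by (simp add: edges_pair)
  qed
  have cond: "(\<forall>z\<in>?G. \<forall>z'\<in>?G. z \<noteq> z' \<longrightarrow> (\<exists>a\<in>merged_cluster L s n k (?s z) (S \<inter> edges V).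
           \<exists>b\<in>merged_cluster L s n k (?s z') (S \<inter> edges V). {a, b} \<in> S \<inter> edges V)) \<longleftrightarrow>
     (\<forall>z\<in>?G. \<forall>z'\<in>?G. z \<noteq> z' \<longrightarrow> (\<exists>a\<in>merged_cluster L s n k (?s z) S.
           \<exists>b\<in>merged_cluster L s n k (?s z') S. {a, b} \<in> S))"
    (is "?l = ?r")
  proof (intro ball_cong[OF refl] imp_cong[OF refl])
    fix z z' assume z: "z \<in> ?G" "z' \<in> ?G" "z \<noteq> z'"
    then have "merged_cluster L s n k (?s z) (S \<inter> edges V) = merged_cluster L s n k (?s z) S"
      "merged_cluster L s n k (?s z') (S \<inter> edges V) = merged_cluster L s n k (?s z') S" using IH by auto
    then show "(\<exists>a\<in>merged_cluster L s n k (?s z) (S \<inter> edges V).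
           \<exists>b\<in>merged_cluster L s n k (?s z') (S \<inter> edges V). {a, b} \<in> S \<inter> edges V) \<longleftrightarrow>
       (\<exists>a\<in>merged_cluster L s n k (?s z) S. \<exists>b\<in>merged_cluster L s n k (?s z') S. {a, b} \<in> S)"
      using edge[OF z] by (simp cong: bex_cong)
  qed
  have un: "(\<Union>z\<in>?G. merged_cluster L s n k (?s z) (S \<inter> edges V)) = (\<Union>z\<in>?G. merged_cluster L s n k (?s z) S)"
    using IH by auto
  show ?case unfolding merged_cluster.simps(2) Let_def G cond un ..
qed

lemma merged_cluster_conn: "x \<in> merged_cluster L s n k v S \<Longrightarrow> y \<in> merged_cluster L s n k v S \<Longrightarrow> conn S x y"
proof (induction k arbitrary: v x y)
  case 0
  then have "conn (S \<inter> edges (lbox s v)) x y" by (intro merged_cluster_0(3)[of L s n v S]) blast+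
  then show ?case by (rule conn_mono) auto
next
  case (Suc k)
  then have ne: "merged_cluster L s n (Suc k) v S \<noteq> {}" by auto
  let ?D = "\<lambda>z. merged_cluster L s n k (subbox (L ^ k * s) v z) S"
  obtain z z' where z: "z \<in> lbox L 0" "z' \<in> lbox L 0" "x \<in> ?D z" "y \<in> ?D z'"
    using Suc.prems unfolding merged_cluster_Suc(2)[OF ne] by blast
  show ?case
  proof (cases "z = z'")
    case False
    obtain a b where ab: "a \<in> ?D z" "b \<in> ?D z'" "{a, b} \<in> S"
      using merged_cluster_Suc(3)[OF ne, of z z'] z False by blast
    have "conn S x a" "conn S b y" using Suc.IH z ab by blast+
    then show ?thesis using conn_edge[OF ab(3)] conn_trans by metis
  qed (use z Suc.IH in blast)
qed

lemma merged_cluster_card: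
  fixes v :: "int ^ 'd::finite"
  shows "merged_cluster L s n k v S \<noteq> {} \<Longrightarrow> (L ^ CARD('d) - 1) ^ k * n \<le> card (merged_cluster L s n k v S)"
proof (induction k arbitrary: v)
  case 0
  then show ?case using merged_cluster_0(2)[of L s n v S] by simp
next
  case (Suc k)
  let ?D = "\<lambda>z. merged_cluster L s n k (subbox (L ^ k * s) v z) S"
  let ?G = "{z \<in> lbox L 0. ?D z \<noteq> {}}"
  have fin: "finite (?D z)" for z using merged_cluster_subset finite_box by (rule finite_subset)
  have disj: "?D z \<inter> ?D z' = {}" if "z \<noteq> z'" for z z'
    using subbox_disjoint[OF that, of "L ^ k * s" v] merged_cluster_subset[of L s n k _ S] by blast
  have "(L ^ CARD('d) - 1) ^ Suc k * n = (L ^ CARD('d) - 1) * ((L ^ CARD('d) - 1) ^ k * n)" by simp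
  also have "\<dots> \<le> card ?G * ((L ^ CARD('d) - 1) ^ k * n)"
    using merged_cluster_Suc(1)[OF Suc.prems] by (rule mult_le_mono1)
  also have "\<dots> = (\<Sum>z\<in>?G. (L ^ CARD('d) - 1) ^ k * n)" by simp
  also have "\<dots> \<le> (\<Sum>z\<in>?G. card (?D z))" using Suc.IH by (intro sum_mono) auto
  also have "\<dots> = card (\<Union>z\<in>?G. ?D z)"
    using fin disj by (intro card_UN_disjoint[symmetric]) auto
  also have "\<dots> = card (merged_cluster L s n (Suc k) v S)" unfolding merged_cluster_Suc(2)[OF Suc.prems] ..
  finally show ?case .
qed

text \<open>The subbox with index 0 shares its corner with the large box. For a fixed corner the
  sets therefore increase with the scale, and they end up in one infinite cluster.\<close>

lemma merged_cluster_step: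
  assumes "merged_cluster L s n (Suc k) v S \<noteq> {}" "1 \<le> L"
  shows "merged_cluster L s n k v S \<subseteq> merged_cluster L s n (Suc k) v S"
proof (cases "merged_cluster L s n k v S = {}")
  case False
  have "(0 :: int ^ 'a) \<in> lbox L 0" using assms(2) by (auto simp: lbox_def)
  then show ?thesis unfolding merged_cluster_Suc(2)[OF assms(1)] using False
    by (intro UN_upper[of 0, where B = "\<lambda>z. merged_cluster L s n k (subbox (L ^ k * s) v z) S", simplified]) auto
qed simp

text \<open>One missing subbox is tolerated precisely so that failure requires a pair: two missing
  subboxes, which makes the recursion for the failure probability quadratic, or two nonempty sets
  without an open edge between them.\<close>

lemma merged_cluster_fail:
  fixes v :: "int ^ 'd::finite"
  assumes "merged_cluster L s n (Suc k) v S = {}" "2 \<le> L"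
  defines "D \<equiv> \<lambda>z. merged_cluster L s n k (subbox (L ^ k * s) v z) S"
  shows "\<exists>z\<in>lbox L 0. \<exists>z'\<in>lbox L 0 - {z}. D z = {} \<and> D z' = {} \<or>
    D z \<noteq> {} \<and> D z' \<noteq> {} \<and> (\<forall>a\<in>D z. \<forall>b\<in>D z'. {a, b} \<notin> S)"
proof -
  let ?I = "lbox L (0 :: int ^ 'd)"
  define G where "G = {z \<in> ?I. D z \<noteq> {}}"
  have cI: "card ?I = L ^ CARD('d)" by (rule box_card)
  have "L ^ 1 \<le> L ^ CARD('d)" using assms(2) by (intro power_increasing) auto
  then have N: "2 \<le> L ^ CARD('d)" using assms(2) by simp
  show ?thesis
  proof (cases "L ^ CARD('d) - 1 \<le> card G")
    case False
    have "card (?I - G) = card ?I - card G" by (intro card_Diff_subset) (auto simp: G_def)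
    then have "2 \<le> card (?I - G)" using False N cI by linarith
    then obtain z z' where "z \<in> ?I - G" "z' \<in> ?I - G" "z \<noteq> z'"
      by (metis card_le_Suc0_iff_eq finite_Diff finite_box not_less_eq_eq numeral_2_eq_2)
    then show ?thesis by (auto simp: G_def)
  next
    case True
    then have "card G \<noteq> 0" using N by linarith
    then have "G \<noteq> {}" by auto
    then have "(\<Union>z\<in>G. D z) \<noteq> {}" by (auto simp: G_def)
    moreover have "merged_cluster L s n (Suc k) v S = (if L ^ CARD('d) - 1 \<le> card G \<and>
      (\<forall>z\<in>G. \<forall>z'\<in>G. z \<noteq> z' \<longrightarrow> (\<exists>a\<in>D z. \<exists>b\<in>D z'. {a, b} \<in> S)) then \<Union>z\<in>G. D z else {})"
      unfolding G_def D_def merged_cluster.simps(2) Let_def ..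
    ultimately have "\<not> (\<forall>z\<in>G. \<forall>z'\<in>G. z \<noteq> z' \<longrightarrow> (\<exists>a\<in>D z. \<exists>b\<in>D z'. {a, b} \<in> S))"
      using assms(1) True by presburger
    then obtain z z' where "z \<in> G" "z' \<in> G" "z \<noteq> z'" "\<forall>a\<in>D z. \<forall>b\<in>D z'. {a, b} \<notin> S" by blast
    then show ?thesis by (intro bexI[of _ z] bexI[of _ z']) (auto simp: G_def)
  qed
qed

lemma merged_cluster_0_nonempty:
  assumes "big m (S \<inter> edges (lbox s v))" "1 \<le> m" "n \<le> Suc m" "1 \<le> n"
  shows "merged_cluster L s n 0 v S \<noteq> {}"
proof -
  obtain U u where U: "finite U" "m < card U" "U \<subseteq> clus (S \<inter> edges (lbox s v)) u"
    using assms by (auto simp: big_def)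
  have "u \<in> lbox s v"
  proof (rule ccontr)
    assume u: "u \<notin> lbox s v"
    have "clus (S \<inter> edges (lbox s v)) u \<subseteq> {u}"
    proof
      fix x assume x: "x \<in> clus (S \<inter> edges (lbox s v)) u"
      show "x \<in> {u}"
      proof (rule ccontr)
        assume "x \<notin> {u}"
        then obtain w where "{u, w} \<in> S \<inter> edges (lbox s v)"
          using x conn_first[of "S \<inter> edges (lbox s v)" u x] by (auto simp: clus_def)
        then show False using u by (auto simp: edges_pair)
      qed
    qed
    then have "card U \<le> card {u}" using U by (intro card_mono) auto
    then show False using U assms by simp
  qed
  then have Ub: "U \<subseteq> lbox s v" using U clus_subset[of "S \<inter> edges (lbox s v)" "lbox s v" u] by auto
  have conn: "conn (S \<inter> edges (lbox s v)) x y" if "x \<in> U" "y \<in> U" for x y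
    using that U conn_sym[of _ u x] conn_trans[of _ x u y] by (auto simp: clus_def)
  let ?P = "\<lambda>U. U \<subseteq> lbox s v \<and> n \<le> card U \<and> (\<forall>x\<in>U. \<forall>y\<in>U. conn (S \<inter> edges (lbox s v)) x y)"
  have ex: "\<exists>U. ?P U"
    using Ub U conn assms by (intro exI[of _ U]) auto
  then have "merged_cluster L s n 0 v S = (SOME U. ?P U)" by (simp add: Let_def)
  then have "n \<le> card (merged_cluster L s n 0 v S)" using someI_ex[OF ex] by simp
  then show ?thesis using assms(4) by (metis card.empty le_zero_eq not_one_le_zero)
qed

text \<open>The sets \<open>D1 S\<close> and \<open>D2 S\<close> are determined by the edges inside
  \<open>V1\<close> and \<open>V2\<close>. Once these are fixed, at least \<open>m * m\<close> fresh
  edges between the two sets must all be closed.\<close>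

lemma no_join_prob:
  fixes m :: nat
  assumes "finite V" "V1 \<subseteq> V" "V2 \<subseteq> V" "V1 \<inter> V2 = {}" "probs p" "0 \<le> j"
    and j: "\<And>a b. a \<in> V1 \<Longrightarrow> b \<in> V2 \<Longrightarrow> 1 - p {a, b} \<le> exp (- j)"
    and D1: "\<And>S. D1 S \<subseteq> V1" "\<And>S. D1 (S \<inter> edges V1) = D1 S" "\<And>S. D1 S \<noteq> {} \<Longrightarrow> m \<le> card (D1 S)"
    and D2: "\<And>S. D2 S \<subseteq> V2" "\<And>S. D2 (S \<inter> edges V2) = D2 S" "\<And>S. D2 S \<noteq> {} \<Longrightarrow> m \<le> card (D2 S)"
  shows "expec p (edges V) (\<lambda>S. of_bool (D1 S \<noteq> {} \<and> D2 S \<noteq> {} \<and> (\<forall>a\<in>D1 S. \<forall>b\<in>D2 S. {a, b} \<notin> S)))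
    \<le> exp (- (j * real (m * m)))"
proof -
  let ?E0 = "edges V1 \<union> edges V2" and ?X = "(\<lambda>(a, b). {a, b}) ` (V1 \<times> V2)"
  let ?f = "\<lambda>S. of_bool (D1 S \<noteq> {} \<and> D2 S \<noteq> {} \<and> (\<forall>a\<in>D1 S. \<forall>b\<in>D2 S. {a, b} \<notin> S)) :: real"
  have fin: "finite V1" "finite V2"
    using finite_subset[OF assms(2,1)] finite_subset[OF assms(3,1)] by auto
  have X0: "?E0 \<inter> ?X = {}" using assms(4) by (auto simp: edges_def doubleton_eq_iff)
  have XV: "?X \<subseteq> edges V" using assms by (auto intro!: edgesI)
  have E0V: "?E0 \<subseteq> edges V" using edges_mono[OF assms(2)] edges_mono[OF assms(3)] by auto
  have loc: "D1 (S \<inter> T) = D1 S" "D2 (S \<inter> T) = D2 S" if "edges V1 \<union> edges V2 \<subseteq> T" for S T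
  proof -
    have "S \<inter> T \<inter> edges V1 = S \<inter> edges V1" "S \<inter> T \<inter> edges V2 = S \<inter> edges V2" using that by auto
    then show "D1 (S \<inter> T) = D1 S" "D2 (S \<inter> T) = D2 S"
      using D1(2)[of S] D1(2)[of "S \<inter> T"] D2(2)[of S] D2(2)[of "S \<inter> T"] by auto
  qed
  have "expec p (edges V) ?f = expec p (?E0 \<union> ?X) ?f"
  proof (rule expec_marginal)
    fix S
    have "{a, b} \<in> S \<inter> (?E0 \<union> ?X) \<longleftrightarrow> {a, b} \<in> S" if "a \<in> D1 S" "b \<in> D2 S" for a b
      using that D1(1)[of S] D2(1)[of S] by auto
    then show "?f S = ?f (S \<inter> (?E0 \<union> ?X))"
      using loc[of "?E0 \<union> ?X" S] by auto
  qed (use assms E0V XV in auto)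
  also have "\<dots> = expec p ?E0 (\<lambda>S. expec p ?X (\<lambda>T. ?f (S \<union> T)))"
    using fin X0 by (intro expec_Un) auto
  also have "\<dots> \<le> expec p ?E0 (\<lambda>S. exp (- (j * real (m * m))))"
  proof (rule expec_mono[OF assms(5)])
    fix S assume S: "S \<subseteq> ?E0"
    have DS: "D1 (S \<union> T) = D1 S" "D2 (S \<union> T) = D2 S" if "T \<subseteq> ?X" for T
    proof -
      have "(S \<union> T) \<inter> ?E0 = S" using S X0 that by blast
      then show "D1 (S \<union> T) = D1 S" "D2 (S \<union> T) = D2 S" using loc[of ?E0 "S \<union> T"] by auto
    qed
    let ?F = "(\<lambda>(a, b). {a, b}) ` (D1 S \<times> D2 S)"
    have FX: "?F \<subseteq> ?X" using D1(1)[of S] D2(1)[of S] by auto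
    show "expec p ?X (\<lambda>T. ?f (S \<union> T)) \<le> exp (- (j * real (m * m)))"
    proof (cases "D1 S \<noteq> {} \<and> D2 S \<noteq> {}")
      case True
      have "expec p ?X (\<lambda>T. ?f (S \<union> T)) \<le> expec p ?X (\<lambda>T. of_bool (T \<inter> ?F = {}))"
        using DS by (intro expec_mono assms) auto
      also have "\<dots> = (\<Prod>e\<in>?F. 1 - p e)" using fin FX by (intro expec_avoid) auto
      also have "\<dots> \<le> exp (- (j * real (card (D1 S) * card (D2 S))))"
      proof (rule prod_cross_le)
        show "finite (D1 S)" "finite (D2 S)"
          using finite_subset[OF D1(1) fin(1)] finite_subset[OF D2(1) fin(2)] by auto
        show "D1 S \<inter> D2 S = {}" using D1(1) D2(1) assms(4) by blast
        show "1 - p {a, b} \<le> exp (- j)" if "a \<in> D1 S" "b \<in> D2 S" for a b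
          using that D1(1)[of S] D2(1)[of S] j[of a b] by blast
      qed (rule assms)
      also have "\<dots> \<le> exp (- (j * real (m * m)))"
        using True D1(3)[of S] D2(3)[of S] assms(6)
        by (auto intro!: mult_left_mono mult_mono simp flip: of_nat_mult)
      finally show ?thesis .
    next
      case False
      then have "expec p ?X (\<lambda>T. ?f (S \<union> T)) \<le> expec p ?X (\<lambda>T. 0 * 0)"
        using DS by (intro expec_mono assms) auto
      also have "\<dots> = 0" unfolding expec_cmult by simp
      also have "\<dots> \<le> exp (- (j * real (m * m)))" by simp
      finally show ?thesis .
    qed
  qed
  also have "\<dots> = exp (- (j * real (m * m)))" using fin by (simp add: expec_const)
  finally show ?thesis .
qed

lemma cross_prob:
  fixes J :: "int ^ 'd::finite \<Rightarrow> int ^ 'd \<Rightarrow> real"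
  assumes "lr_kernel \<alpha> c C J" "0 < \<alpha>" "0 \<le> c" "0 \<le> \<beta>" "a \<noteq> b" "real (sup_norm (a - b)) \<le> s"
  shows "1 - edge_prob J \<beta> {a, b} \<le> exp (- (\<beta> * (c * s powr - (real CARD('d) + \<alpha>))))"
proof -
  have "c * s powr - (real CARD('d) + \<alpha>) \<le> J a b" using assms by (intro lr_lower)
  then have "\<beta> * (c * s powr - (real CARD('d) + \<alpha>)) \<le> \<beta> * J a b" using assms by (intro mult_left_mono)
  then show ?thesis using assms lr_good[OF assms(1)] by (simp add: edge_prob_pair)
qed

definition merge_failure :: "(int ^ 'd::finite \<Rightarrow> int ^ 'd \<Rightarrow> real) \<Rightarrow> real \<Rightarrow> nat \<Rightarrow> nat \<Rightarrow> nat \<Rightarrow> nat \<Rightarrow> int ^ 'd \<Rightarrow> real" where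
  "merge_failure J \<beta> L s n k v = expec (edge_prob J \<beta>) (edges (lbox (L ^ k * s) v)) (\<lambda>S. of_bool (merged_cluster L s n k v S = {}))"

text \<open>A union bound over the at most \<open>(L ^ d) ^ 2\<close> ordered pairs of subboxes in
  \<open>merged_cluster_fail\<close>. Two subboxes are missing with probability at most the square
  of \<delta> by independence; the exponential bounds the absence of an edge.\<close>

lemma merge_failure_Suc:
  fixes J :: "int ^ 'd::finite \<Rightarrow> int ^ 'd \<Rightarrow> real"
  assumes lr: "lr_kernel \<alpha> c C J" "0 < \<alpha>" "0 \<le> c" "0 \<le> \<beta>" and "2 \<le> L"
    and \<delta>: "\<And>v. merge_failure J \<beta> L s n k v \<le> \<delta>" "0 \<le> \<delta>"
  shows "merge_failure J \<beta> L s n (Suc k) v \<le> (real L ^ CARD('d))\<^sup>2 * (\<delta>\<^sup>2 +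
    exp (- (\<beta> * (c * real (L ^ Suc k * s) powr - (real CARD('d) + \<alpha>)) * (real ((L ^ CARD('d) - 1) ^ k * n))\<^sup>2)))"
proof -
  let ?I = "lbox L (0 :: int ^ 'd)"
  let ?V = "lbox (L ^ Suc k * s) v"
  let ?p = "edge_prob J \<beta>"
  let ?sub = "\<lambda>z. lbox (L ^ k * s) (subbox (L ^ k * s) v z)"
  let ?D = "\<lambda>z. merged_cluster L s n k (subbox (L ^ k * s) v z)"
  let ?j = "\<beta> * (c * real (L ^ Suc k * s) powr - (real CARD('d) + \<alpha>))"
  let ?m = "(L ^ CARD('d) - 1) ^ k * n"
  let ?e = "exp (- (?j * real (?m * ?m)))"
  let ?bad = "\<lambda>z z' S. ?D z S = {} \<and> ?D z' S = {}"
  let ?nj = "\<lambda>z z' S. ?D z S \<noteq> {} \<and> ?D z' S \<noteq> {} \<and> (\<forall>a\<in>?D z S. \<forall>b\<in>?D z' S. {a, b} \<notin> S)"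
  have p: "probs ?p" using probs_edge_prob[OF lr_good[OF lr(1)] lr(4)] .
  have sub: "?sub z \<subseteq> ?V" if "z \<in> ?I" for z
    using subbox_subset[OF that, of "L ^ k * s" v] by (simp add: mult.assoc)
  have locD: "?D z (S \<inter> edges (?sub z)) = ?D z S" for z S by (intro merged_cluster_local) simp
  have dis: "?sub z \<inter> ?sub z' = {}" if "z \<noteq> z'" for z z' using subbox_disjoint[OF that] .
  have bad1: "expec ?p (edges ?V) (\<lambda>S. of_bool (?D z S = {})) \<le> \<delta>" if "z \<in> ?I" for z
  proof -
    have "expec ?p (edges ?V) (\<lambda>S. of_bool (?D z S = {})) = expec ?p (edges (?sub z)) (\<lambda>S. of_bool (?D z S = {}))"
      using edges_mono[OF sub[OF that]] locD[of z] by (intro expec_marginal) auto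
    then show ?thesis using \<delta>(1)[of "subbox (L ^ k * s) v z"] by (simp add: merge_failure_def)
  qed
  have bad2: "expec ?p (edges ?V) (\<lambda>S. of_bool (?bad z z' S)) \<le> \<delta>\<^sup>2" if "z \<in> ?I" "z' \<in> ?I" "z \<noteq> z'" for z z'
  proof -
    have "expec ?p (edges ?V) (\<lambda>S. of_bool (?bad z z' S))
        = expec ?p (edges ?V) (\<lambda>S. of_bool (?D z S = {}) * of_bool (?D z' S = {}))"
      by (simp only: of_bool_conj)
    also have "\<dots> = expec ?p (edges ?V) (\<lambda>S. of_bool (?D z S = {})) * expec ?p (edges ?V) (\<lambda>S. of_bool (?D z' S = {}))"
      using edges_disjoint[OF dis[OF that(3)]] locD
      by (intro expec_indep[where A = "edges (?sub z)" and B = "edges (?sub z')"]) auto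
    also have "\<dots> \<le> \<delta> * \<delta>"
      using bad1 that \<delta>(2) p by (intro mult_mono expec_nonneg) auto
    finally show ?thesis by (simp add: power2_eq_square)
  qed
  have nj: "expec ?p (edges ?V) (\<lambda>S. of_bool (?nj z z' S)) \<le> ?e" if "z \<in> ?I" "z' \<in> ?I" "z \<noteq> z'" for z z'
  proof (rule no_join_prob[where ?V1.0 = "?sub z" and ?V2.0 = "?sub z'"])
    fix a b assume ab: "a \<in> ?sub z" "b \<in> ?sub z'"
    then have "a \<noteq> b" using dis[OF that(3)] by auto
    moreover have "sup_norm (a - b) < L ^ Suc k * s" using ab sub that by (intro box_sup_norm_less) auto
    then have "real (sup_norm (a - b)) \<le> real (L ^ Suc k * s)" by (intro of_nat_mono) simp
    ultimately show "1 - ?p {a, b} \<le> exp (- ?j)"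
      using cross_prob[OF lr, of a b "real (L ^ Suc k * s)"] by simp
  next
    show "0 \<le> ?j" using lr by simp
  next
    show "?D z S \<subseteq> ?sub z" "?D z' S \<subseteq> ?sub z'" for S by (rule merged_cluster_subset)+
    show "?m \<le> card (?D z S)" if "?D z S \<noteq> {}" for S using that by (rule merged_cluster_card)
    show "?m \<le> card (?D z' S)" if "?D z' S \<noteq> {}" for S using that by (rule merged_cluster_card)
  qed (use sub that dis p locD in auto)
  have "merge_failure J \<beta> L s n (Suc k) v \<le> expec ?p (edges ?V)
      (\<lambda>S. of_bool (\<exists>zz\<in>?I \<times> ?I. fst zz \<noteq> snd zz \<and> (?bad (fst zz) (snd zz) S \<or> ?nj (fst zz) (snd zz) S)))"
    unfolding merge_failure_def
  proof (rule expec_mono[OF p])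
    fix S
    have "\<exists>zz\<in>?I \<times> ?I. fst zz \<noteq> snd zz \<and> (?bad (fst zz) (snd zz) S \<or> ?nj (fst zz) (snd zz) S)"
      if empty: "merged_cluster L s n (Suc k) v S = {}"
    proof -
      obtain z z' where "z \<in> ?I" "z' \<in> ?I - {z}" "?bad z z' S \<or> ?nj z z' S"
        using merged_cluster_fail[OF empty \<open>2 \<le> L\<close>] by blast
      then show ?thesis by (intro bexI[of _ "(z, z')"]) auto
    qed
    then show "of_bool (merged_cluster L s n (Suc k) v S = {}) \<le>
      (of_bool (\<exists>zz\<in>?I \<times> ?I. fst zz \<noteq> snd zz \<and> (?bad (fst zz) (snd zz) S \<or> ?nj (fst zz) (snd zz) S)) :: real)"
      by simp
  qed
  also have "\<dots> \<le> (\<Sum>zz\<in>?I \<times> ?I. expec ?p (edges ?V)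
      (\<lambda>S. of_bool (fst zz \<noteq> snd zz \<and> (?bad (fst zz) (snd zz) S \<or> ?nj (fst zz) (snd zz) S))))"
    using p by (intro expec_of_bool_Ex_le) auto
  also have "\<dots> \<le> (\<Sum>zz\<in>?I \<times> ?I. \<delta>\<^sup>2 + ?e)"
  proof (rule sum_mono)
    fix zz assume zz: "zz \<in> ?I \<times> ?I"
    show "expec ?p (edges ?V)
      (\<lambda>S. of_bool (fst zz \<noteq> snd zz \<and> (?bad (fst zz) (snd zz) S \<or> ?nj (fst zz) (snd zz) S))) \<le> \<delta>\<^sup>2 + ?e"
    proof (cases "fst zz = snd zz")
      case True
      then have "expec ?p (edges ?V)
        (\<lambda>S. of_bool (fst zz \<noteq> snd zz \<and> (?bad (fst zz) (snd zz) S \<or> ?nj (fst zz) (snd zz) S))) = expec ?p (edges ?V) (\<lambda>S. 0 * 0)"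
        by (intro expec_cong) simp
      also have "\<dots> = 0" unfolding expec_cmult by simp
      also have "0 \<le> \<delta>\<^sup>2 + ?e" by (simp add: add_nonneg_nonneg)
      finally show ?thesis .
    next
      case False
      have "expec ?p (edges ?V)
        (\<lambda>S. of_bool (fst zz \<noteq> snd zz \<and> (?bad (fst zz) (snd zz) S \<or> ?nj (fst zz) (snd zz) S)))
        \<le> expec ?p (edges ?V) (\<lambda>S. of_bool (?bad (fst zz) (snd zz) S) + of_bool (?nj (fst zz) (snd zz) S))"
        by (intro expec_mono p) auto
      also have "\<dots> \<le> \<delta>\<^sup>2 + ?e"
        unfolding expec_add using bad2 nj zz False by (intro add_mono) auto
      finally show ?thesis .
    qed
  qed
  also have "\<dots> = (real L ^ CARD('d))\<^sup>2 * (\<delta>\<^sup>2 + ?e)"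
    by (simp add: card_cartesian_product box_card power2_eq_square)
  finally show ?thesis by (simp add: power2_eq_square)
qed

text \<open>With \<open>N = L ^ d\<close> the starting level \<open>1 / (4 * N ^ 2)\<close> makes
  the quadratic term a quarter of the bound at scale \<open>k\<close>. The exponent
  \<open>?y\<close> starts large by \<open>start\<close> and at least doubles at every scale by
  \<open>growth\<close>, so the exponential term is at most another quarter.\<close>

lemma merge_failure_le:
  fixes J :: "int ^ 'd::finite \<Rightarrow> int ^ 'd \<Rightarrow> real"
  assumes lr: "lr_kernel \<alpha> c C J" "0 < \<alpha>" "0 \<le> c" "0 \<le> \<beta>" and L: "2 \<le> L"
    and growth: "2 * real L powr (real CARD('d) + \<alpha>) \<le> (real (L ^ CARD('d) - 1))\<^sup>2"
    and "1 \<le> s"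
    and base: "\<And>v. merge_failure J \<beta> L s n 0 v \<le> 1 / (4 * (real L ^ CARD('d))\<^sup>2)"
    and start: "16 * (real L ^ CARD('d)) ^ 4 * real L powr (real CARD('d) + \<alpha>)
      \<le> \<beta> * c * (real n)\<^sup>2 * real s powr - (real CARD('d) + \<alpha>)"
  shows "merge_failure J \<beta> L s n k v \<le> 1 / (4 * (real L ^ CARD('d))\<^sup>2) / 2 ^ k"
proof (induction k arbitrary: v)
  case 0
  show ?case using base by simp
next
  case (Suc k)
  let ?N = "real L ^ CARD('d)" and ?q = "real CARD('d) + \<alpha>"
  let ?d = "1 / (4 * ?N\<^sup>2)"
  let ?y = "\<beta> * (c * real (L ^ Suc k * s) powr - ?q) * (real ((L ^ CARD('d) - 1) ^ k * n))\<^sup>2"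
  have N: "0 < ?N" "1 \<le> ?N" using L by auto
  have L0: "0 < real L" using L by simp
  have y: "2 ^ k * (16 * ?N ^ 4) \<le> ?y"
  proof -
    let ?g = "(real (L ^ CARD('d) - 1))\<^sup>2 * real L powr - ?q"
    have split: "real (L ^ Suc k * s) powr - ?q = real L powr - ?q * (real L powr - ?q) ^ k * real s powr - ?q"
      using L0 assms(7) by (simp add: powr_mult power_mult_distrib powr_power mult.commute flip: powr_realpow)
        (simp add: powr_powr algebra_simps)
    have "real L powr - ?q * real L powr ?q = 1" using L0 by (simp add: powr_add[symmetric])
    then have "2 \<le> ?g"
      using mult_right_mono[OF growth, of "real L powr - ?q"] by (simp add: algebra_simps)
    then have g: "2 ^ k \<le> ?g ^ k" by (intro power_mono) auto
    have "16 * ?N ^ 4 = 16 * ?N ^ 4 * real L powr ?q * real L powr - ?q"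
      using L0 by (simp add: powr_add[symmetric])
    also have "\<dots> \<le> \<beta> * c * (real n)\<^sup>2 * real s powr - ?q * real L powr - ?q"
      using start by (intro mult_right_mono) auto
    finally have st: "16 * ?N ^ 4 \<le> \<beta> * c * (real n)\<^sup>2 * real s powr - ?q * real L powr - ?q" .
    have "2 ^ k * (16 * ?N ^ 4) \<le> ?g ^ k * (\<beta> * c * (real n)\<^sup>2 * real s powr - ?q * real L powr - ?q)"
      by (rule mult_mono[OF g st]) auto
    also have "\<dots> = ?y"
      unfolding split by (simp add: power_mult_distrib power2_eq_square algebra_simps)
    finally show ?thesis .
  qed
  \<comment> \<open>The crude bound \<open>exp (- y) \<le> 1 / y\<close> is enough, since only a
    factor 2 per scale has to be gained.\<close>
  have "?y \<le> exp ?y" using exp_ge_add_one_self[of ?y] by linarith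
  then have "exp (- ?y) \<le> 1 / (2 ^ k * (16 * ?N ^ 4))"
    using y N by (simp add: exp_minus field_simps) 
  moreover have "(?d / 2 ^ k)\<^sup>2 \<le> 1 / (16 * ?N ^ 4) / 2 ^ k"
  proof -
    have "(?d / 2 ^ k)\<^sup>2 = 1 / (16 * ?N ^ 4) / (2 ^ k * 2 ^ k)"
      by (simp add: power2_eq_square power4_eq_xxxx)
    also have "\<dots> \<le> 1 / (16 * ?N ^ 4) / 2 ^ k"
      using N by (intro divide_left_mono) auto
    finally show ?thesis .
  qed
  ultimately have le: "(?d / 2 ^ k)\<^sup>2 + exp (- ?y) \<le> 1 / (8 * ?N ^ 4) / 2 ^ k" by (simp add: field_simps)
  have "merge_failure J \<beta> L s n (Suc k) v \<le> ?N\<^sup>2 * ((?d / 2 ^ k)\<^sup>2 + exp (- ?y))"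
    using Suc by (intro merge_failure_Suc[OF lr L]) auto
  also have "\<dots> \<le> ?N\<^sup>2 * (1 / (8 * ?N ^ 4) / 2 ^ k)"
    using le by (intro mult_left_mono) auto
  also have "\<dots> = ?d / 2 ^ Suc k" using N by (simp add: field_simps power2_eq_square power4_eq_xxxx)
  finally show ?case .
qed

lemma percolation_criterion_aux:
  fixes J :: "int ^ 'd::finite \<Rightarrow> int ^ 'd \<Rightarrow> real"
  assumes lr: "lr_kernel \<alpha> c C J" "0 < \<alpha>" "0 \<le> c" "0 \<le> \<beta>" and L: "2 \<le> L"
    and growth: "2 * real L powr (real CARD('d) + \<alpha>) \<le> (real (L ^ CARD('d) - 1))\<^sup>2"
    and "1 \<le> s" "1 \<le> n"
    and base: "\<And>v. merge_failure J \<beta> L s n 0 v \<le> 1 / (4 * (real L ^ CARD('d))\<^sup>2)"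
    and start: "16 * (real L ^ CARD('d)) ^ 4 * real L powr (real CARD('d) + \<alpha>)
      \<le> \<beta> * c * (real n)\<^sup>2 * real s powr - (real CARD('d) + \<alpha>)"
  shows "0 < perc_prob J \<beta>"
proof (rule percolates[OF lr_good[OF lr(1)] lr(4), where V = "\<lambda>k. lbox (L ^ k * s) 0"
      and Q = "\<lambda>k S. merged_cluster L s n k 0 S \<noteq> {}" and \<epsilon> = "\<lambda>k. 1 / (4 * (real L ^ CARD('d))\<^sup>2) / 2 ^ k"])
  show "expec (edge_prob J \<beta>) (edges (lbox (L ^ k * s) 0)) (\<lambda>S. of_bool (\<not> merged_cluster L s n k 0 S \<noteq> {}))
    \<le> 1 / (4 * (real L ^ CARD('d))\<^sup>2) / 2 ^ k" for k
    using merge_failure_le[OF lr L growth assms(7) base start, of k 0] by (simp add: merge_failure_def)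
  show "(\<Sum>k<M. 1 / (4 * (real L ^ CARD('d))\<^sup>2) / 2 ^ k) \<le> 1 / 2" for M
  proof -
    let ?d = "1 / (4 * (real L ^ CARD('d))\<^sup>2)"
    have "(\<Sum>k<M. ?d / 2 ^ k) = ?d * (\<Sum>k<M. (1 / 2) ^ k)"
      unfolding sum_distrib_left by (intro sum.cong) (auto simp: power_one_over)
    also have "\<dots> \<le> ?d * (1 / (1 - 1 / 2))" by (intro mult_left_mono geometric_sum_le) auto
    also have "\<dots> \<le> 1 / 2"
    proof -
      have "1 \<le> (real L ^ CARD('d))\<^sup>2" using L by (intro one_le_power) auto
      then have "1 / (real L ^ CARD('d))\<^sup>2 \<le> 1 / 1" by (intro divide_left_mono) (use L in auto)
      then show ?thesis by simp
    qed
    finally show ?thesis .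
  qed
next
  fix \<omega> :: "(int ^ 'd) set \<Rightarrow> bool"
  assume Q: "\<And>k. merged_cluster L s n k 0 (restr \<omega> (lbox (L ^ k * s) 0)) \<noteq> {}"
  let ?S = "{e. \<omega> e}"
  let ?U = "\<lambda>k. merged_cluster L s n k 0 ?S"
  have "restr \<omega> V = ?S \<inter> edges V" for V by (auto simp: restr_def)
  then have ne: "?U k \<noteq> {}" for k using Q[of k] merged_cluster_local[of L k s 0 "lbox (L ^ k * s) 0" n ?S] by simp
  have step: "?U k \<subseteq> ?U (Suc k)" for k using merged_cluster_step[OF ne] L by simp
  then have "mono ?U" by (intro mono_SucI1 mono_iff_le_Suc[THEN iffD2] allI) 
  then have U0: "?U 0 \<subseteq> ?U k" for k by (rule monoD) simp
  obtain x where x: "x \<in> ?U 0" using ne by blast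
  have sub: "?U k \<subseteq> cluster \<omega> x" for k
    using merged_cluster_conn[of x L s n k 0 ?S] U0[of k] x by (auto simp: cluster_clus clus_def)
  \<comment> \<open>\<open>growth\<close> excludes \<open>L ^ CARD('d) = 2\<close>, where the
    cluster sizes would not grow: the square would be 1, while the left side is at least 2.\<close>
  have two: "2 \<le> L ^ CARD('d) - 1"
  proof (rule ccontr)
    assume "\<not> 2 \<le> L ^ CARD('d) - 1"
    then have "real (L ^ CARD('d) - 1) \<le> 1" by simp
    then have "(real (L ^ CARD('d) - 1))\<^sup>2 \<le> 1" by (simp add: power_le_one)
    moreover have "1 \<le> real L powr (real CARD('d) + \<alpha>)" using L lr by (intro ge_one_powr_ge_zero) auto
    ultimately show False using growth by linarith
  qed
  show "\<exists>x. infinite (cluster \<omega> x)"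
  proof (intro exI notI)
    assume fin: "finite (cluster \<omega> x)"
    let ?m = "card (cluster \<omega> x)"
    have "?m < 2 ^ ?m" by simp
    also have "\<dots> \<le> (L ^ CARD('d) - 1) ^ ?m" using two by (rule power_mono) simp
    also have "\<dots> \<le> (L ^ CARD('d) - 1) ^ ?m * n" using \<open>1 \<le> n\<close> by simp
    also have "\<dots> \<le> card (?U ?m)" using ne by (rule merged_cluster_card)
    also have "\<dots> \<le> ?m" using fin sub by (rule card_mono)
    finally show False by simp
  qed
qed simp

text \<open>Since \<open>\<alpha> < D\<close>, the power \<open>L powr (D - \<alpha>)\<close>
  exceeds 8 for large \<open>L\<close>. Of this 8, a factor 4 pays for replacing
  \<open>L ^ D - 1\<close> by \<open>L ^ D / 2\<close> in the square and 2 is the required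
  growth.\<close>

lemma exists_renormalization_scale:
  assumes "0 < \<alpha>" "\<alpha> < real D" "1 \<le> D"
  shows "\<exists>L\<ge>2. 2 * real L powr (real D + \<alpha>) \<le> (real (L ^ D - 1))\<^sup>2"
proof -
  define L where "L = nat \<lceil>8 powr (1 / (real D - \<alpha>))\<rceil> + 2"
  have L: "2 \<le> L" by (simp add: L_def)
  have "8 powr (1 / (real D - \<alpha>)) \<le> real L" unfolding L_def by linarith
  then have "(8 powr (1 / (real D - \<alpha>))) powr (real D - \<alpha>) \<le> real L powr (real D - \<alpha>)"
    using assms by (intro powr_mono2) auto
  then have 8: "8 \<le> real L powr (real D - \<alpha>)" using assms by (simp add: powr_powr)
  have "real L powr (real D + \<alpha>) * 8 \<le> real L powr (real D + \<alpha>) * real L powr (real D - \<alpha>)"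
    using 8 by (intro mult_left_mono) auto
  also have "\<dots> = real L powr (real D + real D)" by (simp add: powr_add[symmetric])
  also have "\<dots> = (real L ^ D)\<^sup>2" using L unfolding powr_add by (simp add: powr_realpow power2_eq_square)
  finally have 1: "8 * real L powr (real D + \<alpha>) \<le> (real L ^ D)\<^sup>2" by simp
  have "L ^ 1 \<le> L ^ D" using L assms by (intro power_increasing) auto
  then have LD: "2 \<le> L ^ D" using L by simp
  then have "real (L ^ D - 1) = real L ^ D - 1" by (simp add: of_nat_diff)
  moreover have "2 \<le> real L ^ D" using LD by (metis of_nat_le_iff of_nat_numeral of_nat_power)
  ultimately have "real L ^ D / 2 \<le> real (L ^ D - 1)" by simp
  then have "(real L ^ D / 2)\<^sup>2 \<le> (real (L ^ D - 1))\<^sup>2" by (intro power_mono) auto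
  then have "(real L ^ D)\<^sup>2 \<le> 4 * (real (L ^ D - 1))\<^sup>2" by (simp add: power_divide)
  then show ?thesis using 1 L by (intro exI[of _ L]) simp
qed

text \<open>\<open>big n\<close> means more than \<open>n\<close> vertices, so merging starts from
  sets of \<open>Suc n\<close> vertices; hence \<open>real n + 1\<close>. The alternative
  \<open>n = 0\<close> starts from single vertices, which are always present, and yields percolation
  at large \<beta>.\<close>

theorem percolation_criterion:
  fixes \<alpha> c C :: real
  assumes "0 < \<alpha>" "\<alpha> < real CARD('d::finite)" "0 < c"
  shows "\<exists>\<delta>>0. \<delta> < 1 \<and> (\<exists>\<Theta>>0. \<forall>(J :: int ^ 'd \<Rightarrow> int ^ 'd \<Rightarrow> real) \<beta> s n.
    lr_kernel \<alpha> c C J \<longrightarrow> 0 \<le> \<beta> \<longrightarrow> 1 \<le> s \<longrightarrow>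
    \<Theta> \<le> \<beta> * (real n + 1)\<^sup>2 * real s powr - (real CARD('d) + \<alpha>) \<longrightarrow>
    (1 \<le> n \<and> 1 - \<delta> \<le> bigprob (edge_prob J \<beta>) (lbox s 0) n \<or> n = 0) \<longrightarrow> 0 < perc_prob J \<beta>)"
proof -
  obtain L where L: "2 \<le> L" "2 * real L powr (real CARD('d) + \<alpha>) \<le> (real (L ^ CARD('d) - 1))\<^sup>2"
    using exists_renormalization_scale[of \<alpha> "CARD('d)"] assms by (auto simp: Suc_leI)
  define \<delta> where "\<delta> = 1 / (4 * (real L ^ CARD('d))\<^sup>2)"
  define \<Theta> where "\<Theta> = 16 * (real L ^ CARD('d)) ^ 4 * real L powr (real CARD('d) + \<alpha>) / c"
  have "1 \<le> (real L ^ CARD('d))\<^sup>2" using L by (intro one_le_power) auto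
  then have "1 < 4 * (real L ^ CARD('d))\<^sup>2" by linarith
  then have \<delta>: "0 < \<delta>" "\<delta> < 1" unfolding \<delta>_def by (simp_all only: divide_less_eq_1_pos zero_less_divide_1_iff)
  have "0 < \<Theta>" using L assms by (auto simp: \<Theta>_def)
  moreover have "0 < perc_prob J \<beta>"
    if lr: "lr_kernel \<alpha> c C J" and \<beta>: "0 \<le> \<beta>" and s: "1 \<le> s"
      and \<Theta>: "\<Theta> \<le> \<beta> * (real n + 1)\<^sup>2 * real s powr - (real CARD('d) + \<alpha>)"
      and n: "1 \<le> n \<and> 1 - \<delta> \<le> bigprob (edge_prob J \<beta>) (lbox s 0) n \<or> n = 0"
    for J :: "int ^ 'd \<Rightarrow> int ^ 'd \<Rightarrow> real" and \<beta> s n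
  proof (rule percolation_criterion_aux[where L = L and s = s and n = "Suc n"])
    have p: "probs (edge_prob J \<beta>)" using probs_edge_prob[OF lr_good[OF lr] \<beta>] .
    show "merge_failure J \<beta> L s (Suc n) 0 v \<le> 1 / (4 * (real L ^ CARD('d))\<^sup>2)" for v
    proof (cases "n = 0")
      case True
      have ne: "merged_cluster L s (Suc n) 0 v S \<noteq> {}" for S
      proof -
        let ?P = "\<lambda>U. U \<subseteq> lbox s v \<and> Suc n \<le> card U \<and> (\<forall>x\<in>U. \<forall>y\<in>U. conn (S \<inter> edges (lbox s v)) x y)"
        have "v \<in> lbox s v" using s by (auto simp: lbox_def)
        then have ex: "\<exists>U. ?P U" using True by (intro exI[of _ "{v}"]) auto
        then have "merged_cluster L s (Suc n) 0 v S = (SOME U. ?P U)" by (simp add: Let_def)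
        then have "Suc n \<le> card (merged_cluster L s (Suc n) 0 v S)" using someI_ex[OF ex] by simp
        then show ?thesis by (metis card.empty not_less_eq_eq zero_le)
      qed
      have "merge_failure J \<beta> L s (Suc n) 0 v \<le> 0"
        unfolding merge_failure_def using p ne by (intro expec_le_const) auto
      also have "0 \<le> 1 / (4 * (real L ^ CARD('d))\<^sup>2)" by simp
      finally show ?thesis .
    next
      case False
      then have n: "1 \<le> n" "1 - \<delta> \<le> bigprob (edge_prob J \<beta>) (lbox s 0) n" using n by auto
      have "merge_failure J \<beta> L s (Suc n) 0 v \<le> expec (edge_prob J \<beta>) (edges (lbox s v)) (\<lambda>S. 1 - of_bool (big n S))"
        unfolding merge_failure_def power_0 mult_1
      proof (rule expec_mono[OF p])
        fix S assume "S \<subseteq> edges (lbox s v)"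
        then have "S \<inter> edges (lbox s v) = S" by auto
        then have "big n S \<Longrightarrow> merged_cluster L s (Suc n) 0 v S \<noteq> {}"
          using merged_cluster_0_nonempty[of n S s v "Suc n" L] n by simp
        then show "(of_bool (merged_cluster L s (Suc n) 0 v S = {}) :: real) \<le> 1 - of_bool (big n S)" by (cases "big n S") (simp_all del: merged_cluster.simps)
      qed
      also have "\<dots> = 1 - bigprob (edge_prob J \<beta>) (lbox s v) n"
        by (simp add: expec_diff expec_const bigprob_def)
      also have "bigprob (edge_prob J \<beta>) (lbox s v) n = bigprob (edge_prob J \<beta>) (lbox s 0) n"
        using bigprob_translate[OF lr finite_box, of \<beta> v s 0 n] by (simp add: box_translate)
      finally show ?thesis using n by (simp add: \<delta>_def)
    qed
    have "\<Theta> * c \<le> \<beta> * (real n + 1)\<^sup>2 * real s powr - (real CARD('d) + \<alpha>) * c"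
      using \<Theta> assms by (intro mult_right_mono) auto
    then show "16 * (real L ^ CARD('d)) ^ 4 * real L powr (real CARD('d) + \<alpha>)
      \<le> \<beta> * c * (real (Suc n))\<^sup>2 * real s powr - (real CARD('d) + \<alpha>)"
      using assms by (simp add: \<Theta>_def algebra_simps)
  qed (use lr \<beta> s L assms in auto)
  ultimately show ?thesis using \<delta> by blast
qed

locale lr_params =
  fixes \<alpha> c C :: real
  assumes \<alpha>0: "0 < \<alpha>" and \<alpha>1: "\<alpha> < 1" and c0: "0 < c" and C0: "0 < C"
begin

lemma \<alpha>d: "\<alpha> < real CARD('d::finite)"
proof -
  have "1 \<le> real CARD('d)" by (simp add: Suc_leI)
  then show ?thesis using \<alpha>1 by linarith
qed

subsection \<open>Sums of the kernel\<close>

text \<open>\<open>dyadic_tail\<close> with constant weight, counting exponent \<open>d\<close> and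
  decay exponent \<open>d + \<alpha>\<close>. It bounds the total weight of the edges from
  \<open>a\<close> of length at least \<open>k\<close>.\<close>

lemma kernel_tail:
  "\<exists>K>0. \<forall>(J :: int ^ 'd::finite \<Rightarrow> int ^ 'd \<Rightarrow> real) a F k. lr_kernel \<alpha> c C J \<longrightarrow> finite F \<longrightarrow> 1 \<le> k \<longrightarrow>
     (\<Sum>b\<in>{b\<in>F. k \<le> real (sup_norm (b - a))}. J a b) \<le> K * k powr - \<alpha>"
proof -
  let ?D = "real CARD('d)"
  define K where "K = C * (2 powr ?D / (1 - 2 powr (?D - (?D + \<alpha>))) * 3 ^ CARD('d))"
  have "2 powr (?D - (?D + \<alpha>)) < 1" using \<alpha>0 by (intro two_powr_less_one) auto
  then have "0 < K" unfolding K_def using C0 by (intro mult_pos_pos divide_pos_pos) auto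
  moreover have "(\<Sum>b\<in>{b\<in>F. k \<le> real (sup_norm (b - a))}. J a b) \<le> K * k powr - \<alpha>"
    if J: "lr_kernel \<alpha> c C J" and F: "finite F" and k: "1 \<le> k"
    for J :: "int ^ 'd \<Rightarrow> int ^ 'd \<Rightarrow> real" and a F k
  proof -
    have "(\<Sum>b\<in>{b\<in>F. k \<le> real (sup_norm (b - a))}. J a b)
        \<le> (\<Sum>b\<in>{b\<in>F. k \<le> real (sup_norm (b - a))}. C * (1 * real (sup_norm (b - a)) powr - (?D + \<alpha>)))"
    proof (rule sum_mono)
      fix b assume b: "b \<in> {b\<in>F. k \<le> real (sup_norm (b - a))}"
      then have "b \<noteq> a" using k by auto
      then show "J a b \<le> C * (1 * real (sup_norm (b - a)) powr - (?D + \<alpha>))"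
        using lr_upper[OF J, of a b] by (simp add: sup_norm_minus[of a b])
    qed
    also have "\<dots> = C * (\<Sum>b\<in>{b\<in>F. k \<le> real (sup_norm (b - a))}. 1 * real (sup_norm (b - a)) powr - (?D + \<alpha>))"
      by (simp add: sum_distrib_left)
    also have "\<dots> \<le> C * (2 powr ?D / (1 - 2 powr (?D - (?D + \<alpha>))) * 3 ^ CARD('d) * k powr (?D - (?D + \<alpha>)))"
      using C0 \<alpha>0 k F count_le[OF F, of _ a]
      by (intro mult_left_mono dyadic_tail) auto
    finally show ?thesis by (simp add: K_def algebra_simps)
  qed
  ultimately show ?thesis by blast
qed

text \<open>Weighting by the length lowers the decay exponent to \<open>d + \<alpha> - 1\<close>,
  which is below \<open>d\<close> because \<open>\<alpha> < 1\<close>: the sum is dominated by the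
  longest edges, and those much shorter than \<kappa> contribute little.\<close>

lemma kernel_near:
  "\<exists>K>0. \<forall>(J :: int ^ 'd::finite \<Rightarrow> int ^ 'd \<Rightarrow> real) a F \<kappa>. lr_kernel \<alpha> c C J \<longrightarrow> finite F \<longrightarrow> 0 < \<kappa> \<longrightarrow>
     (\<Sum>b\<in>{b\<in>F. b \<noteq> a \<and> real (sup_norm (b - a)) \<le> \<kappa>}. J a b * real (sup_norm (b - a))) \<le> K * \<kappa> powr (1 - \<alpha>)"
proof -
  let ?D = "real CARD('d)"
  let ?p = "?D + \<alpha> - 1"
  have "1 \<le> ?D" by (simp add: Suc_leI)
  then have p: "0 \<le> ?p" "?p < ?D" using \<alpha>0 \<alpha>1 by linarith+
  define K where "K = C * (2 powr ?p / (1 - 2 powr (?p - ?D)) * 3 ^ CARD('d))"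
  have "2 powr (?p - ?D) < 1" using \<alpha>1 by (intro two_powr_less_one) auto
  then have "0 < K" unfolding K_def using C0 by (intro mult_pos_pos divide_pos_pos) auto
  moreover have "(\<Sum>b\<in>{b\<in>F. b \<noteq> a \<and> real (sup_norm (b - a)) \<le> \<kappa>}. J a b * real (sup_norm (b - a))) \<le> K * \<kappa> powr (1 - \<alpha>)"
    if J: "lr_kernel \<alpha> c C J" and F: "finite F" and \<kappa>: "0 < \<kappa>"
    for J :: "int ^ 'd \<Rightarrow> int ^ 'd \<Rightarrow> real" and a F \<kappa>
  proof -
    have eq: "{b\<in>F. b \<noteq> a \<and> real (sup_norm (b - a)) \<le> \<kappa>} = {b\<in>F. 1 \<le> sup_norm (b - a) \<and> real (sup_norm (b - a)) \<le> \<kappa>}"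
      using sup_norm_pos by auto
    have "(\<Sum>b\<in>{b\<in>F. b \<noteq> a \<and> real (sup_norm (b - a)) \<le> \<kappa>}. J a b * real (sup_norm (b - a)))
        \<le> (\<Sum>b\<in>{b\<in>F. b \<noteq> a \<and> real (sup_norm (b - a)) \<le> \<kappa>}. C * (1 * real (sup_norm (b - a)) powr - ?p))"
    proof (rule sum_mono)
      fix b assume b: "b \<in> {b\<in>F. b \<noteq> a \<and> real (sup_norm (b - a)) \<le> \<kappa>}"
      have n: "1 \<le> real (sup_norm (b - a))" using sup_norm_pos[of b a] b by auto
      have "J a b \<le> C * real (sup_norm (b - a)) powr - (?D + \<alpha>)"
        using lr_upper[OF J, of a b] b unfolding sup_norm_minus[of a b] by blast
      then have "J a b * real (sup_norm (b - a)) \<le> C * real (sup_norm (b - a)) powr - (?D + \<alpha>) * real (sup_norm (b - a)) powr 1"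
        using n by (simp add: mult_right_mono)
      also have "\<dots> = C * (1 * real (sup_norm (b - a)) powr - ?p)"
        unfolding mult.assoc powr_add[symmetric] by (simp add: algebra_simps)
      finally show "J a b * real (sup_norm (b - a)) \<le> C * (1 * real (sup_norm (b - a)) powr - ?p)" .
    qed
    also have "\<dots> = C * (\<Sum>b\<in>{b\<in>F. 1 \<le> sup_norm (b - a) \<and> real (sup_norm (b - a)) \<le> \<kappa>}. 1 * real (sup_norm (b - a)) powr - ?p)"
      unfolding eq by (simp add: sum_distrib_left)
    also have "\<dots> \<le> C * (2 powr ?p / (1 - 2 powr (?p - ?D)) * 3 ^ CARD('d) * \<kappa> powr (?D - ?p))"
      using C0 p \<kappa> F count_le[OF F, of _ a]
      by (intro mult_left_mono dyadic_near) auto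
    finally show ?thesis by (simp add: K_def algebra_simps)
  qed
  ultimately show ?thesis by blast
qed

subsection \<open>The critical value and the susceptibility of a ball\<close>

text \<open>Up to a constant, an upper bound for the mean number of open edges leaving the ball from
  the cluster of the origin inside it: a vertex \<open>a\<close> is at distance
  \<open>s + 1 - sup_norm a\<close> from the complement, and \<open>kernel_tail\<close>
  applies.\<close>

definition phi :: "(int ^ 'd::finite \<Rightarrow> int ^ 'd \<Rightarrow> real) \<Rightarrow> real \<Rightarrow> nat \<Rightarrow> real" where
  "phi J \<beta> s = (\<Sum>a\<in>lball s 0. tau (edge_prob J \<beta>) (lball s 0) 0 a * (\<beta> * real (s + 1 - sup_norm a) powr - \<alpha>))"

lemma lball_translate_0: "lball s x = (\<lambda>y. y + x) ` lball s 0"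
  by (simp add: lball_translate)

text \<open>Passing from \<open>W\<close> to the full ball only increases the two-point function.
  The bound is thus uniform in \<open>V\<close> and \<open>x\<close> and can be used at whichever
  vertex maximises the susceptibility of \<open>V\<close>.\<close>

lemma phi_bound:
  fixes J :: "int ^ 'd::finite \<Rightarrow> int ^ 'd \<Rightarrow> real" and s :: nat and x :: "int ^ 'd"
  assumes J: "lr_kernel \<alpha> c C J" and \<beta>: "0 \<le> \<beta>" and V: "finite V" "x \<in> V" and K: "0 \<le> K"
    "\<And>a F k. finite F \<Longrightarrow> 1 \<le> k \<Longrightarrow> (\<Sum>b\<in>{b\<in>F. k \<le> real (sup_norm (b - a))}. J a b) \<le> K * k powr - \<alpha>"
  defines "W \<equiv> V \<inter> lball s x"
  shows "(\<Sum>a\<in>W. \<Sum>b\<in>V - W. tau (edge_prob J \<beta>) W x a * edge_prob J \<beta> {a, b}) \<le> K * phi J \<beta> s"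
proof -
  let ?p = "edge_prob J \<beta>"
  have p: "probs ?p" using probs_edge_prob[OF lr_good[OF J] \<beta>] .
  have finW: "finite W" using V by (simp add: W_def)
  let ?g = "\<lambda>a. tau ?p (lball s x) x a * (\<beta> * (K * real (s + 1 - sup_norm (a - x)) powr - \<alpha>))"
  have "(\<Sum>a\<in>W. \<Sum>b\<in>V - W. tau ?p W x a * ?p {a, b}) \<le> (\<Sum>a\<in>W. ?g a)"
  proof (rule sum_mono)
    fix a assume a: "a \<in> W"
    then have na: "sup_norm (a - x) \<le> s" by (simp add: W_def lball_def)
    let ?k = "real (s + 1 - sup_norm (a - x))"
    have sub: "V - W \<subseteq> {b\<in>V. ?k \<le> real (sup_norm (b - a))}"
    proof
      fix b assume b: "b \<in> V - W"
      then have "s < sup_norm (b - x)" unfolding W_def lball_def using not_le_imp_less by blast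
      then have "s + 1 - sup_norm (a - x) \<le> sup_norm (b - a)" using sup_norm_triangle[of b x a] by simp
      then show "b \<in> {b\<in>V. ?k \<le> real (sup_norm (b - a))}" using b by (simp add: of_nat_mono)
    qed
    have "(\<Sum>b\<in>V - W. tau ?p W x a * ?p {a, b}) \<le> (\<Sum>b\<in>V - W. tau ?p W x a * (\<beta> * J a b))"
      using edge_prob_le[OF lr_good[OF J] \<beta>] tau_nonneg[OF p] by (intro sum_mono mult_left_mono)
    also have "\<dots> = tau ?p W x a * (\<beta> * (\<Sum>b\<in>V - W. J a b))" by (simp add: sum_distrib_left)
    also have "\<dots> \<le> tau ?p W x a * (\<beta> * (\<Sum>b\<in>{b\<in>V. ?k \<le> real (sup_norm (b - a))}. J a b))"
      using sub V lr_good[OF J] tau_nonneg[OF p] \<beta>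
      by (intro mult_left_mono sum_mono2) (auto simp: good_kernel_def)
    also have "\<dots> \<le> tau ?p W x a * (\<beta> * (K * ?k powr - \<alpha>))"
      using V tau_nonneg[OF p] \<beta> na by (intro mult_left_mono K) auto
    also have "\<dots> \<le> ?g a"
      using tau_mono[OF p finite_lball, of W s x x a] \<beta> K by (intro mult_right_mono) (auto simp: W_def)
    finally show "(\<Sum>b\<in>V - W. tau ?p W x a * ?p {a, b}) \<le> ?g a" .
  qed
  also have "\<dots> \<le> (\<Sum>a\<in>lball s x. ?g a)"
    using \<beta> K tau_nonneg[OF p] by (intro sum_mono2) (auto simp: W_def)
  also have "\<dots> = (\<Sum>a\<in>lball s 0. ?g (a + x))"
    unfolding lball_translate_0[of s x] by (subst sum.reindex) (auto simp: inj_on_def)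
  also have "\<dots> = (\<Sum>a\<in>lball s 0. tau ?p (lball s 0) 0 a * (\<beta> * (K * real (s + 1 - sup_norm a) powr - \<alpha>)))"
  proof (rule sum.cong[OF refl])
    fix a
    have "tau ?p (lball s x) x (a + x) = tau ?p (lball s 0) 0 a"
      using tau_translate[OF J finite_lball, of \<beta> x s 0 0 a] lball_translate_0[of s x] by simp
    then show "?g (a + x) = tau ?p (lball s 0) 0 a * (\<beta> * (K * real (s + 1 - sup_norm a) powr - \<alpha>))" by simp
  qed
  also have "\<dots> = K * phi J \<beta> s" by (simp add: phi_def sum_distrib_left algebra_simps)
  finally show ?thesis .
qed

text \<open>Summing \<open>tau_decomposition\<close> over \<open>y\<close>, the largest
  susceptibility \<open>X\<close> of a vertex in \<open>V\<close> satisfies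
  \<open>X \<le> ?M + ?\<phi> * X\<close>. As \<open>?\<phi> < 1\<close>, this bounds mean cluster
  sizes uniformly in \<open>V\<close>.\<close>

lemma subcritical:
  fixes J :: "int ^ 'd::finite \<Rightarrow> int ^ 'd \<Rightarrow> real"
  assumes J: "lr_kernel \<alpha> c C J" and \<beta>: "0 \<le> \<beta>" and K: "0 \<le> K"
    "\<And>a F k. finite F \<Longrightarrow> 1 \<le> k \<Longrightarrow> (\<Sum>b\<in>{b\<in>F. k \<le> real (sup_norm (b - a))}. J a b) \<le> K * k powr - \<alpha>"
    and small: "K * phi J \<beta> s < 1"
  shows "perc_prob J \<beta> = 0"
proof -
  let ?p = "edge_prob J \<beta>" and ?M = "real (card (lball s (0 :: int ^ 'd)))"
  let ?\<phi> = "K * phi J \<beta> s"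
  have p: "probs ?p" using probs_edge_prob[OF lr_good[OF J] \<beta>] .
  have phi0: "0 \<le> ?\<phi>" unfolding phi_def using K \<beta> tau_nonneg[OF p] by (intro mult_nonneg_nonneg sum_nonneg) auto
  have M1: "1 \<le> ?M" by (simp add: card_lball)
  have bound: "(\<Sum>y\<in>V. tau ?p V x y) \<le> ?M / (1 - ?\<phi>)" if V: "finite V" "x \<in> V" for V x
  proof -
    \<comment> \<open>A maximum over the finite set \<open>V\<close>: since \<open>X\<close> is a
      finite number, the term \<open>?\<phi> * X\<close> can be moved to the left.\<close>
    define X where "X = Max ((\<lambda>x. \<Sum>y\<in>V. tau ?p V x y) ` V)"
    have X: "(\<Sum>y\<in>V. tau ?p V x y) \<le> X" if "x \<in> V" for x
      unfolding X_def using V that by (intro Max_ge) auto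
    have "X \<in> (\<lambda>x. \<Sum>y\<in>V. tau ?p V x y) ` V" unfolding X_def using V by (intro Max_in) auto
    then obtain x0 where x0: "x0 \<in> V" "X = (\<Sum>y\<in>V. tau ?p V x0 y)" by auto
    have X0: "0 \<le> X" unfolding x0 using tau_nonneg[OF p] by (intro sum_nonneg)
    define W where "W = V \<inter> lball s x0"
    have W: "W \<subseteq> V" "x0 \<in> W" "finite W" using V x0 by (auto simp: W_def)
    have "X \<le> (\<Sum>y\<in>V. tau ?p W x0 y + (\<Sum>a\<in>W. \<Sum>b\<in>V - W. tau ?p W x0 a * ?p {a, b} * tau ?p V b y))"
      unfolding x0(2) using V W p by (intro sum_mono tau_decomposition)
    also have "\<dots> = (\<Sum>y\<in>V. tau ?p W x0 y) + (\<Sum>a\<in>W. \<Sum>b\<in>V - W. tau ?p W x0 a * ?p {a, b} * (\<Sum>y\<in>V. tau ?p V b y))"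
      unfolding sum.distrib
      by (subst sum.swap, rule arg_cong2[of _ _ _ _ "(+)"], rule refl, rule sum.cong[OF refl],
          subst sum.swap) (simp add: sum_distrib_left)
    also have "(\<Sum>y\<in>V. tau ?p W x0 y) = (\<Sum>y\<in>W. tau ?p W x0 y)"
      using V W tau_outside[of x0 W] by (intro sum.mono_neutral_right) auto
    also have "(\<Sum>y\<in>W. tau ?p W x0 y) \<le> (\<Sum>y\<in>W. 1)" using tau_le_1[OF p W(3)] by (intro sum_mono)
    also have "\<dots> \<le> ?M"
    proof -
      have "card W \<le> card (lball s x0)" by (intro card_mono) (auto simp: W_def)
      then have "real (card W) \<le> real (card (lball s x0))" by (rule of_nat_mono)
      also have "card (lball s x0) = card (lball s (0 :: int ^ 'd))" by (simp only: card_lball)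
      finally show ?thesis by simp
    qed
    also have "(\<Sum>a\<in>W. \<Sum>b\<in>V - W. tau ?p W x0 a * ?p {a, b} * (\<Sum>y\<in>V. tau ?p V b y))
        \<le> (\<Sum>a\<in>W. \<Sum>b\<in>V - W. tau ?p W x0 a * ?p {a, b} * X)"
      using X tau_nonneg[OF p] probsD(1)[OF p] by (intro sum_mono mult_left_mono mult_nonneg_nonneg) auto
    also have "\<dots> = (\<Sum>a\<in>W. \<Sum>b\<in>V - W. tau ?p W x0 a * ?p {a, b}) * X" by (simp add: sum_distrib_right)
    also have "\<dots> \<le> ?\<phi> * X"
      unfolding W_def using X0 by (intro mult_right_mono phi_bound[OF J \<beta> V(1) x0(1) K]) auto
    finally have "X * (1 - ?\<phi>) \<le> ?M" by (simp add: algebra_simps)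
    then have "X \<le> ?M / (1 - ?\<phi>)" using small by (simp add: pos_le_divide_eq)
    then show ?thesis using X[OF V(2)] by linarith
  qed
  have M2: "1 \<le> ?M / (1 - ?\<phi>)" using small phi0 M1 by (simp add: pos_le_divide_eq)
  show ?thesis
  proof (rule no_percolation[OF lr_good[OF J] \<beta>])
    fix x n
    show "expec ?p (edges (lball n 0)) (\<lambda>S. real (card (clus S x))) \<le> ?M / (1 - ?\<phi>)"
    proof (cases "x \<in> lball n 0")
      case True
      then show ?thesis using bound[OF finite_lball True] sum_tau_eq[OF finite_lball True, of ?p] by simp
    next
      case False
      have "clus S x = {x}" if S: "S \<subseteq> edges (lball n 0)" for S
      proof -
        have "y = x" if y: "conn S x y" for y
        proof (rule ccontr)
          assume "y \<noteq> x"
          then obtain w where "{x, w} \<in> S" using conn_first[OF y] by metis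
          then show False using S False by (auto simp: edges_pair)
        qed
        then show ?thesis by (auto simp: clus_def)
      qed
      then have "expec ?p (edges (lball n 0)) (\<lambda>S. real (card (clus S x))) = expec ?p (edges (lball n 0)) (\<lambda>S. 1)"
        by (intro expec_cong) simp
      then show ?thesis using M2 by (simp add: expec_const)
    qed
  qed
qed

lemma continuous_edge_prob: "continuous_on UNIV (\<lambda>\<beta>. edge_prob J \<beta> e)"
  unfolding edge_prob_def by (cases "e \<in> potential_edges") (auto intro!: continuous_intros)

lemma continuous_tau: "continuous_on UNIV (\<lambda>\<beta>. tau (edge_prob J \<beta>) V x y)"
  unfolding tau_def by (intro continuous_expec continuous_edge_prob)

lemma continuous_bigprob: "continuous_on UNIV (\<lambda>\<beta>. bigprob (edge_prob J \<beta>) V n)"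
  unfolding bigprob_def by (intro continuous_expec continuous_edge_prob)

lemma continuous_phi: "continuous_on UNIV (\<lambda>\<beta>. phi J \<beta> s)"
  unfolding phi_def by (intro continuous_intros continuous_tau)

text \<open>The strict reverse inequality would persist in a neighbourhood by continuity, and
  \<open>subcritical\<close> would rule out the percolating parameters that accumulate at the
  critical value.\<close>

lemma phi_critical:
  fixes J :: "int ^ 'd::finite \<Rightarrow> int ^ 'd \<Rightarrow> real"
  assumes J: "lr_kernel \<alpha> c C J" and perc: "0 \<le> \<beta>0" "0 < perc_prob J \<beta>0" and K: "0 \<le> K"
    "\<And>a F k. finite F \<Longrightarrow> 1 \<le> k \<Longrightarrow> (\<Sum>b\<in>{b\<in>F. k \<le> real (sup_norm (b - a))}. J a b) \<le> K * k powr - \<alpha>"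
  shows "1 \<le> K * phi J (critical_value J) s"
proof (rule ccontr)
  let ?bc = "critical_value J"
  assume "\<not> ?thesis"
  then have lt: "K * phi J ?bc s < 1" by simp
  have "isCont (\<lambda>\<beta>. K * phi J \<beta> s) ?bc"
    using continuous_phi[of J s] by (intro continuous_intros) (simp add: continuous_on_eq_continuous_at)
  then have "\<forall>\<^sub>F \<beta> in at ?bc. K * phi J \<beta> s < 1"
    unfolding isCont_def using lt by (rule order_tendstoD)
  then obtain d where d: "0 < d" "\<And>\<beta>. \<beta> \<noteq> ?bc \<Longrightarrow> dist \<beta> ?bc < d \<Longrightarrow> K * phi J \<beta> s < 1"
    unfolding eventually_at by auto
  obtain \<beta> where \<beta>: "?bc \<le> \<beta>" "\<beta> < ?bc + d" "0 \<le> \<beta>" "0 < perc_prob J \<beta>"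
    using above_critical[OF perc, of "?bc + d"] d(1) by auto
  have "K * phi J \<beta> s < 1" using d(2)[of \<beta>] lt \<beta> by (cases "\<beta> = ?bc") (auto simp: dist_real_def)
  then have "perc_prob J \<beta> = 0" using subcritical[OF J \<beta>(3) K] by blast
  then show False using \<beta> by simp
qed

text \<open>The upper bound starts the percolation criterion from single vertices in boxes of side
  1. The lower bound is \<open>phi_critical\<close> at radius 0, where \<open>phi\<close> equals
  \<beta>.\<close>

lemma critical_value_bounds:
  "\<exists>b0>0. \<exists>b1>0. \<forall>(J :: int ^ 'd::finite \<Rightarrow> int ^ 'd \<Rightarrow> real). lr_kernel \<alpha> c C J \<longrightarrow>
     b0 \<le> critical_value J \<and> critical_value J \<le> b1 \<and> 0 < perc_prob J b1"
proof -
  obtain K where K: "0 < K" "\<And>(J :: int ^ 'd \<Rightarrow> int ^ 'd \<Rightarrow> real) a F k. lr_kernel \<alpha> c C J \<Longrightarrow> finite F \<Longrightarrow> 1 \<le> k \<Longrightarrow>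
     (\<Sum>b\<in>{b\<in>F. k \<le> real (sup_norm (b - a))}. J a b) \<le> K * k powr - \<alpha>"
    using kernel_tail[where 'd = 'd] by blast
  obtain \<delta> \<Theta> where crit: "0 < \<Theta>" "\<And>(J :: int ^ 'd \<Rightarrow> int ^ 'd \<Rightarrow> real) \<beta> s n.
    lr_kernel \<alpha> c C J \<Longrightarrow> 0 \<le> \<beta> \<Longrightarrow> 1 \<le> s \<Longrightarrow>
    \<Theta> \<le> \<beta> * (real n + 1)\<^sup>2 * real s powr - (real CARD('d) + \<alpha>) \<Longrightarrow>
    (1 \<le> n \<and> 1 - \<delta> \<le> bigprob (edge_prob J \<beta>) (lbox s 0) n \<or> n = 0) \<Longrightarrow> 0 < perc_prob J \<beta>"
    using percolation_criterion[where 'd = 'd and C = C, OF \<alpha>0 \<alpha>d c0] by blast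
  have "1 / K \<le> critical_value J \<and> critical_value J \<le> \<Theta> \<and> 0 < perc_prob J \<Theta>"
    if J: "lr_kernel \<alpha> c C J" for J :: "int ^ 'd \<Rightarrow> int ^ 'd \<Rightarrow> real"
  proof -
    have perc: "0 < perc_prob J \<Theta>" by (rule crit(2)[OF J, of \<Theta> 1 0]) (use crit(1) in auto)
    have up: "critical_value J \<le> \<Theta>" using critical_nonneg(2)[OF _ perc] crit(1) by simp
    have "1 \<le> K * phi J (critical_value J) 0"
      by (rule phi_critical[OF J _ perc]) (use crit K J in auto)
    moreover have "lball 0 (0 :: int ^ 'd) = {0}" by (auto simp: lball_def)
    ultimately have "1 \<le> K * critical_value J" by (simp add: phi_def)
    then show ?thesis using K(1) up perc by (simp add: field_simps)
  qed
  then show ?thesis using K(1) crit(1) by (intro exI[of _ "1 / K"] conjI exI[of _ \<Theta>]) auto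
qed

lemma critical_value_ge_0: "lr_kernel \<alpha> c C (J :: int ^ 'd::finite \<Rightarrow> int ^ 'd \<Rightarrow> real) \<Longrightarrow> 0 \<le> critical_value J"
  using critical_value_bounds[where 'd = 'd] by (meson less_imp_le order_trans)

abbreviation (input) "pc J \<equiv> edge_prob J (critical_value J)"

lemma probs_pc: "lr_kernel \<alpha> c C (J :: int ^ 'd::finite \<Rightarrow> int ^ 'd \<Rightarrow> real) \<Longrightarrow> probs (pc J)"
  by (intro probs_edge_prob lr_good critical_value_ge_0)

text \<open>\<open>phi_critical\<close> is summed over the radii \<open>s\<close> from
  \<open>r\<close> to \<open>2 * r\<close>. For a fixed \<open>a\<close> the weights
  \<open>(s + 1 - sup_norm a) powr - \<alpha>\<close> sum to order
  \<open>r powr (1 - \<alpha>)\<close> because \<open>\<alpha> < 1\<close>, so \<open>r\<close> is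
  at most a constant times \<open>r powr (1 - \<alpha>)\<close> times the susceptibility at radius
  \<open>2 * r\<close>.\<close>

lemma susceptibility_lower:
  "\<exists>\<kappa>>0. \<forall>(J :: int ^ 'd::finite \<Rightarrow> int ^ 'd \<Rightarrow> real) r. lr_kernel \<alpha> c C J \<longrightarrow>
     \<kappa> * real (r + 1) powr \<alpha> \<le> (\<Sum>a\<in>lball r 0. tau (edge_prob J (critical_value J)) (lball r 0) 0 a)"
proof -
  obtain K where K: "0 < K" "\<And>(J :: int ^ 'd \<Rightarrow> int ^ 'd \<Rightarrow> real) a F k. lr_kernel \<alpha> c C J \<Longrightarrow> finite F \<Longrightarrow> 1 \<le> k \<Longrightarrow>
     (\<Sum>b\<in>{b\<in>F. k \<le> real (sup_norm (b - a))}. J a b) \<le> K * k powr - \<alpha>"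
    using kernel_tail[where 'd = 'd] by blast
  obtain b0 b1 where b: "0 < b0" "0 < b1" "\<And>(J :: int ^ 'd \<Rightarrow> int ^ 'd \<Rightarrow> real). lr_kernel \<alpha> c C J \<Longrightarrow>
     b0 \<le> critical_value J \<and> critical_value J \<le> b1 \<and> 0 < perc_prob J b1"
    using critical_value_bounds[where 'd = 'd] by blast
  define Q where "Q = 2 / (1 - 2 powr (\<alpha> - 1))"
  have "2 powr (\<alpha> - 1) < 1" using \<alpha>1 by (intro two_powr_less_one) auto
  then have Q: "0 < Q" by (simp add: Q_def)
  \<comment> \<open>The second entry serves \<open>R \<le> 1\<close>, where the sum is at least 1
    because of the origin. In the first, \<open>4 powr \<alpha>\<close> comes from
    \<open>R + 1 \<le> 4 * r\<close>.\<close>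
  define \<kappa> where "\<kappa> = min (1 / (K * b1 * Q * 2 powr (1 - \<alpha>)) / 4 powr \<alpha>) (1 / 2 powr \<alpha>)"
  have \<kappa>: "0 < \<kappa>" unfolding \<kappa>_def using K b Q by simp
  have "\<kappa> * real (R + 1) powr \<alpha> \<le> (\<Sum>a\<in>lball R 0. tau (edge_prob J (critical_value J)) (lball R 0) 0 a)"
    if J: "lr_kernel \<alpha> c C J" for J :: "int ^ 'd \<Rightarrow> int ^ 'd \<Rightarrow> real" and R
  proof -
    let ?b = "critical_value J"
    let ?p = "edge_prob J ?b"
    have bc: "0 \<le> ?b" "?b \<le> b1" "0 < perc_prob J b1" using b J by fastforce+
    have p: "probs ?p" using probs_edge_prob[OF lr_good[OF J] bc(1)] .
    let ?\<chi> = "\<lambda>R. \<Sum>a\<in>lball R 0. tau ?p (lball R 0) 0 a"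
    show ?thesis
    proof (cases "R \<le> 1")
      case True
      have "tau ?p (lball R 0) 0 0 \<le> ?\<chi> R"
        using tau_nonneg[OF p] by (intro member_le_sum) auto
      then have "1 \<le> ?\<chi> R" by simp
      moreover have "\<kappa> * real (R + 1) powr \<alpha> \<le> (1 / 2 powr \<alpha>) * 2 powr \<alpha>"
        using True \<alpha>0 by (intro mult_mono powr_mono2) (auto simp: \<kappa>_def)
      ultimately show ?thesis by simp
    next
      case False
      define r where "r = R div 2"
      have r: "1 \<le> r" "2 * r \<le> R" "R + 1 \<le> 4 * r" using False unfolding r_def by presburger+
      let ?B = "lball (2 * r) (0 :: int ^ 'd)"
      have "real r \<le> (\<Sum>s\<in>{r..<2*r}. K * phi J ?b s)"
      proof -
        have "(\<Sum>s\<in>{r..<2*r}. 1) \<le> (\<Sum>s\<in>{r..<2*r}. K * phi J ?b s)"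
          using phi_critical[OF J _ bc(3)] b K J by (intro sum_mono) auto
        then show ?thesis by simp
      qed
      also have "\<dots> \<le> (\<Sum>s\<in>{r..<2*r}. \<Sum>a\<in>?B. of_bool (sup_norm a \<le> s) * (K * (tau ?p ?B 0 a * (b1 * real (s + 1 - sup_norm a) powr - \<alpha>))))"
      proof (rule sum_mono)
        fix s assume s: "s \<in> {r..<2*r}"
        then have sub: "lball s 0 \<subseteq> ?B" by (intro lball_mono) auto
        have "K * phi J ?b s = (\<Sum>a\<in>lball s 0. K * (tau ?p (lball s 0) 0 a * (?b * real (s + 1 - sup_norm a) powr - \<alpha>)))"
          by (simp add: phi_def sum_distrib_left)
        also have "\<dots> \<le> (\<Sum>a\<in>lball s 0. K * (tau ?p ?B 0 a * (b1 * real (s + 1 - sup_norm a) powr - \<alpha>)))"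
          using K(1) bc b tau_nonneg[OF p] tau_mono[OF p finite_lball sub]
          by (intro sum_mono mult_left_mono mult_mono mult_right_mono) auto
        also have "\<dots> = (\<Sum>a\<in>lball s 0. of_bool (sup_norm a \<le> s) * (K * (tau ?p ?B 0 a * (b1 * real (s + 1 - sup_norm a) powr - \<alpha>))))"
          by (intro sum.cong) (auto simp: lball_def)
        also have "\<dots> \<le> (\<Sum>a\<in>?B. of_bool (sup_norm a \<le> s) * (K * (tau ?p ?B 0 a * (b1 * real (s + 1 - sup_norm a) powr - \<alpha>))))"
          using sub K(1) b tau_nonneg[OF p] by (intro sum_mono2) auto
        finally show "K * phi J ?b s \<le> (\<Sum>a\<in>?B. of_bool (sup_norm a \<le> s) * (K * (tau ?p ?B 0 a * (b1 * real (s + 1 - sup_norm a) powr - \<alpha>))))" .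
      qed
      also have "\<dots> = (\<Sum>a\<in>?B. K * b1 * tau ?p ?B 0 a * (\<Sum>s\<in>{r..<2*r}. of_bool (sup_norm a \<le> s) * real (s + 1 - sup_norm a) powr - \<alpha>))"
        unfolding sum_distrib_left by (subst sum.swap, intro sum.cong refl) (simp only: mult_ac)
      also have "\<dots> \<le> (\<Sum>a\<in>?B. K * b1 * tau ?p ?B 0 a * (Q * real (2 * r) powr (1 - \<alpha>)))"
      proof (intro sum_mono mult_left_mono)
        fix a :: "int ^ 'd"
        have "(\<Sum>s\<in>{r..<2*r}. of_bool (sup_norm a \<le> s) * real (s + 1 - sup_norm a) powr - \<alpha>)
            = (\<Sum>s\<in>{s\<in>{r..<2*r}. sup_norm a \<le> s}. real (s + 1 - sup_norm a) powr - \<alpha>)"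
          by (simp only: sum.inter_filter[OF finite_atLeastLessThan]) (intro sum.cong refl, simp)
        also have "\<dots> = (\<Sum>j\<in>(\<lambda>s. s + 1 - sup_norm a) ` {s\<in>{r..<2*r}. sup_norm a \<le> s}. real j powr - \<alpha>)"
          by (subst sum.reindex) (auto simp: inj_on_def)
        also have "\<dots> \<le> (\<Sum>j=1..2*r. real j powr - \<alpha>)"
          by (intro sum_mono2) auto
        also have "\<dots> \<le> Q * real (2 * r) powr (1 - \<alpha>)"
          unfolding Q_def using \<alpha>0 \<alpha>1 r by (intro sum_powr_le) auto
        finally show "(\<Sum>s\<in>{r..<2*r}. of_bool (sup_norm a \<le> s) * real (s + 1 - sup_norm a) powr - \<alpha>)
          \<le> Q * real (2 * r) powr (1 - \<alpha>)" .
      qed (use K b tau_nonneg[OF p] in auto)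
      also have "\<dots> = K * b1 * Q * 2 powr (1 - \<alpha>) * real r powr (1 - \<alpha>) * ?\<chi> (2 * r)"
        by (simp add: sum_distrib_left sum_distrib_right powr_mult algebra_simps)
      finally have main: "real r \<le> K * b1 * Q * 2 powr (1 - \<alpha>) * real r powr (1 - \<alpha>) * ?\<chi> (2 * r)" .
      let ?Z = "K * b1 * Q * 2 powr (1 - \<alpha>)"
      have Z: "0 < ?Z" using K b Q by simp
      have "real r powr \<alpha> * real r powr (1 - \<alpha>) = real r" using r by (simp add: powr_add[symmetric])
      then have "real r powr (1 - \<alpha>) * real r powr \<alpha> \<le> real r powr (1 - \<alpha>) * (?Z * ?\<chi> (2 * r))"
        using main by (simp add: algebra_simps)
      then have "real r powr \<alpha> \<le> ?Z * ?\<chi> (2 * r)"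
        using r by (subst (asm) mult_le_cancel_left_pos) auto
      also have "?\<chi> (2 * r) \<le> ?\<chi> R"
      proof -
        have sub: "?B \<subseteq> lball R 0" using r by (intro lball_mono)
        have "?\<chi> (2 * r) \<le> (\<Sum>a\<in>?B. tau ?p (lball R 0) 0 a)"
          using tau_mono[OF p finite_lball sub] by (intro sum_mono)
        also have "\<dots> \<le> ?\<chi> R" using sub tau_nonneg[OF p] by (intro sum_mono2) auto
        finally show ?thesis .
      qed
      finally have "real r powr \<alpha> \<le> ?Z * ?\<chi> R" using Z by (simp add: mult_left_mono)
      moreover have "real (R + 1) powr \<alpha> \<le> 4 powr \<alpha> * real r powr \<alpha>"
      proof -
        have "real (R + 1) \<le> 4 * real r" using r(3) by linarith
        then have "real (R + 1) powr \<alpha> \<le> (4 * real r) powr \<alpha>" using \<alpha>0 by (intro powr_mono2) auto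
        then show ?thesis by (simp add: powr_mult)
      qed
      ultimately have X: "real (R + 1) powr \<alpha> \<le> 4 powr \<alpha> * (?Z * ?\<chi> R)"
        by (meson mult_left_mono order_trans powr_ge_zero)
      have e0: "0 \<le> 1 / ?Z / 4 powr \<alpha>" using Z by simp
      have "\<kappa> * real (R + 1) powr \<alpha> \<le> 1 / ?Z / 4 powr \<alpha> * real (R + 1) powr \<alpha>"
        by (intro mult_right_mono) (auto simp: \<kappa>_def)
      also have "\<dots> \<le> 1 / ?Z / 4 powr \<alpha> * (4 powr \<alpha> * (?Z * ?\<chi> R))"
        by (rule mult_left_mono[OF X e0])
      also have "\<dots> = ?\<chi> R" using K b Q by simp
      finally show ?thesis .
    qed
  qed
  then show ?thesis using \<kappa> by blast
qed

end

lemma sq_mult_geometric_limit: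
  fixes q :: real
  assumes "0 \<le> q" "q < 1" "0 < \<epsilon>"
  shows "\<exists>m\<ge>1. (real m)\<^sup>2 * q ^ m \<le> \<epsilon>"
proof -
  have "(\<lambda>m. (real m * sqrt q ^ m)\<^sup>2) \<longlonglongrightarrow> 0\<^sup>2"
    using assms by (intro tendsto_power powser_times_n_limit_0) auto
  then have "(\<lambda>m. (real m)\<^sup>2 * q ^ m) \<longlonglongrightarrow> 0"
    using assms by (simp add: power_mult_distrib power_mult[symmetric] mult.commute[of _ 2])
      (simp add: power_mult)
  then have "\<forall>\<^sub>F m in sequentially. (real m)\<^sup>2 * q ^ m < \<epsilon>" using assms by (auto dest: order_tendstoD)
  then obtain m0 where "\<And>m. m0 \<le> m \<Longrightarrow> (real m)\<^sup>2 * q ^ m < \<epsilon>"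
    unfolding eventually_sequentially by auto
  then show ?thesis by (intro exI[of _ "max m0 1"]) (simp add: less_imp_le)
qed

context lr_params
begin

subsection \<open>Clusters in a critical box\<close>

text \<open>If the bound failed at the critical value, the strict inequality would survive at a
  slightly smaller parameter, where \<open>percolation_criterion\<close> would then give
  percolation.\<close>

lemma critical_max_cluster:
  "\<exists>\<delta>>0. \<delta> < 1 \<and> (\<exists>M\<ge>1. \<forall>(J :: int ^ 'd::finite \<Rightarrow> int ^ 'd \<Rightarrow> real) s n. lr_kernel \<alpha> c C J \<longrightarrow> 1 \<le> s \<longrightarrow>
     M * real s powr ((real CARD('d) + \<alpha>) / 2) \<le> real n \<longrightarrow> bigprob (pc J) (lbox s 0) n \<le> 1 - \<delta>)"
proof -
  let ?h = "(real CARD('d) + \<alpha>) / 2"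
  obtain b0 b1 where b: "0 < b0" "0 < b1" "\<And>(J :: int ^ 'd \<Rightarrow> int ^ 'd \<Rightarrow> real). lr_kernel \<alpha> c C J \<Longrightarrow>
     b0 \<le> critical_value J \<and> critical_value J \<le> b1 \<and> 0 < perc_prob J b1"
    using critical_value_bounds[where 'd = 'd] by blast
  obtain \<delta> \<Theta> where crit: "0 < \<delta>" "\<delta> < 1" "0 < \<Theta>" "\<And>(J :: int ^ 'd \<Rightarrow> int ^ 'd \<Rightarrow> real) \<beta> s n.
    lr_kernel \<alpha> c C J \<Longrightarrow> 0 \<le> \<beta> \<Longrightarrow> 1 \<le> s \<Longrightarrow>
    \<Theta> \<le> \<beta> * (real n + 1)\<^sup>2 * real s powr - (real CARD('d) + \<alpha>) \<Longrightarrow>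
    (1 \<le> n \<and> 1 - \<delta> \<le> bigprob (edge_prob J \<beta>) (lbox s 0) n \<or> n = 0) \<Longrightarrow> 0 < perc_prob J \<beta>"
    using percolation_criterion[where 'd = 'd and C = C, OF \<alpha>0 \<alpha>d c0] by blast
  \<comment> \<open>Chosen so that \<Theta> is at most \<open>b0 / 2 * M ^ 2\<close>; the half
    leaves room for the smaller parameter below.\<close>
  define M where "M = max 1 (sqrt (2 * \<Theta> / b0))"
  have M: "1 \<le> M" "2 * \<Theta> / b0 \<le> M\<^sup>2"
  proof -
    have "(sqrt (2 * \<Theta> / b0))\<^sup>2 \<le> M\<^sup>2" using crit b by (intro power_mono) (auto simp: M_def)
    then show "2 * \<Theta> / b0 \<le> M\<^sup>2" using crit b by simp
  qed (simp add: M_def)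
  have "bigprob (pc J) (lbox s 0) n \<le> 1 - \<delta>"
    if J: "lr_kernel \<alpha> c C J" and s: "1 \<le> s" and n: "M * real s powr ?h \<le> real n"
    for J :: "int ^ 'd \<Rightarrow> int ^ 'd \<Rightarrow> real" and s n
  proof (rule ccontr)
    let ?bc = "critical_value J"
    have bc: "b0 \<le> ?bc" using b J by blast
    assume "\<not> ?thesis"
    then have gt: "1 - \<delta> < bigprob (edge_prob J ?bc) (lbox s 0) n" by simp
    have "isCont (\<lambda>\<beta>. bigprob (edge_prob J \<beta>) (lbox s 0) n) ?bc"
      using continuous_bigprob[of J "lbox s 0" n] by (simp add: continuous_on_eq_continuous_at)
    then have "\<forall>\<^sub>F \<beta> in at ?bc. 1 - \<delta> < bigprob (edge_prob J \<beta>) (lbox s 0) n"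
      unfolding isCont_def using gt by (rule order_tendstoD)
    then obtain d where d: "0 < d" "\<And>\<beta>. \<beta> \<noteq> ?bc \<Longrightarrow> dist \<beta> ?bc < d \<Longrightarrow> 1 - \<delta> < bigprob (edge_prob J \<beta>) (lbox s 0) n"
      unfolding eventually_at by auto
    \<comment> \<open>Close enough for the inequality to persist, below the critical value, and
      still at least half of it.\<close>
    define \<beta> where "\<beta> = max (?bc / 2) (?bc - d / 2)"
    have "b0 / 2 \<le> \<beta>" unfolding \<beta>_def by (rule max.coboundedI1) (use bc in simp)
    moreover have "\<beta> < ?bc" using b(1) bc d(1) by (auto simp: \<beta>_def)
    ultimately have \<beta>: "\<beta> < ?bc" "b0 / 2 \<le> \<beta>" "0 \<le> \<beta>" using b(1) by auto
    have "dist \<beta> ?bc < d" using \<beta>(1) d(1) by (auto simp: \<beta>_def dist_real_def)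
    then have big: "1 - \<delta> < bigprob (edge_prob J \<beta>) (lbox s 0) n" using d(2)[of \<beta>] \<beta>(1) by simp
    have s1: "1 \<le> real s powr ?h" using s \<alpha>0 by (intro ge_one_powr_ge_zero) auto
    then have "1 * 1 \<le> M * real s powr ?h" using M by (intro mult_mono) auto
    then have n1: "1 \<le> n" using n by simp
    have "\<Theta> \<le> b0 / 2 * M\<^sup>2" using M(2) b(1) by (simp add: field_simps)
    also have "\<dots> = b0 / 2 * ((M * real s powr ?h)\<^sup>2 * real s powr - (real CARD('d) + \<alpha>))"
      using s by (simp add: power_mult_distrib power2_eq_square powr_add[symmetric])
    also have "\<dots> \<le> \<beta> * ((real n + 1)\<^sup>2 * real s powr - (real CARD('d) + \<alpha>))"
      using \<beta> n M by (intro mult_mono mult_right_mono power_mono) auto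
    finally have "0 < perc_prob J \<beta>"
      using big n1 by (intro crit(4)[OF J \<beta>(3) s, of n]) (auto simp: mult.assoc)
    then show False using below_critical[OF \<beta>(3,1)] by simp
  qed
  then show ?thesis using crit(1,2) M(1) by blast
qed

text \<open>The threshold is taken as \<open>3 * n0 * m\<close>, where \<open>n0\<close> is the
  critical size: \<open>bigprob_tail\<close> makes the probability exponentially small in
  \<open>m\<close>, while the prefactor \<open>n ^ 2\<close> grows only like
  \<open>m ^ 2\<close>.\<close>

lemma critical_tail:
  assumes "0 < \<eta>"
  shows "\<exists>M>0. \<forall>(J :: int ^ 'd::finite \<Rightarrow> int ^ 'd \<Rightarrow> real) s. lr_kernel \<alpha> c C J \<longrightarrow> 1 \<le> s \<longrightarrow>
     (\<exists>n\<ge>1. real n \<le> M * real s powr ((real CARD('d) + \<alpha>) / 2) \<and>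
       expec (pc J) (edges (lbox s 0)) (\<lambda>S. \<Sum>x\<in>lbox s 0. real (card (clus S x)) * of_bool (n < card (clus S x)))
         \<le> \<eta> * real s powr (real CARD('d) + \<alpha>))"
proof -
  let ?h = "(real CARD('d) + \<alpha>) / 2"
  obtain \<delta> M0 where M0: "0 < \<delta>" "\<delta> < 1" "1 \<le> M0" "\<And>(J :: int ^ 'd \<Rightarrow> int ^ 'd \<Rightarrow> real) s n. lr_kernel \<alpha> c C J \<Longrightarrow> 1 \<le> s \<Longrightarrow>
     M0 * real s powr ?h \<le> real n \<Longrightarrow> bigprob (pc J) (lbox s 0) n \<le> 1 - \<delta>"
    using critical_max_cluster[where 'd = 'd] by blast
  \<comment> \<open>The number 648 is \<open>18 * 6 ^ 2\<close>: the constant of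
    \<open>tail_second_moment\<close> times the square of the factor in
    \<open>n \<le> 6 * M0 * m * s powr ?h\<close>.\<close>
  obtain m where m: "1 \<le> m" "(real m)\<^sup>2 * (1 - \<delta>) ^ m \<le> \<eta> * \<delta>\<^sup>2 / (648 * M0\<^sup>2)"
    using sq_mult_geometric_limit[of "1 - \<delta>" "\<eta> * \<delta>\<^sup>2 / (648 * M0\<^sup>2)"] M0 assms by auto
  have "\<exists>n\<ge>1. real n \<le> 6 * M0 * real m * real s powr ?h \<and>
       expec (pc J) (edges (lbox s 0)) (\<lambda>S. \<Sum>x\<in>lbox s 0. real (card (clus S x)) * of_bool (n < card (clus S x)))
         \<le> \<eta> * real s powr (real CARD('d) + \<alpha>)"
    if J: "lr_kernel \<alpha> c C J" and s: "1 \<le> s" for J :: "int ^ 'd \<Rightarrow> int ^ 'd \<Rightarrow> real" and s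
  proof -
    have p: "probs (pc J)" by (rule probs_pc[OF J])
    have s1: "1 \<le> real s powr ?h" using s \<alpha>0 by (intro ge_one_powr_ge_zero) auto
    then have Ms: "1 * 1 \<le> M0 * real s powr ?h" using M0 by (intro mult_mono) auto
    define n0 where "n0 = nat \<lceil>M0 * real s powr ?h\<rceil>"
    have n0: "M0 * real s powr ?h \<le> real n0" "real n0 \<le> 2 * (M0 * real s powr ?h)" "1 \<le> n0"
      using Ms unfolding n0_def by linarith+
    define n where "n = 3 * n0 * m"
    have n1: "1 \<le> n" using n0 m by (simp add: n_def)
    have nle: "real n \<le> 6 * M0 * real m * real s powr ?h"
      using n0(2) by (simp add: n_def) (metis (no_types, opaque_lifting) mult.assoc mult.commute mult_le_cancel_left_pos mult_right_mono of_nat_0_le_iff mult_2 mult_numeral_left_semiring_numeral)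
    let ?b = "bigprob (pc J) (lbox s 0) n"
    have b0: "0 \<le> ?b" using bigprob_bounds[OF finite_box p] by blast
    have "?b \<le> bigprob (pc J) (lbox s 0) n0 ^ m" unfolding n_def using n0 by (intro bigprob_tail p) auto
    also have "\<dots> \<le> (1 - \<delta>) ^ m"
      using M0(4)[OF J s n0(1)] bigprob_bounds[OF finite_box p, of s 0 n0] by (intro power_mono) auto
    finally have bm: "?b \<le> (1 - \<delta>) ^ m" .
    also have "\<dots> \<le> (1 - \<delta>) ^ 1" using M0 m by (intro power_decreasing) auto
    finally have b\<delta>: "\<delta> \<le> 1 - ?b" by simp
    have "expec (pc J) (edges (lbox s 0)) (\<lambda>S. \<Sum>x\<in>lbox s 0. real (card (clus S x)) * of_bool (n < card (clus S x)))
      \<le> 18 * (real n)\<^sup>2 * ?b / (1 - ?b)\<^sup>2"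
      using b\<delta> M0 n1 by (intro tail_second_moment p) auto
    also have "\<dots> \<le> 18 * (6 * M0 * real m * real s powr ?h)\<^sup>2 * (1 - \<delta>) ^ m / \<delta>\<^sup>2"
      using nle bm b\<delta> b0 M0 by (intro frac_le mult_mono power_mono mult_nonneg_nonneg) auto
    also have "\<dots> = 648 * M0\<^sup>2 / \<delta>\<^sup>2 * ((real m)\<^sup>2 * (1 - \<delta>) ^ m) * (real s powr ?h)\<^sup>2"
      by (simp add: power_mult_distrib)
    also have "\<dots> \<le> 648 * M0\<^sup>2 / \<delta>\<^sup>2 * (\<eta> * \<delta>\<^sup>2 / (648 * M0\<^sup>2)) * (real s powr ?h)\<^sup>2"
      using m(2) by (intro mult_right_mono mult_left_mono) auto
    also have "\<dots> = \<eta> * (real s powr ?h)\<^sup>2" using M0 by simp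
    also have "(real s powr ?h)\<^sup>2 = real s powr (real CARD('d) + \<alpha>)"
      using s by (simp add: power2_eq_square powr_add[symmetric])
    finally show ?thesis using n1 nle by blast
  qed
  moreover have "0 < 6 * M0 * real m" using M0 m by simp
  ultimately show ?thesis by blast
qed

text \<open>This is the expected sum of the squared cluster sizes in the box.\<close>

definition box_moment :: "(int ^ 'd::finite \<Rightarrow> int ^ 'd \<Rightarrow> real) \<Rightarrow> nat \<Rightarrow> real" where
  "box_moment J s = (\<Sum>u\<in>lbox s 0. \<Sum>w\<in>lbox s 0. tau (pc J) (lbox s 0) u w)"

text \<open>Two disjoint copies of the box lie in the doubled box. Truncating at the critical size
  loses at most \<open>s powr (d + \<alpha>)\<close> of the moment, by \<open>critical_tail\<close>
  with constant 1, and makes \<open>j * n ^ 2\<close> bounded; pairs from the two copies are then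
  joined as in \<open>tau_ge_trunc_mean\<close>.\<close>

lemma box_moment_doubling:
  "\<exists>k>0. \<forall>(J :: int ^ 'd::finite \<Rightarrow> int ^ 'd \<Rightarrow> real) s. lr_kernel \<alpha> c C J \<longrightarrow> 1 \<le> s \<longrightarrow>
     real s powr (real CARD('d) + \<alpha>) \<le> box_moment J s \<longrightarrow>
     k * real s powr - (real CARD('d) + \<alpha>) * (box_moment J s - real s powr (real CARD('d) + \<alpha>))\<^sup>2
       \<le> box_moment J (2 * s)"
proof -
  let ?q = "real CARD('d) + \<alpha>"
  obtain b0 b1 where b: "0 < b0" "0 < b1" "\<And>(J :: int ^ 'd \<Rightarrow> int ^ 'd \<Rightarrow> real). lr_kernel \<alpha> c C J \<Longrightarrow>
     b0 \<le> critical_value J \<and> critical_value J \<le> b1 \<and> 0 < perc_prob J b1"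
    using critical_value_bounds[where 'd = 'd] by blast
  obtain M where M: "0 < M" "\<And>(J :: int ^ 'd \<Rightarrow> int ^ 'd \<Rightarrow> real) s. lr_kernel \<alpha> c C J \<Longrightarrow> 1 \<le> s \<Longrightarrow>
     \<exists>n\<ge>1. real n \<le> M * real s powr (?q / 2) \<and>
       expec (pc J) (edges (lbox s 0)) (\<lambda>S. \<Sum>x\<in>lbox s 0. real (card (clus S x)) * of_bool (n < card (clus S x)))
         \<le> 1 * real s powr ?q"
    using critical_tail[of 1, where 'd = 'd] zero_less_one by blast
  define k where "k = b0 * c * 2 powr - ?q / (1 + b1 * c * M\<^sup>2)"
  have pos: "0 < 1 + b1 * c * M\<^sup>2" using b c0 by (simp add: add_pos_nonneg)
  have k: "0 < k" unfolding k_def using b c0 pos by simp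
  have "k * real s powr - ?q * (box_moment J s - real s powr ?q)\<^sup>2 \<le> box_moment J (2 * s)"
    if J: "lr_kernel \<alpha> c C J" and s: "1 \<le> s" and big: "real s powr ?q \<le> box_moment J s"
    for J :: "int ^ 'd \<Rightarrow> int ^ 'd \<Rightarrow> real" and s
  proof -
    let ?bc = "critical_value J"
    have bc: "b0 \<le> ?bc" "?bc \<le> b1" "0 \<le> ?bc" using b J by fastforce+
    have p: "probs (pc J)" by (rule probs_pc[OF J])
    obtain n where n: "1 \<le> n" "real n \<le> M * real s powr (?q / 2)"
      "expec (pc J) (edges (lbox s 0)) (\<lambda>S. \<Sum>x\<in>lbox s 0. real (card (clus S x)) * of_bool (n < card (clus S x)))
         \<le> 1 * real s powr ?q"
      using M(2)[OF J s] by blast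
    \<comment> \<open>The index of the diagonally opposite subbox of the doubled box.\<close>
    let ?e = "(\<chi> i. 1) :: int ^ 'd"
    let ?z = "subbox s 0 ?e"
    let ?A = "lbox s (0 :: int ^ 'd)" and ?B = "lbox s ?z" and ?V = "lbox (2 * s) (0 :: int ^ 'd)"
    have e: "?e \<in> lbox 2 0" "(0 :: int ^ 'd) \<in> lbox 2 0" "?e \<noteq> 0" by (auto simp: lbox_def vec_eq_iff)
    have AB: "?A \<subseteq> ?V" "?B \<subseteq> ?V" "?A \<inter> ?B = {}"
      using subbox_subset[OF e(1), of s 0] subbox_subset[OF e(2), of s 0]
        subbox_disjoint[OF e(3)[symmetric], of s 0] by auto
    define j where "j = ?bc * (c * real (2 * s) powr - ?q)"
    have j0: "0 \<le> j" using bc c0 by (simp add: j_def)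
    have spow: "real (2 * s) powr - ?q = 2 powr - ?q * real s powr - ?q" by (simp add: powr_mult)
    have jn: "j * (real n)\<^sup>2 \<le> b1 * c * M\<^sup>2"
    proof -
      have "j * (real n)\<^sup>2 \<le> b1 * (c * (1 * real s powr - ?q)) * (M * real s powr (?q / 2))\<^sup>2"
      proof (intro mult_mono power_mono)
        have "2 powr - ?q \<le> 2 powr 0" using \<alpha>0 by (intro powr_mono) auto
        then show "j \<le> b1 * (c * (1 * real s powr - ?q))"
          unfolding j_def spow using bc c0 by (intro mult_mono mult_left_mono mult_right_mono) auto
      qed (use n b c0 M in auto)
      also have "\<dots> = b1 * c * M\<^sup>2 * (real s powr - ?q * (real s powr (?q / 2) * real s powr (?q / 2)))"
        by (simp add: power_mult_distrib power2_eq_square)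
      also have "real s powr - ?q * (real s powr (?q / 2) * real s powr (?q / 2)) = 1"
        using s unfolding powr_add[symmetric] by simp
      finally show ?thesis by simp
    qed
    have jk: "k * real s powr - ?q \<le> j / (1 + j * (real n)\<^sup>2)"
    proof -
      have "k * real s powr - ?q = b0 * (c * real (2 * s) powr - ?q) / (1 + b1 * c * M\<^sup>2)"
        unfolding k_def spow by simp
      also have "\<dots> \<le> j / (1 + j * (real n)\<^sup>2)"
        unfolding j_def[symmetric] using jn j0 bc c0 pos
        by (intro frac_le) (auto simp: j_def intro!: mult_right_mono add_pos_nonneg)
      finally show ?thesis .
    qed
    let ?T = "\<Sum>u\<in>?A. trunc_mean (pc J) ?A n u"
    have TB: "(\<Sum>w\<in>?B. trunc_mean (pc J) ?B n w) = ?T"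
    proof -
      have B: "?B = (\<lambda>x. x + ?z) ` ?A" by (simp add: box_translate)
      have "(\<Sum>w\<in>?B. trunc_mean (pc J) ?B n w) = (\<Sum>u\<in>?A. trunc_mean (pc J) ?B n (u + ?z))"
        by (subst B, subst sum.reindex) (auto simp: inj_on_def)
      also have "\<dots> = ?T"
        by (intro sum.cong refl) (simp only: B trunc_mean_translate[OF J finite_box])
      finally show ?thesis .
    qed
    have T: "box_moment J s - real s powr ?q \<le> ?T"
      using sum_trunc_mean_ge[OF p finite_box, of s 0 n] n(3) by (simp add: box_moment_def)
    have "k * real s powr - ?q * (box_moment J s - real s powr ?q)\<^sup>2 \<le> j / (1 + j * (real n)\<^sup>2) * ?T\<^sup>2"
      using jk T big k j0 by (intro mult_mono power_mono) auto
    also have "\<dots> = (\<Sum>u\<in>?A. \<Sum>w\<in>?B. j / (1 + j * (real n)\<^sup>2) * (trunc_mean (pc J) ?A n u * trunc_mean (pc J) ?B n w))"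
    proof -
      have "?T\<^sup>2 = ?T * (\<Sum>w\<in>?B. trunc_mean (pc J) ?B n w)" unfolding TB by (rule power2_eq_square)
      also have "\<dots> = (\<Sum>u\<in>?A. \<Sum>w\<in>?B. trunc_mean (pc J) ?A n u * trunc_mean (pc J) ?B n w)"
        by (rule sum_product)
      finally show ?thesis by (simp only: sum_distrib_left)
    qed
    also have "\<dots> \<le> (\<Sum>u\<in>?A. \<Sum>w\<in>?B. tau (pc J) ?V u w)"
    proof (intro sum_mono tau_ge_trunc_mean AB p j0)
      fix a b assume ab: "a \<in> ?A" "b \<in> ?B"
      then have "a \<noteq> b" using AB by auto
      moreover have "sup_norm (a - b) < 2 * s" using ab AB by (intro box_sup_norm_less) auto
      then have "real (sup_norm (a - b)) \<le> real (2 * s)" by (intro of_nat_mono) simp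
      ultimately show "1 - pc J {a, b} \<le> exp (- j)"
        unfolding j_def using c0 by (intro cross_prob[OF J \<alpha>0 _ bc(3)]) auto
    qed auto
    also have "\<dots> \<le> (\<Sum>u\<in>?A. \<Sum>w\<in>?V. tau (pc J) ?V u w)"
      using AB tau_nonneg[OF p] by (intro sum_mono sum_mono2) auto
    also have "\<dots> \<le> box_moment J (2 * s)"
      unfolding box_moment_def using AB tau_nonneg[OF p] by (intro sum_mono2 sum_nonneg) auto
    finally show ?thesis .
  qed
  then show ?thesis using k by blast
qed

text \<open>By the previous lemma a large value of \<open>box_moment J s / s ^ (d + \<alpha>)\<close> would at least
  be multiplied by \<open>2 ^ d\<close> at each doubling of \<open>s\<close>, whereas it is at most \<open>s ^ (d - \<alpha>)\<close>.\<close>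

lemma box_moment_upper:
  "\<exists>A>0. \<forall>(J :: int ^ 'd::finite \<Rightarrow> int ^ 'd \<Rightarrow> real) s. lr_kernel \<alpha> c C J \<longrightarrow> 1 \<le> s \<longrightarrow>
     box_moment J s \<le> A * real s powr (real CARD('d) + \<alpha>)"
proof -
  let ?D = "real CARD('d)"
  let ?q = "?D + \<alpha>"
  obtain k where k: "0 < k" "\<And>(J :: int ^ 'd \<Rightarrow> int ^ 'd \<Rightarrow> real) s. lr_kernel \<alpha> c C J \<Longrightarrow> 1 \<le> s \<Longrightarrow>
     real s powr ?q \<le> box_moment J s \<Longrightarrow>
     k * real s powr - ?q * (box_moment J s - real s powr ?q)\<^sup>2 \<le> box_moment J (2 * s)"
    using box_moment_doubling[where 'd = 'd] by blast
  \<comment> \<open>The entry 2 lets half of the moment absorb the subtracted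
    \<open>t powr ?q\<close>; the other entry turns the quadratic bound into growth by the factor
    \<open>2 powr ?D\<close> per doubling.\<close>
  define A where "A = max 2 (4 * 2 powr ?q * 2 powr ?D / k)"
  have A: "2 \<le> A" "4 * 2 powr ?q * 2 powr ?D / k \<le> A" by (auto simp: A_def)
  have "box_moment J s \<le> A * real s powr ?q"
    if J: "lr_kernel \<alpha> c C J" and s: "1 \<le> s" for J :: "int ^ 'd \<Rightarrow> int ^ 'd \<Rightarrow> real" and s
  proof (rule ccontr)
    assume "\<not> ?thesis"
    then have big: "A * real s powr ?q < box_moment J s" by simp
    have p: "probs (pc J)" by (rule probs_pc[OF J])
    have grow: "2 powr ?D * X * real (2 * t) powr ?q \<le> box_moment J (2 * t)"
      if t: "1 \<le> t" and X: "A \<le> X" "X * real t powr ?q \<le> box_moment J t" for X t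
    proof -
      have X2: "2 \<le> X" using A X by linarith
      have t0: "0 < real t powr ?q" using t by simp
      have Xt: "2 * real t powr ?q \<le> X * real t powr ?q" using X2 by (intro mult_right_mono) auto
      have ge: "X / 2 * real t powr ?q \<le> box_moment J t - real t powr ?q" using X(2) Xt by simp
      have tt: "real t powr - ?q * (real t powr ?q * real t powr ?q) = real t powr ?q"
        using t unfolding powr_add[symmetric] by simp
      have "4 * 2 powr ?q * 2 powr ?D \<le> X * k"
      proof -
        have "4 * 2 powr ?q * 2 powr ?D / k \<le> X" using A(2) X(1) by linarith
        then show ?thesis using k(1) by (simp only: pos_divide_le_eq)
      qed
      then have "X * real t powr ?q * (4 * 2 powr ?q * 2 powr ?D) \<le> X * real t powr ?q * (X * k)"
        using X2 by (intro mult_left_mono) auto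
      then have "2 powr ?D * X * (2 powr ?q * real t powr ?q) \<le> k * real t powr ?q * (X / 2)\<^sup>2"
        by (simp add: power2_eq_square algebra_simps)
      also have "\<dots> = k * (real t powr - ?q * (real t powr ?q * real t powr ?q)) * (X / 2)\<^sup>2" unfolding tt ..
      also have "\<dots> = k * real t powr - ?q * (X / 2 * real t powr ?q)\<^sup>2"
        by (simp add: power_mult_distrib power2_eq_square)
      also have "\<dots> \<le> k * real t powr - ?q * (box_moment J t - real t powr ?q)\<^sup>2"
        using ge X2 k(1) by (intro mult_left_mono power_mono) auto
      also have "\<dots> \<le> box_moment J (2 * t)"
        using Xt X(2) t0 by (intro k(2)[OF J t]) linarith
      finally show ?thesis by (simp add: powr_mult)
    qed
    have iter: "(2 powr ?D) ^ i * A * real (2 ^ i * s) powr ?q \<le> box_moment J (2 ^ i * s)" for i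
    proof (induction i)
      case 0
      then show ?case using big by simp
    next
      case (Suc i)
      have "1 \<le> (2 powr ?D) ^ i" by (intro one_le_power ge_one_powr_ge_zero) auto
      then have "1 * A \<le> (2 powr ?D) ^ i * A" using A by (intro mult_right_mono) auto
      then show ?case using grow[of "2 ^ i * s" "(2 powr ?D) ^ i * A"] Suc s by (simp add: mult.assoc)
    qed
    have upper: "box_moment J t \<le> real t powr (?D - \<alpha>) * real t powr ?q" if "1 \<le> t" for t
    proof -
      have "box_moment J t \<le> (\<Sum>u\<in>lbox t (0 :: int ^ 'd). \<Sum>w\<in>lbox t (0 :: int ^ 'd). 1)"
        unfolding box_moment_def using tau_le_1[OF p] by (intro sum_mono) auto
      also have "\<dots> = real t ^ CARD('d) * real t ^ CARD('d)" by (simp add: box_card)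
      also have "\<dots> = real t powr (?D - \<alpha>) * real t powr ?q"
      proof -
        have "real t ^ CARD('d) = real t powr ?D" using that by (simp add: powr_realpow)
        then show ?thesis by (simp add: powr_add[symmetric])
      qed
      finally show ?thesis .
    qed
    have "(2 powr \<alpha>) ^ i \<le> real s powr (?D - \<alpha>)" for i
    proof -
      let ?t = "2 ^ i * s"
      have t1: "1 \<le> ?t" using s by simp
      have t0: "0 < real ?t powr ?q" using s by simp
      have "(2 powr ?D) ^ i * A * real ?t powr ?q \<le> real ?t powr (?D - \<alpha>) * real ?t powr ?q"
        using iter[of i] upper[OF t1] by linarith
      then have "(2 powr ?D) ^ i * A \<le> real ?t powr (?D - \<alpha>)" using t0 by (simp only: mult_le_cancel_right_pos)
      also have "real ?t powr (?D - \<alpha>) = (2 powr (?D - \<alpha>)) ^ i * real s powr (?D - \<alpha>)"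
        by (simp add: powr_mult powr_power powr_realpow[symmetric] powr_powr mult.commute)
      finally have "(2 powr ?D) ^ i * A \<le> (2 powr (?D - \<alpha>)) ^ i * real s powr (?D - \<alpha>)" .
      moreover have "2 powr ?D = 2 powr (?D - \<alpha>) * 2 powr \<alpha>" by (simp add: powr_add[symmetric])
      ultimately have "(2 powr (?D - \<alpha>)) ^ i * ((2 powr \<alpha>) ^ i * A) \<le> (2 powr (?D - \<alpha>)) ^ i * real s powr (?D - \<alpha>)"
        by (simp add: power_mult_distrib mult.assoc)
      then have "(2 powr \<alpha>) ^ i * A \<le> real s powr (?D - \<alpha>)" by (subst (asm) mult_le_cancel_left_pos) auto
      moreover have "(2 powr \<alpha>) ^ i * 1 \<le> (2 powr \<alpha>) ^ i * A" using A by (intro mult_left_mono) auto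
      ultimately show ?thesis by linarith
    qed
    moreover have "1 < 2 powr \<alpha>" using \<alpha>0 powr_less_mono[of 0 \<alpha> 2] by simp
    then obtain i where "real s powr (?D - \<alpha>) < (2 powr \<alpha>) ^ i" using real_arch_pow by blast
    ultimately show False using not_le by blast
  qed
  then show ?thesis using A by (intro exI[of _ A]) auto
qed


section \<open>Passing between boxes and balls\<close>

lemma susceptibility_translate:
  assumes "lr_kernel \<alpha> c C J"
  shows "(\<Sum>y\<in>lball r u. tau (edge_prob J \<beta>) (lball r u) u y) = (\<Sum>y\<in>lball r 0. tau (edge_prob J \<beta>) (lball r 0) 0 y)"
proof -
  have "(\<Sum>y\<in>lball r u. tau (edge_prob J \<beta>) (lball r u) u y) = (\<Sum>y\<in>lball r 0. tau (edge_prob J \<beta>) (lball r u) u (y + u))"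
    by (subst (1) lball_translate_0, subst sum.reindex) (auto simp: inj_on_def)
  also have "\<dots> = (\<Sum>y\<in>lball r 0. tau (edge_prob J \<beta>) (lball r 0) 0 y)"
  proof (rule sum.cong[OF refl])
    fix y
    show "tau (edge_prob J \<beta>) (lball r u) u (y + u) = tau (edge_prob J \<beta>) (lball r 0) 0 y"
      using tau_translate[OF assms finite_lball, of \<beta> u r 0 0 y] lball_translate_0[of r u] by simp
  qed
  finally show ?thesis .
qed

lemma box_moment_ge_balls:
  fixes J :: "int ^ 'd::finite \<Rightarrow> int ^ 'd \<Rightarrow> real" and U :: "(int ^ 'd) set"
  assumes J: "lr_kernel \<alpha> c C J" and bc: "0 \<le> critical_value J"
    and U: "\<And>u. u \<in> U \<Longrightarrow> lball r u \<subseteq> lbox s 0" "finite U"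
  shows "real (card U) * (\<Sum>y\<in>lball r 0. tau (pc J) (lball r 0) 0 y) \<le> box_moment J s"
proof -
  have p: "probs (pc J)" by (rule probs_pc[OF J])
  have UV: "U \<subseteq> lbox s 0" using U(1) center_in_lball by blast
  have "real (card U) * (\<Sum>y\<in>lball r 0. tau (pc J) (lball r 0) 0 y)
      = (\<Sum>u\<in>U. \<Sum>y\<in>lball r u. tau (pc J) (lball r u) u y)"
  proof -
    have "(\<Sum>u\<in>U. \<Sum>y\<in>lball r u. tau (pc J) (lball r u) u y)
        = (\<Sum>u\<in>U. \<Sum>y\<in>lball r 0. tau (pc J) (lball r 0) 0 y)"
      by (intro sum.cong refl susceptibility_translate[OF J])
    then show ?thesis by simp
  qed
  also have "\<dots> \<le> (\<Sum>u\<in>U. \<Sum>y\<in>lball r u. tau (pc J) (lbox s 0) u y)"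
    using U by (intro sum_mono tau_mono p) auto
  also have "\<dots> \<le> (\<Sum>u\<in>U. \<Sum>y\<in>lbox s 0. tau (pc J) (lbox s 0) u y)"
    using U tau_nonneg[OF p] by (intro sum_mono sum_mono2) auto
  also have "\<dots> \<le> box_moment J s"
    unfolding box_moment_def using UV tau_nonneg[OF p] by (intro sum_mono2 sum_nonneg) auto
  finally show ?thesis .
qed

lemma lball_subset_lbox:
  assumes "u \<in> lbox m (\<chi> i. int R)" "m + 2 * R \<le> s"
  shows "lball R u \<subseteq> lbox s 0"
proof
  fix x assume x: "x \<in> lball R u"
  show "x \<in> lbox s 0" unfolding lbox_def
  proof (intro CollectI allI)
    fix i
    have "\<bar>(x - u) $ i\<bar> \<le> int R" using x by (simp add: lball_def sup_norm_le_iff)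
    moreover have "int R \<le> u $ i \<and> u $ i < int R + int m" using assms(1) by (auto simp: lbox_def)
    ultimately show "0 $ i \<le> x $ i \<and> x $ i < 0 $ i + int s" using assms(2) by (simp add: abs_le_iff)
  qed
qed

text \<open>A box of side \<open>3 * (r + 1)\<close> contains the balls of radius \<open>r\<close>
  around \<open>(r + 1) ^ d\<close> of its points. By translation invariance all these balls have
  the same susceptibility, so the bound on the box moment becomes one for a single ball.\<close>

lemma susceptibility_upper:
  "\<exists>A>0. \<forall>(J :: int ^ 'd::finite \<Rightarrow> int ^ 'd \<Rightarrow> real) r. lr_kernel \<alpha> c C J \<longrightarrow>
     (\<Sum>a\<in>lball r 0. tau (pc J) (lball r 0) 0 a) \<le> A * real (r + 1) powr \<alpha>"
proof -
  let ?D = "real CARD('d)"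
  obtain A where A: "0 < A" "\<And>(J :: int ^ 'd \<Rightarrow> int ^ 'd \<Rightarrow> real) s. lr_kernel \<alpha> c C J \<Longrightarrow> 1 \<le> s \<Longrightarrow>
     box_moment J s \<le> A * real s powr (?D + \<alpha>)"
    using box_moment_upper[where 'd = 'd] by blast
  have "(\<Sum>a\<in>lball r 0. tau (pc J) (lball r 0) 0 a) \<le> A * 3 powr (?D + \<alpha>) * real (r + 1) powr \<alpha>"
    if J: "lr_kernel \<alpha> c C J" for J :: "int ^ 'd \<Rightarrow> int ^ 'd \<Rightarrow> real" and r
  proof -
    let ?s = "r + 1"
    let ?U = "lbox ?s (\<chi> i. int r) :: (int ^ 'd) set"
    have bc: "0 \<le> critical_value J" by (rule critical_value_ge_0[OF J])
    have "real (card ?U) * (\<Sum>y\<in>lball r 0. tau (pc J) (lball r 0) 0 y) \<le> box_moment J (3 * ?s)"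
      by (intro box_moment_ge_balls[OF J bc] lball_subset_lbox) auto
    also have "\<dots> \<le> A * real (3 * ?s) powr (?D + \<alpha>)" by (intro A(2)[OF J]) simp
    also have "real (3 * ?s) powr (?D + \<alpha>) = 3 powr (?D + \<alpha>) * (real ?s powr ?D * real ?s powr \<alpha>)"
      by (simp only: of_nat_mult of_nat_numeral powr_mult powr_add mult_ac)
    also have "real ?s powr ?D = real (card ?U)" by (simp add: box_card powr_realpow del: of_nat_Suc)
    finally have "real (card ?U) * (\<Sum>y\<in>lball r 0. tau (pc J) (lball r 0) 0 y)
        \<le> real (card ?U) * (A * 3 powr (?D + \<alpha>) * real ?s powr \<alpha>)" by (simp only: mult_ac)
    then show ?thesis
    proof (subst (asm) mult_le_cancel_left_pos)
      show "0 < real (card ?U)" by (simp add: box_card)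
    qed
  qed
  then show ?thesis using A(1) by (intro exI[of _ "A * 3 powr (?D + \<alpha>)"]) auto
qed

text \<open>The same comparison in the other direction: with radius about a quarter of the side, at
  least half of the positions in each coordinate are admissible centres.\<close>

lemma box_moment_lower:
  "\<exists>\<kappa>>0. \<forall>(J :: int ^ 'd::finite \<Rightarrow> int ^ 'd \<Rightarrow> real) s. lr_kernel \<alpha> c C J \<longrightarrow> 1 \<le> s \<longrightarrow>
     \<kappa> * real s powr (real CARD('d) + \<alpha>) \<le> box_moment J s"
proof -
  let ?D = "real CARD('d)"
  obtain \<kappa> where \<kappa>: "0 < \<kappa>" "\<And>(J :: int ^ 'd \<Rightarrow> int ^ 'd \<Rightarrow> real) r. lr_kernel \<alpha> c C J \<Longrightarrow>
     \<kappa> * real (r + 1) powr \<alpha> \<le> (\<Sum>a\<in>lball r 0. tau (pc J) (lball r 0) 0 a)"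
    using susceptibility_lower[where 'd = 'd] by blast
  define k where "k = \<kappa> * (1 / 2) powr ?D * (1 / 4) powr \<alpha>"
  have k: "0 < k" using \<kappa> by (simp add: k_def)
  have "k * real s powr (?D + \<alpha>) \<le> box_moment J s"
    if J: "lr_kernel \<alpha> c C J" and s: "1 \<le> s" for J :: "int ^ 'd \<Rightarrow> int ^ 'd \<Rightarrow> real" and s
  proof -
    define R where "R = s div 4"
    have R: "s \<le> 4 * (R + 1)" "4 * R \<le> s" unfolding R_def by presburger+
    define m where "m = s - 2 * R"
    have m: "m + 2 * R = s" "s \<le> 2 * m" using R unfolding m_def by auto
    let ?U = "lbox m (\<chi> i. int R) :: (int ^ 'd) set"
    have bc: "0 \<le> critical_value J" by (rule critical_value_ge_0[OF J])
    have s2: "1 / 2 * real s \<le> real m" using m(2) by linarith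
    have s4: "1 / 4 * real s \<le> real (R + 1)" using of_nat_mono[OF R(1), where 'a = real] by simp
    have m0: "0 < m" using m(2) s by simp
    have "k * real s powr (?D + \<alpha>) = (1 / 2 * real s) powr ?D * (\<kappa> * (1 / 4 * real s) powr \<alpha>)"
      unfolding k_def powr_add powr_mult by (simp only: mult_ac)
    also have "\<dots> \<le> real m powr ?D * (\<kappa> * real (R + 1) powr \<alpha>)"
      using s2 s4 \<alpha>0 \<kappa>(1) by (intro mult_mono mult_left_mono powr_mono2) auto
    also have "real m powr ?D = real (card ?U)" using m0 by (simp add: box_card powr_realpow)
    also have "real (card ?U) * (\<kappa> * real (R + 1) powr \<alpha>)
        \<le> real (card ?U) * (\<Sum>a\<in>lball R 0. tau (pc J) (lball R 0) 0 a)"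
      by (intro mult_left_mono \<kappa>(2)[OF J]) simp
    also have "\<dots> \<le> box_moment J s"
      using m by (intro box_moment_ge_balls[OF J bc] lball_subset_lbox) auto
    finally show ?thesis .
  qed
  then show ?thesis using k by blast
qed

text \<open>\<open>critical_tail\<close> is applied with half the constant of
  \<open>box_moment_lower\<close>, so that truncation costs at most half of the moment. A box of
  side \<open>r + 1\<close> lies in the ball of radius \<open>r\<close> around each of its points,
  which turns the average into a bound at the centre.\<close>

lemma trunc_mean_lower:
  "\<exists>\<kappa>>0. \<exists>M>0. \<forall>(J :: int ^ 'd::finite \<Rightarrow> int ^ 'd \<Rightarrow> real) r. lr_kernel \<alpha> c C J \<longrightarrow>
     (\<exists>n. real n \<le> M * real (r + 1) powr ((real CARD('d) + \<alpha>) / 2) \<and>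
       \<kappa> * real (r + 1) powr \<alpha> \<le> trunc_mean (pc J) (lball r 0) n 0)"
proof -
  let ?D = "real CARD('d)"
  let ?q = "?D + \<alpha>"
  obtain \<kappa> where \<kappa>: "0 < \<kappa>" "\<And>(J :: int ^ 'd \<Rightarrow> int ^ 'd \<Rightarrow> real) s. lr_kernel \<alpha> c C J \<Longrightarrow> 1 \<le> s \<Longrightarrow>
     \<kappa> * real s powr ?q \<le> box_moment J s"
    using box_moment_lower[where 'd = 'd] by blast
  have "0 < \<kappa> / 2" using \<kappa>(1) by simp
  from critical_tail[OF this, where 'd = 'd]
  obtain M where M: "0 < M" "\<And>(J :: int ^ 'd \<Rightarrow> int ^ 'd \<Rightarrow> real) s. lr_kernel \<alpha> c C J \<Longrightarrow> 1 \<le> s \<Longrightarrow>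
     \<exists>n\<ge>1. real n \<le> M * real s powr (?q / 2) \<and>
       expec (pc J) (edges (lbox s 0)) (\<lambda>S. \<Sum>x\<in>lbox s 0. real (card (clus S x)) * of_bool (n < card (clus S x)))
         \<le> \<kappa> / 2 * real s powr ?q"
    by blast
  have "\<exists>n. real n \<le> M * real (r + 1) powr (?q / 2) \<and>
       \<kappa> / 2 * real (r + 1) powr \<alpha> \<le> trunc_mean (pc J) (lball r 0) n 0"
    if J: "lr_kernel \<alpha> c C J" for J :: "int ^ 'd \<Rightarrow> int ^ 'd \<Rightarrow> real" and r
  proof -
    have p: "probs (pc J)" by (rule probs_pc[OF J])
    let ?s = "r + 1"
    let ?V = "lbox ?s (0 :: int ^ 'd)"
    have s1: "1 \<le> ?s" by simp
    obtain n where n: "real n \<le> M * real ?s powr (?q / 2)"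
      "expec (pc J) (edges ?V) (\<lambda>S. \<Sum>x\<in>?V. real (card (clus S x)) * of_bool (n < card (clus S x)))
         \<le> \<kappa> / 2 * real ?s powr ?q"
      using M(2)[OF J s1] by blast
    have "\<kappa> / 2 * real ?s powr ?q \<le> box_moment J ?s
        - expec (pc J) (edges ?V) (\<lambda>S. \<Sum>x\<in>?V. real (card (clus S x)) * of_bool (n < card (clus S x)))"
      using \<kappa>(2)[OF J s1] n(2) by linarith
    also have "\<dots> \<le> (\<Sum>u\<in>?V. trunc_mean (pc J) ?V n u)"
      unfolding box_moment_def by (rule sum_trunc_mean_ge[OF p finite_box])
    also have "\<dots> \<le> (\<Sum>u\<in>?V. trunc_mean (pc J) (lball r 0) n 0)"
    proof (rule sum_mono)
      fix u assume u: "u \<in> ?V"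
      have sub: "?V \<subseteq> lball r u" using box_sup_norm_less[OF _ u] by (force simp: lball_def)
      have "trunc_mean (pc J) ?V n u \<le> trunc_mean (pc J) (lball r u) n u"
        using sub u by (intro trunc_mean_mono p) auto
      also have "\<dots> = trunc_mean (pc J) (lball r 0) n 0"
        using trunc_mean_translate[OF J finite_lball, of "critical_value J" u r 0 n 0] lball_translate_0[of r u] by simp
      finally show "trunc_mean (pc J) ?V n u \<le> trunc_mean (pc J) (lball r 0) n 0" .
    qed
    also have "\<dots> = real ?s powr ?D * trunc_mean (pc J) (lball r 0) n 0"
      by (simp add: box_card powr_realpow del: of_nat_Suc)
    finally have "real ?s powr ?D * (\<kappa> / 2 * real ?s powr \<alpha>) \<le> real ?s powr ?D * trunc_mean (pc J) (lball r 0) n 0"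
      by (simp add: powr_add algebra_simps)
    then have "\<kappa> / 2 * real ?s powr \<alpha> \<le> trunc_mean (pc J) (lball r 0) n 0"
      by (subst (asm) mult_le_cancel_left_pos) auto
    then show ?thesis using n(1) by blast
  qed
  then show ?thesis using \<kappa>(1) M(1) by (intro exI[of _ "\<kappa> / 2"] conjI exI[of _ M]) auto
qed

text \<open>With \<open>N = sup_norm x\<close>, an edge between the two balls has probability of
  order at least \<open>N powr - (d + \<alpha>)\<close> and each truncated cluster has mean size of
  order at least \<open>N powr \<alpha>\<close>. The product has exponent
  \<open>- (d + \<alpha>) + 2 * \<alpha> = \<alpha> - d\<close>.\<close>

lemma two_point_lower:
  "\<exists>B>0. \<forall>(J :: int ^ 'd::finite \<Rightarrow> int ^ 'd \<Rightarrow> real) x. lr_kernel \<alpha> c C J \<longrightarrow> x \<noteq> 0 \<longrightarrow>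
     B * real (sup_norm x) powr (\<alpha> - real CARD('d)) \<le> two_point J (critical_value J) 0 x"
proof -
  let ?D = "real CARD('d)"
  let ?q = "?D + \<alpha>"
  obtain b0 b1 where b: "0 < b0" "0 < b1" "\<And>(J :: int ^ 'd \<Rightarrow> int ^ 'd \<Rightarrow> real). lr_kernel \<alpha> c C J \<Longrightarrow>
     b0 \<le> critical_value J \<and> critical_value J \<le> b1 \<and> 0 < perc_prob J b1"
    using critical_value_bounds[where 'd = 'd] by blast
  obtain \<kappa> M where \<kappa>: "0 < \<kappa>" "0 < M" "\<And>(J :: int ^ 'd \<Rightarrow> int ^ 'd \<Rightarrow> real) r. lr_kernel \<alpha> c C J \<Longrightarrow>
     \<exists>n. real n \<le> M * real (r + 1) powr (?q / 2) \<and>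
       \<kappa> * real (r + 1) powr \<alpha> \<le> trunc_mean (pc J) (lball r 0) n 0"
    using trunc_mean_lower[where 'd = 'd] by blast
  define B where "B = b0 * c * 2 powr - ?q / (1 + b1 * c * M\<^sup>2) * (\<kappa> * (1 / 2) powr \<alpha>)\<^sup>2"
  have pos: "0 < 1 + b1 * c * M\<^sup>2" using b c0 by (simp add: add_pos_nonneg)
  have B: "0 < B" unfolding B_def using b c0 pos \<kappa> by simp
  have "B * real (sup_norm x) powr (\<alpha> - ?D) \<le> two_point J (critical_value J) 0 x"
    if J: "lr_kernel \<alpha> c C J" and x: "x \<noteq> 0" for J :: "int ^ 'd \<Rightarrow> int ^ 'd \<Rightarrow> real" and x
  proof -
    let ?bc = "critical_value J"
    let ?N = "sup_norm x"
    have bc: "b0 \<le> ?bc" "?bc \<le> b1" "0 \<le> ?bc" using b J by fastforce+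
    have p: "probs (pc J)" by (rule probs_pc[OF J])
    have N1: "1 \<le> ?N" using sup_norm_pos[of x 0] x by simp
    \<comment> \<open>The largest radius with \<open>2 * r + 1 \<le> ?N\<close>, which keeps the
      balls around 0 and \<open>x\<close> disjoint.\<close>
    define r where "r = (?N - 1) div 2"
    have r: "2 * r + 1 \<le> ?N" "?N \<le> 2 * (r + 1)" "r + 1 \<le> ?N" using N1 unfolding r_def by presburger+
    obtain n where n: "real n \<le> M * real (r + 1) powr (?q / 2)"
      "\<kappa> * real (r + 1) powr \<alpha> \<le> trunc_mean (pc J) (lball r 0) n 0"
      using \<kappa>(3)[OF J, of r] by blast
    let ?A = "lball r (0 :: int ^ 'd)" and ?B = "lball r x"
    have far: "?N \<le> sup_norm (a - b) + 2 * r" "sup_norm (a - b) \<le> 2 * ?N" if "a \<in> ?A" "b \<in> ?B" for a b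
    proof -
      have ab: "sup_norm a \<le> r" "sup_norm (b - x) \<le> r" using that by (auto simp: lball_def)
      have "sup_norm (x - 0) \<le> sup_norm (x - b) + sup_norm (b - 0)" "sup_norm (b - 0) \<le> sup_norm (b - a) + sup_norm (a - 0)"
        by (rule sup_norm_triangle)+
      then show "?N \<le> sup_norm (a - b) + 2 * r" using ab sup_norm_minus[of x b] sup_norm_minus[of a b] by simp
      have "sup_norm (a - b) \<le> sup_norm (a - 0) + sup_norm (0 - b)" "sup_norm (0 - b) \<le> sup_norm (0 - x) + sup_norm (x - b)"
        by (rule sup_norm_triangle)+
      then show "sup_norm (a - b) \<le> 2 * ?N" using ab r sup_norm_minus[of x b] sup_norm_minus[of 0 x] by simp
    qed
    have ne: "a \<noteq> b" if "a \<in> ?A" "b \<in> ?B" for a b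
      using far(1)[OF that] r(1) by auto
    then have dis: "?A \<inter> ?B = {}" by blast
    define j where "j = ?bc * (c * real (2 * ?N) powr - ?q)"
    have j0: "0 \<le> j" using bc c0 by (simp add: j_def)
    have spow: "real (2 * ?N) powr - ?q = 2 powr - ?q * real ?N powr - ?q" by (simp add: powr_mult)
    have jn: "j * (real n)\<^sup>2 \<le> b1 * c * M\<^sup>2"
    proof -
      have "real n \<le> M * real ?N powr (?q / 2)"
      proof -
        have "real (r + 1) powr (?q / 2) \<le> real ?N powr (?q / 2)"
          using r(3) \<alpha>0 by (intro powr_mono2 of_nat_mono) auto
        then show ?thesis using n(1) \<kappa>(2) by (meson mult_left_mono less_imp_le order_trans)
      qed
      then have "j * (real n)\<^sup>2 \<le> b1 * (c * (1 * real ?N powr - ?q)) * (M * real ?N powr (?q / 2))\<^sup>2"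
      proof (intro mult_mono power_mono)
        have "2 powr - ?q \<le> 2 powr 0" using \<alpha>0 by (intro powr_mono) auto
        then show "j \<le> b1 * (c * (1 * real ?N powr - ?q))"
          unfolding j_def spow using bc c0 by (intro mult_mono mult_left_mono mult_right_mono) auto
      qed (use b c0 \<kappa> in auto)
      also have "\<dots> = b1 * c * M\<^sup>2 * (real ?N powr - ?q * (real ?N powr (?q / 2) * real ?N powr (?q / 2)))"
        by (simp add: power_mult_distrib power2_eq_square)
      also have "real ?N powr - ?q * (real ?N powr (?q / 2) * real ?N powr (?q / 2)) = 1"
        using x unfolding powr_add[symmetric] by simp
      finally show ?thesis by simp
    qed
    have jk: "b0 * c * 2 powr - ?q / (1 + b1 * c * M\<^sup>2) * real ?N powr - ?q \<le> j / (1 + j * (real n)\<^sup>2)"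
    proof -
      have "b0 * c * 2 powr - ?q / (1 + b1 * c * M\<^sup>2) * real ?N powr - ?q = b0 * (c * real (2 * ?N) powr - ?q) / (1 + b1 * c * M\<^sup>2)"
        unfolding spow by simp
      also have "\<dots> \<le> j / (1 + j * (real n)\<^sup>2)"
        unfolding j_def[symmetric] using jn j0 bc c0 pos
        by (intro frac_le) (auto simp: j_def intro!: mult_right_mono add_pos_nonneg)
      finally show ?thesis .
    qed
    have TB: "trunc_mean (pc J) ?B n x = trunc_mean (pc J) ?A n 0"
      using trunc_mean_translate[OF J finite_lball, of ?bc x r 0 n 0] lball_translate_0[of r x] by simp
    have TA: "\<kappa> * (1 / 2) powr \<alpha> * real ?N powr \<alpha> \<le> trunc_mean (pc J) ?A n 0"
    proof -
      have "1 / 2 * real ?N \<le> real (r + 1)" using of_nat_mono[OF r(2), where 'a = real] by simp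
      then have "(1 / 2 * real ?N) powr \<alpha> \<le> real (r + 1) powr \<alpha>" using \<alpha>0 by (intro powr_mono2) auto
      then have "\<kappa> * (1 / 2 * real ?N) powr \<alpha> \<le> \<kappa> * real (r + 1) powr \<alpha>" using \<kappa>(1) by (intro mult_left_mono) auto
      then show ?thesis using n(2) unfolding powr_mult by (simp only: mult.assoc)
    qed
    have "real ?N powr (\<alpha> - ?D) = real ?N powr - ?q * (real ?N powr \<alpha> * real ?N powr \<alpha>)"
      unfolding powr_add[symmetric] by simp
    then have "B * real ?N powr (\<alpha> - ?D) = (b0 * c * 2 powr - ?q / (1 + b1 * c * M\<^sup>2) * real ?N powr - ?q)
        * (\<kappa> * (1 / 2) powr \<alpha> * real ?N powr \<alpha>)\<^sup>2"
      unfolding B_def power2_eq_square by (simp only: mult_ac times_divide_eq_left times_divide_eq_right)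
    also have "\<dots> \<le> j / (1 + j * (real n)\<^sup>2) * (trunc_mean (pc J) ?A n 0)\<^sup>2"
      using jk TA j0 \<kappa>(1) b c0 pos by (intro mult_mono power_mono) auto
    also have "\<dots> = j / (1 + j * (real n)\<^sup>2) * (trunc_mean (pc J) ?A n 0 * trunc_mean (pc J) ?B n x)"
      unfolding TB by (simp add: power2_eq_square)
    also have "\<dots> \<le> tau (pc J) (?A \<union> ?B) 0 x"
    proof (intro tau_ge_trunc_mean p j0 dis)
      fix a b assume ab: "a \<in> ?A" "b \<in> ?B"
      have "real (sup_norm (a - b)) \<le> real (2 * ?N)" using far(2)[OF ab] by (rule of_nat_mono)
      then show "1 - pc J {a, b} \<le> exp (- j)"
        unfolding j_def using c0 ne[OF ab] by (intro cross_prob[OF J \<alpha>0 _ bc(3)]) auto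
    qed auto
    also have "\<dots> \<le> two_point J ?bc 0 x"
      by (intro two_point_ge[OF lr_good[OF J] bc(3)]) auto
    finally show ?thesis .
  qed
  then show ?thesis using B by blast
qed


subsection \<open>The pointwise upper bound\<close>

text \<open>Averaging the decomposition over balls of radius \<open>s\<close> with \<open>r \<le> s < 2 * r\<close>: the edge
  \<open>{a, b}\<close> leaves at most \<open>min r (sup_norm (b - a))\<close> of these balls.\<close>

lemma averaged_decomposition:
  fixes J :: "int ^ 'd::finite \<Rightarrow> int ^ 'd \<Rightarrow> real"
  assumes J: "lr_kernel \<alpha> c C J" and \<beta>: "0 \<le> \<beta>" and V: "finite V" "x \<in> V"
  shows "real r * tau (edge_prob J \<beta>) V x y \<le> real r * tau (edge_prob J \<beta>) (lball (2 * r) x) x y +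
    (\<Sum>a\<in>V \<inter> lball (2 * r) x. \<Sum>b\<in>{b\<in>V. b \<noteq> a \<and> r < sup_norm (b - x)}.
       tau (edge_prob J \<beta>) (lball (2 * r) x) x a * (\<beta> * (J a b * real (min r (sup_norm (b - a)))) * tau (edge_prob J \<beta>) V b y))"
proof -
  let ?p = "edge_prob J \<beta>"
  have p: "probs ?p" using probs_edge_prob[OF lr_good[OF J] \<beta>] .
  let ?B = "lball (2 * r) x"
  let ?t = "tau ?p ?B x"
  let ?W = "\<lambda>s. V \<inter> lball s x"
  let ?F = "\<lambda>a b. ?t a * (\<beta> * J a b * tau ?p V b y)"
  let ?X = "V \<inter> ?B" and ?Y = "\<lambda>a. {b\<in>V. b \<noteq> a \<and> r < sup_norm (b - x)}"
  let ?I = "\<lambda>a b s. of_bool (sup_norm (a - x) \<le> s \<and> s < sup_norm (b - x)) :: real"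
  have F0: "0 \<le> ?F a b" for a b
    using tau_nonneg[OF p] \<beta> lr_good[OF J] by (auto simp: good_kernel_def)
  have each: "tau ?p V x y \<le> ?t y + (\<Sum>a\<in>?X. \<Sum>b\<in>?Y a. ?I a b s * ?F a b)" if s: "s \<in> {r..<2*r}" for s
  proof -
    have sub: "?W s \<subseteq> ?B" "?W s \<subseteq> V" "?W s \<subseteq> ?X" using s lball_mono[of s "2 * r" x] by auto
    have "tau ?p V x y \<le> tau ?p (?W s) x y + (\<Sum>a\<in>?W s. \<Sum>b\<in>V - ?W s. tau ?p (?W s) x a * ?p {a, b} * tau ?p V b y)"
      using V p sub by (intro tau_decomposition) auto
    also have "\<dots> \<le> ?t y + (\<Sum>a\<in>?W s. \<Sum>b\<in>V - ?W s. ?I a b s * ?F a b)"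
    proof (intro add_mono sum_mono)
      show "tau ?p (?W s) x y \<le> ?t y" using sub by (intro tau_mono p) auto
      fix a b assume ab: "a \<in> ?W s" "b \<in> V - ?W s"
      then have "?I a b s = 1" by (auto simp: lball_def not_le)
      moreover have "tau ?p (?W s) x a * ?p {a, b} * tau ?p V b y \<le> ?t a * (\<beta> * J a b) * tau ?p V b y"
        using sub tau_nonneg[OF p] probsD(1)[OF p] edge_prob_le[OF lr_good[OF J] \<beta>]
        by (intro mult_right_mono mult_mono tau_mono p) auto
      ultimately show "tau ?p (?W s) x a * ?p {a, b} * tau ?p V b y \<le> ?I a b s * ?F a b"
        by (simp add: mult.assoc)
    qed
    also have "(\<Sum>a\<in>?W s. \<Sum>b\<in>V - ?W s. ?I a b s * ?F a b) \<le> (\<Sum>a\<in>?W s. \<Sum>b\<in>?Y a. ?I a b s * ?F a b)"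
    proof (intro sum_mono sum_mono2)
      fix a assume a: "a \<in> ?W s"
      show "V - ?W s \<subseteq> ?Y a" using a s by (auto simp: lball_def)
    qed (use V F0 in auto)
    also have "\<dots> \<le> (\<Sum>a\<in>?X. \<Sum>b\<in>?Y a. ?I a b s * ?F a b)"
    proof (rule sum_mono2)
      fix a show "0 \<le> (\<Sum>b\<in>?Y a. ?I a b s * ?F a b)"
        by (rule sum_nonneg, rule mult_nonneg_nonneg[OF _ F0]) simp
    qed (use V sub in auto)
    finally show ?thesis by simp
  qed
  have count: "(\<Sum>s\<in>{r..<2*r}. ?I a b s) \<le> real (min r (sup_norm (b - a)))" for a b
  proof -
    have "(\<Sum>s\<in>{r..<2*r}. ?I a b s) = real (card {s\<in>{r..<2*r}. sup_norm (a - x) \<le> s \<and> s < sup_norm (b - x)})"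
      by (simp add: Int_def conj_ac)
    also have "card {s\<in>{r..<2*r}. sup_norm (a - x) \<le> s \<and> s < sup_norm (b - x)} \<le> min r (sup_norm (b - a))"
    proof (rule min.boundedI)
      have "card {s\<in>{r..<2*r}. sup_norm (a - x) \<le> s \<and> s < sup_norm (b - x)} \<le> card {r..<2*r}"
        by (intro card_mono) auto
      then show "card {s\<in>{r..<2*r}. sup_norm (a - x) \<le> s \<and> s < sup_norm (b - x)} \<le> r" by simp
      have "card {s\<in>{r..<2*r}. sup_norm (a - x) \<le> s \<and> s < sup_norm (b - x)} \<le> card {sup_norm (a - x)..<sup_norm (b - x)}"
        by (intro card_mono) auto
      also have "\<dots> \<le> sup_norm (b - a)" using sup_norm_triangle[of b x a] by simp
      finally show "card {s\<in>{r..<2*r}. sup_norm (a - x) \<le> s \<and> s < sup_norm (b - x)} \<le> sup_norm (b - a)" .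
    qed
    finally show ?thesis by simp
  qed
  have "real r * tau ?p V x y = (\<Sum>s\<in>{r..<2*r}. tau ?p V x y)" by simp
  also have "\<dots> \<le> (\<Sum>s\<in>{r..<2*r}. ?t y + (\<Sum>a\<in>?X. \<Sum>b\<in>?Y a. ?I a b s * ?F a b))"
    using each by (rule sum_mono)
  also have "\<dots> = real r * ?t y + (\<Sum>a\<in>?X. \<Sum>b\<in>?Y a. (\<Sum>s\<in>{r..<2*r}. ?I a b s) * ?F a b)"
  proof -
    have "(\<Sum>s\<in>{r..<2*r}. \<Sum>a\<in>?X. \<Sum>b\<in>?Y a. ?I a b s * ?F a b) = (\<Sum>a\<in>?X. \<Sum>s\<in>{r..<2*r}. \<Sum>b\<in>?Y a. ?I a b s * ?F a b)"
      by (rule sum.swap)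
    also have "\<dots> = (\<Sum>a\<in>?X. \<Sum>b\<in>?Y a. \<Sum>s\<in>{r..<2*r}. ?I a b s * ?F a b)"
      by (intro sum.cong refl sum.swap)
    finally show ?thesis by (simp only: sum.distrib sum_distrib_right sum_constant card_atLeastLessThan) simp
  qed
  also have "\<dots> \<le> real r * ?t y + (\<Sum>a\<in>?X. \<Sum>b\<in>?Y a. real (min r (sup_norm (b - a))) * ?F a b)"
    using count F0 by (intro add_left_mono sum_mono mult_right_mono)
  finally show ?thesis by (simp only: mult_ac)
qed

text \<open>Edges shorter than \<open>r\<close> are counted with their length
  (\<open>kernel_near\<close>), longer ones with \<open>r\<close> (\<open>kernel_tail\<close>); both
  contributions have order \<open>r powr (1 - \<alpha>)\<close>.\<close>

lemma kernel_weighted: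
  "\<exists>K>0. \<forall>(J :: int ^ 'd::finite \<Rightarrow> int ^ 'd \<Rightarrow> real) a F r. lr_kernel \<alpha> c C J \<longrightarrow> finite F \<longrightarrow> 1 \<le> r \<longrightarrow>
     (\<Sum>b\<in>{b\<in>F. b \<noteq> a}. J a b * real (min r (sup_norm (b - a)))) \<le> K * real r powr (1 - \<alpha>)"
proof -
  obtain K1 where K1: "0 < K1" "\<And>(J :: int ^ 'd \<Rightarrow> int ^ 'd \<Rightarrow> real) a F k. lr_kernel \<alpha> c C J \<Longrightarrow> finite F \<Longrightarrow> 1 \<le> k \<Longrightarrow>
     (\<Sum>b\<in>{b\<in>F. k \<le> real (sup_norm (b - a))}. J a b) \<le> K1 * k powr - \<alpha>"
    using kernel_tail[where 'd = 'd] by blast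
  obtain K2 where K2: "0 < K2" "\<And>(J :: int ^ 'd \<Rightarrow> int ^ 'd \<Rightarrow> real) a F \<kappa>. lr_kernel \<alpha> c C J \<Longrightarrow> finite F \<Longrightarrow> 0 < \<kappa> \<Longrightarrow>
     (\<Sum>b\<in>{b\<in>F. b \<noteq> a \<and> real (sup_norm (b - a)) \<le> \<kappa>}. J a b * real (sup_norm (b - a))) \<le> K2 * \<kappa> powr (1 - \<alpha>)"
    using kernel_near[where 'd = 'd] by blast
  have "(\<Sum>b\<in>{b\<in>F. b \<noteq> a}. J a b * real (min r (sup_norm (b - a)))) \<le> (K1 + K2) * real r powr (1 - \<alpha>)"
    if J: "lr_kernel \<alpha> c C J" and F: "finite F" and r: "1 \<le> r" for J :: "int ^ 'd \<Rightarrow> int ^ 'd \<Rightarrow> real" and a F r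
  proof -
    let ?N = "{b\<in>F. b \<noteq> a \<and> real (sup_norm (b - a)) \<le> real r}" and ?T = "{b\<in>F. real r \<le> real (sup_norm (b - a))}"
    have J0: "0 \<le> J a b" for a b using lr_good[OF J] by (simp add: good_kernel_def)
    have "(\<Sum>b\<in>{b\<in>F. b \<noteq> a}. J a b * real (min r (sup_norm (b - a)))) \<le> (\<Sum>b\<in>?N \<union> ?T. J a b * real (min r (sup_norm (b - a))))"
      using F J0 by (intro sum_mono2) auto
    also have "\<dots> \<le> (\<Sum>b\<in>?N. J a b * real (min r (sup_norm (b - a)))) + (\<Sum>b\<in>?T. J a b * real (min r (sup_norm (b - a))))"
    proof -
      have "0 \<le> (\<Sum>b\<in>?N \<inter> ?T. J a b * real (min r (sup_norm (b - a))))" using J0 by (intro sum_nonneg) auto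
      then show ?thesis
        using sum.union_inter[of ?N ?T "\<lambda>b. J a b * real (min r (sup_norm (b - a)))"] F by simp
    qed
    also have "(\<Sum>b\<in>?N. J a b * real (min r (sup_norm (b - a)))) \<le> (\<Sum>b\<in>?N. J a b * real (sup_norm (b - a)))"
      using J0 by (intro sum_mono mult_left_mono) auto
    also have "\<dots> \<le> K2 * real r powr (1 - \<alpha>)" using r by (intro K2(2)[OF J F]) auto
    also have "(\<Sum>b\<in>?T. J a b * real (min r (sup_norm (b - a)))) \<le> (\<Sum>b\<in>?T. J a b * real r)"
      using J0 by (intro sum_mono mult_left_mono) auto
    also have "\<dots> = (\<Sum>b\<in>?T. J a b) * real r" by (simp add: sum_distrib_right)
    also have "\<dots> \<le> K1 * real r powr - \<alpha> * real r" using r by (intro mult_right_mono K1(2)[OF J F]) auto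
    also have "\<dots> = K1 * real r powr (1 - \<alpha>)"
    proof -
      have "real r powr - \<alpha> * real r powr 1 = real r powr (1 - \<alpha>)" unfolding powr_add[symmetric] by simp
      then show ?thesis using r by simp
    qed
    finally show ?thesis by (simp add: algebra_simps)
  qed
  then show ?thesis using K1(1) K2(1) by (intro exI[of _ "K1 + K2"]) auto
qed

text \<open>Both the connection and its end points are confined to \<open>V\<close>, so a finite
  constant exists trivially for each finite \<open>V\<close>.\<close>

definition decay :: "(int ^ 'd::finite \<Rightarrow> int ^ 'd \<Rightarrow> real) \<Rightarrow> (int ^ 'd) set \<Rightarrow> real \<Rightarrow> bool" where
  "decay J V A \<longleftrightarrow> (\<forall>u\<in>V. \<forall>v\<in>V. u \<noteq> v \<longrightarrow> tau (pc J) V u v \<le> A * real (sup_norm (u - v)) powr (\<alpha> - real CARD('d)))"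

text \<open>\<open>susceptibility_upper\<close> covers only connections inside a ball. A path that
  leaves the ball of radius about \<open>K * \<rho>\<close> must come back from a distance of order
  \<open>K * \<rho>\<close>, at a cost controlled by the decay constant \<open>A\<close>. The
  coefficient of \<open>A\<close> decreases with \<open>K\<close> since
  \<open>\<alpha> < d\<close>.\<close>

lemma local_sum_bound:
  "\<exists>E1>0. \<exists>E2>0. \<forall>(J :: int ^ 'd::finite \<Rightarrow> int ^ 'd \<Rightarrow> real) V x A K \<rho>.
     lr_kernel \<alpha> c C J \<longrightarrow> finite V \<longrightarrow> x \<in> V \<longrightarrow> 0 \<le> A \<longrightarrow> decay J V A \<longrightarrow> (2::nat) \<le> K \<longrightarrow> 1 \<le> \<rho> \<longrightarrow>
     (\<Sum>y\<in>{y\<in>V. real (sup_norm (y - x)) \<le> \<rho>}. tau (pc J) V x y)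
       \<le> (E1 * real K powr \<alpha> + E2 * real K powr (\<alpha> - real CARD('d)) * A) * \<rho> powr \<alpha>"
proof -
  let ?D = "real CARD('d)"
  obtain b0 b1 where b: "0 < b0" "0 < b1" "\<And>(J :: int ^ 'd \<Rightarrow> int ^ 'd \<Rightarrow> real). lr_kernel \<alpha> c C J \<Longrightarrow>
     b0 \<le> critical_value J \<and> critical_value J \<le> b1 \<and> 0 < perc_prob J b1"
    using critical_value_bounds[where 'd = 'd] by blast
  obtain A1 where A1: "0 < A1" "\<And>(J :: int ^ 'd \<Rightarrow> int ^ 'd \<Rightarrow> real) r. lr_kernel \<alpha> c C J \<Longrightarrow>
     (\<Sum>a\<in>lball r 0. tau (pc J) (lball r 0) 0 a) \<le> A1 * real (r + 1) powr \<alpha>"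
    using susceptibility_upper[where 'd = 'd] by blast
  obtain K2 where K2: "0 < K2" "\<And>(J :: int ^ 'd \<Rightarrow> int ^ 'd \<Rightarrow> real) a F r. lr_kernel \<alpha> c C J \<Longrightarrow> finite F \<Longrightarrow> 1 \<le> r \<Longrightarrow>
     (\<Sum>b\<in>{b\<in>F. b \<noteq> a}. J a b * real (min r (sup_norm (b - a)))) \<le> K2 * real r powr (1 - \<alpha>)"
    using kernel_weighted[where 'd = 'd] by blast
  define E1 where "E1 = A1 * 3 powr \<alpha>"
  define E2 where "E2 = A1 * 3 powr \<alpha> * b1 * K2 * 3 ^ CARD('d) * (1 / 2) powr (\<alpha> - ?D)"
  have main: "(\<Sum>y\<in>V \<inter> lball \<rho> x. tau (pc J) V x y)
       \<le> (E1 * real K powr \<alpha> + E2 * real K powr (\<alpha> - ?D) * A) * real \<rho> powr \<alpha>"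
    if J: "lr_kernel \<alpha> c C J" and V: "finite V" "x \<in> V" and A: "0 \<le> A" "decay J V A" and K: "2 \<le> K" and \<rho>: "1 \<le> \<rho>"
    for J :: "int ^ 'd \<Rightarrow> int ^ 'd \<Rightarrow> real" and V x A K \<rho>
  proof -
    let ?bc = "critical_value J"
    have bc: "?bc \<le> b1" "0 \<le> ?bc" using b J by fastforce+
    have p: "probs (pc J)" by (rule probs_pc[OF J])
    have J0: "0 \<le> J a b" for a b using lr_good[OF J] by (simp add: good_kernel_def)
    define r where "r = K * \<rho>"
    have r1: "1 \<le> r" "\<rho> \<le> r" unfolding r_def using K \<rho> by auto
    let ?B = "lball (2 * r) x"
    let ?t = "tau (pc J) ?B x"
    let ?Z = "V \<inter> lball \<rho> x"
    let ?Y = "\<lambda>a. {b\<in>V. b \<noteq> a \<and> r < sup_norm (b - x)}"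
    let ?k = "\<lambda>a b. ?bc * (J a b * real (min r (sup_norm (b - a))))"
    let ?S = "A * (real r / 2) powr (\<alpha> - ?D) * (3 ^ CARD('d) * real \<rho> powr ?D)"
    have sumt: "(\<Sum>a\<in>?B. ?t a) \<le> E1 * real r powr \<alpha>"
    proof -
      have "(\<Sum>a\<in>?B. ?t a) \<le> A1 * real (2 * r + 1) powr \<alpha>"
        using A1(2)[OF J, of "2 * r"] susceptibility_translate[OF J, where r = "2 * r" and u = x and \<beta> = ?bc] by linarith
      also have "real (2 * r + 1) powr \<alpha> \<le> (3 * real r) powr \<alpha>"
        using \<alpha>0 r1 by (intro powr_mono2) auto
      finally show ?thesis using A1(1) by (simp add: E1_def powr_mult mult.assoc)
    qed
    have inner: "(\<Sum>y\<in>?Z. tau (pc J) V b y) \<le> ?S" if b: "b \<in> V" "r < sup_norm (b - x)" for b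
    proof -
      have "(\<Sum>y\<in>?Z. tau (pc J) V b y) \<le> (\<Sum>y\<in>?Z. A * (real r / 2) powr (\<alpha> - ?D))"
      proof (rule sum_mono)
        fix y assume y: "y \<in> ?Z"
        have ny: "sup_norm (y - x) \<le> \<rho>" using y by (simp add: lball_def)
        have tri: "sup_norm (b - x) \<le> sup_norm (b - y) + sup_norm (y - x)" by (rule sup_norm_triangle)
        \<comment> \<open>Hence a vertex \<open>b\<close> farther than \<open>r\<close> from
          \<open>x\<close> is at least \<open>r / 2\<close> away from every \<open>y\<close> in the
          small ball.\<close>
        have "2 * \<rho> \<le> r" unfolding r_def using K by simp
        then have "r \<le> 2 * sup_norm (b - y)" using b(2) tri ny by linarith
        then have half: "real r / 2 \<le> real (sup_norm (b - y))" by linarith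
        then have "b \<noteq> y" using r1 by auto
        then have "tau (pc J) V b y \<le> A * real (sup_norm (b - y)) powr (\<alpha> - ?D)"
          using A(2) b y unfolding decay_def by blast
        also have "\<dots> \<le> A * (real r / 2) powr (\<alpha> - ?D)"
          using half A(1) \<alpha>d[where 'd = 'd] r1 by (intro mult_left_mono powr_mono2') auto
        finally show "tau (pc J) V b y \<le> A * (real r / 2) powr (\<alpha> - ?D)" .
      qed
      also have "\<dots> = A * (real r / 2) powr (\<alpha> - ?D) * real (card ?Z)" by simp
      also have "real (card ?Z) \<le> 3 ^ CARD('d) * real \<rho> powr ?D"
      proof -
        have "?Z = {z\<in>V. real (sup_norm (z - x)) \<le> real \<rho>}" by (auto simp: lball_def)
        then show ?thesis using count_le[OF V(1), of "real \<rho>" x] \<rho> by simp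
      qed
      finally show ?thesis using A(1) by (simp add: mult_left_mono)
    qed
    have "real r * (\<Sum>y\<in>?Z. tau (pc J) V x y) = (\<Sum>y\<in>?Z. real r * tau (pc J) V x y)"
      by (simp add: sum_distrib_left)
    also have "\<dots> \<le> (\<Sum>y\<in>?Z. real r * ?t y + (\<Sum>a\<in>V \<inter> ?B. \<Sum>b\<in>?Y a. ?t a * (?k a b * tau (pc J) V b y)))"
      by (intro sum_mono averaged_decomposition J bc V)
    also have "\<dots> = real r * (\<Sum>y\<in>?Z. ?t y) + (\<Sum>a\<in>V \<inter> ?B. \<Sum>b\<in>?Y a. ?t a * (?k a b * (\<Sum>y\<in>?Z. tau (pc J) V b y)))"
    proof -
      have "(\<Sum>y\<in>?Z. \<Sum>a\<in>V \<inter> ?B. \<Sum>b\<in>?Y a. ?t a * (?k a b * tau (pc J) V b y))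
          = (\<Sum>a\<in>V \<inter> ?B. \<Sum>y\<in>?Z. \<Sum>b\<in>?Y a. ?t a * (?k a b * tau (pc J) V b y))"
        by (rule sum.swap)
      also have "\<dots> = (\<Sum>a\<in>V \<inter> ?B. \<Sum>b\<in>?Y a. \<Sum>y\<in>?Z. ?t a * (?k a b * tau (pc J) V b y))"
        by (intro sum.cong refl sum.swap)
      finally show ?thesis by (simp only: sum.distrib sum_distrib_left)
    qed
    also have "\<dots> \<le> real r * (E1 * real r powr \<alpha>) + (\<Sum>a\<in>V \<inter> ?B. \<Sum>b\<in>?Y a. ?t a * (?k a b * ?S))"
    proof (intro add_mono mult_left_mono sum_mono)
      have "(\<Sum>y\<in>?Z. ?t y) \<le> (\<Sum>a\<in>?B. ?t a)"
        using tau_nonneg[OF p] lball_mono[of \<rho> "2 * r" x] r1 by (intro sum_mono2) auto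
      then show "(\<Sum>y\<in>?Z. ?t y) \<le> E1 * real r powr \<alpha>" using sumt by linarith
    qed (use inner tau_nonneg[OF p] bc J0 in auto)
    also have "(\<Sum>a\<in>V \<inter> ?B. \<Sum>b\<in>?Y a. ?t a * (?k a b * ?S))
        = (\<Sum>a\<in>V \<inter> ?B. ?t a * (?bc * (\<Sum>b\<in>?Y a. J a b * real (min r (sup_norm (b - a)))) * ?S))"
      unfolding sum_distrib_left sum_distrib_right ..
    also have "\<dots> \<le> (\<Sum>a\<in>V \<inter> ?B. ?t a * (b1 * (K2 * real r powr (1 - \<alpha>)) * ?S))"
    proof (intro sum_mono mult_left_mono mult_right_mono mult_mono)
      fix a
      have "(\<Sum>b\<in>?Y a. J a b * real (min r (sup_norm (b - a)))) \<le> (\<Sum>b\<in>{b\<in>V. b \<noteq> a}. J a b * real (min r (sup_norm (b - a))))"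
        using V J0 by (intro sum_mono2) auto
      also have "\<dots> \<le> K2 * real r powr (1 - \<alpha>)" by (rule K2(2)[OF J V(1) r1(1)])
      finally show "(\<Sum>b\<in>?Y a. J a b * real (min r (sup_norm (b - a)))) \<le> K2 * real r powr (1 - \<alpha>)" .
    qed (use bc b tau_nonneg[OF p] J0 A in \<open>auto intro!: sum_nonneg\<close>)
    also have "\<dots> = (\<Sum>a\<in>V \<inter> ?B. ?t a) * (b1 * (K2 * real r powr (1 - \<alpha>)) * ?S)"
      by (simp only: sum_distrib_right)
    also have "\<dots> \<le> (E1 * real r powr \<alpha>) * (b1 * (K2 * real r powr (1 - \<alpha>)) * ?S)"
    proof (rule mult_right_mono)
      have "(\<Sum>a\<in>V \<inter> ?B. ?t a) \<le> (\<Sum>a\<in>?B. ?t a)" using tau_nonneg[OF p] by (intro sum_mono2) auto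
      then show "(\<Sum>a\<in>V \<inter> ?B. ?t a) \<le> E1 * real r powr \<alpha>" using sumt by linarith
    qed (use b K2 A in auto)
    also have "\<dots> = (real r powr \<alpha> * real r powr (1 - \<alpha>)) * (E1 * b1 * K2 * ?S)" by (simp only: mult_ac)
    also have "real r powr \<alpha> * real r powr (1 - \<alpha>) = real r" using r1 by (simp add: powr_add[symmetric])
    finally have "real r * (\<Sum>y\<in>?Z. tau (pc J) V x y) \<le> real r * (E1 * real r powr \<alpha> + E1 * b1 * K2 * ?S)"
      by (simp only: distrib_left)
    then have le: "(\<Sum>y\<in>?Z. tau (pc J) V x y) \<le> E1 * real r powr \<alpha> + E1 * b1 * K2 * ?S"
      using r1 by (subst (asm) mult_le_cancel_left_pos) auto
    have rK: "real r = real K * real \<rho>" by (simp add: r_def)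
    have "(real r / 2) powr (\<alpha> - ?D) * real \<rho> powr ?D = (1 / 2) powr (\<alpha> - ?D) * real K powr (\<alpha> - ?D) * (real \<rho> powr (\<alpha> - ?D) * real \<rho> powr ?D)"
    proof -
      have "real r / 2 = 1 / 2 * real K * real \<rho>" unfolding rK by simp
      then show ?thesis by (simp only: powr_mult mult_ac)
    qed
    also have "real \<rho> powr (\<alpha> - ?D) * real \<rho> powr ?D = real \<rho> powr \<alpha>" unfolding powr_add[symmetric] by simp
    finally have pw: "(real r / 2) powr (\<alpha> - ?D) * real \<rho> powr ?D = (1 / 2) powr (\<alpha> - ?D) * real K powr (\<alpha> - ?D) * real \<rho> powr \<alpha>" .
    have "E1 * b1 * K2 * ?S = E1 * b1 * K2 * 3 ^ CARD('d) * A * ((real r / 2) powr (\<alpha> - ?D) * real \<rho> powr ?D)"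
      by (simp only: mult_ac)
    also have "\<dots> = E2 * real K powr (\<alpha> - ?D) * A * real \<rho> powr \<alpha>"
      unfolding pw E1_def E2_def by (simp only: mult_ac)
    finally have S: "E1 * b1 * K2 * ?S = E2 * real K powr (\<alpha> - ?D) * A * real \<rho> powr \<alpha>" .
    show ?thesis using le unfolding S unfolding rK powr_mult by (simp only: distrib_right mult.assoc)
  qed
  have "(\<Sum>y\<in>{y\<in>V. real (sup_norm (y - x)) \<le> \<rho>}. tau (pc J) V x y)
       \<le> (E1 * real K powr \<alpha> + E2 * real K powr (\<alpha> - ?D) * A) * \<rho> powr \<alpha>"
    if J: "lr_kernel \<alpha> c C J" and V: "finite V" "x \<in> V" and A: "0 \<le> A" "decay J V A" and K: "2 \<le> K" and \<rho>: "1 \<le> \<rho>"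
    for J :: "int ^ 'd \<Rightarrow> int ^ 'd \<Rightarrow> real" and V x A K \<rho>
  proof -
    let ?f = "nat \<lfloor>\<rho>\<rfloor>"
    have f: "1 \<le> ?f" "real ?f \<le> \<rho>" using \<rho> by (simp_all add: le_nat_floor)
    have "{y\<in>V. real (sup_norm (y - x)) \<le> \<rho>} = V \<inter> lball ?f x"
    proof -
      have "real m \<le> \<rho> \<longleftrightarrow> m \<le> ?f" for m using \<rho> by (simp add: le_nat_iff le_floor_iff)
      then show ?thesis by (auto simp: lball_def)
    qed
    then have "(\<Sum>y\<in>{y\<in>V. real (sup_norm (y - x)) \<le> \<rho>}. tau (pc J) V x y)
      \<le> (E1 * real K powr \<alpha> + E2 * real K powr (\<alpha> - ?D) * A) * real ?f powr \<alpha>"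
      using main[OF J V A K f(1)] by simp
    also have "\<dots> \<le> (E1 * real K powr \<alpha> + E2 * real K powr (\<alpha> - ?D) * A) * \<rho> powr \<alpha>"
      using f(2) \<alpha>0 A(1) A1(1) b K2(1)
      by (intro mult_left_mono powr_mono2 add_nonneg_nonneg mult_nonneg_nonneg) (auto simp: E1_def E2_def)
    finally show ?thesis .
  qed
  moreover have "0 < E1" "0 < E2" using A1(1) b K2(1) by (auto simp: E1_def E2_def)
  ultimately show ?thesis by blast
qed


text \<open>With \<open>N = sup_norm (x - y)\<close>, an exit edge of length at most
  \<open>\<epsilon> * N\<close> ends at distance at least \<open>N / 4\<close> from
  \<open>y\<close>, so the decay hypothesis applies and \<open>kernel_near\<close> contributes the
  small factor \<open>\<epsilon> powr (1 - \<alpha>)\<close>. For longer edges the kernel is small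
  enough that the sums of the two-point function around \<open>y\<close>, bounded by
  \<open>B\<close>, suffice.\<close>

lemma decay_step:
  "\<exists>F1>0. \<forall>\<epsilon>. 0 < \<epsilon> \<longrightarrow> \<epsilon> \<le> 1 / 4 \<longrightarrow> (\<exists>F2>0. \<forall>(J :: int ^ 'd::finite \<Rightarrow> int ^ 'd \<Rightarrow> real) V x y A B.
     lr_kernel \<alpha> c C J \<longrightarrow> finite V \<longrightarrow> x \<in> V \<longrightarrow> y \<in> V \<longrightarrow> 0 \<le> A \<longrightarrow> decay J V A \<longrightarrow> 0 \<le> B \<longrightarrow>
     (\<forall>\<rho>\<ge>1. (\<Sum>b\<in>{b\<in>V. real (sup_norm (b - y)) \<le> \<rho>}. tau (pc J) V y b) \<le> B * \<rho> powr \<alpha>) \<longrightarrow>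
     4 \<le> sup_norm (x - y) \<longrightarrow>
     tau (pc J) V x y \<le> (F1 * \<epsilon> powr (1 - \<alpha>) * A + F2 * B) * real (sup_norm (x - y)) powr (\<alpha> - real CARD('d)))"
proof -
  let ?D = "real CARD('d)"
  let ?q = "?D + \<alpha>"
  obtain b0 b1 where b: "0 < b0" "0 < b1" "\<And>(J :: int ^ 'd \<Rightarrow> int ^ 'd \<Rightarrow> real). lr_kernel \<alpha> c C J \<Longrightarrow>
     b0 \<le> critical_value J \<and> critical_value J \<le> b1 \<and> 0 < perc_prob J b1"
    using critical_value_bounds[where 'd = 'd] by blast
  obtain A1 where A1: "0 < A1" "\<And>(J :: int ^ 'd \<Rightarrow> int ^ 'd \<Rightarrow> real) r. lr_kernel \<alpha> c C J \<Longrightarrow>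
     (\<Sum>a\<in>lball r 0. tau (pc J) (lball r 0) 0 a) \<le> A1 * real (r + 1) powr \<alpha>"
    using susceptibility_upper[where 'd = 'd] by blast
  obtain K1 where K1: "0 < K1" "\<And>(J :: int ^ 'd \<Rightarrow> int ^ 'd \<Rightarrow> real) a F \<kappa>. lr_kernel \<alpha> c C J \<Longrightarrow> finite F \<Longrightarrow> 0 < \<kappa> \<Longrightarrow>
     (\<Sum>b\<in>{b\<in>F. b \<noteq> a \<and> real (sup_norm (b - a)) \<le> \<kappa>}. J a b * real (sup_norm (b - a))) \<le> K1 * \<kappa> powr (1 - \<alpha>)"
    using kernel_near[where 'd = 'd] by blast
  define Kd where "Kd = 2 powr \<alpha> / (1 - 2 powr (\<alpha> - ?q))"
  have "1 \<le> ?D" by (simp add: Suc_leI)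
  then have D0: "0 < ?D" by linarith
  have "2 powr (\<alpha> - ?q) < 1" using D0 by (intro two_powr_less_one) auto
  then have Kd: "0 < Kd" by (simp add: Kd_def)
  define F1 where "F1 = A1 * 8 * b1 * K1 * (1 / 4) powr (\<alpha> - ?D)"
  have F1: "0 < F1" using A1(1) b K1(1) by (simp add: F1_def)
  have "\<exists>F2>0. \<forall>(J :: int ^ 'd \<Rightarrow> int ^ 'd \<Rightarrow> real) V x y A B.
     lr_kernel \<alpha> c C J \<longrightarrow> finite V \<longrightarrow> x \<in> V \<longrightarrow> y \<in> V \<longrightarrow> 0 \<le> A \<longrightarrow> decay J V A \<longrightarrow> 0 \<le> B \<longrightarrow>
     (\<forall>\<rho>\<ge>1. (\<Sum>b\<in>{b\<in>V. real (sup_norm (b - y)) \<le> \<rho>}. tau (pc J) V y b) \<le> B * \<rho> powr \<alpha>) \<longrightarrow>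
     4 \<le> sup_norm (x - y) \<longrightarrow>
     tau (pc J) V x y \<le> (F1 * \<epsilon> powr (1 - \<alpha>) * A + F2 * B) * real (sup_norm (x - y)) powr (\<alpha> - ?D)"
    if \<epsilon>: "0 < \<epsilon>" "\<epsilon> \<le> 1 / 4" for \<epsilon>
  proof -
    \<comment> \<open>For an edge longer than \<open>\<epsilon> * N\<close> from \<open>a\<close>,
      with \<open>sup_norm (a - y) \<le> 2 * N\<close>, its length is at least \<open>e\<close>
      times both \<open>N\<close> and \<open>sup_norm (b - y)\<close>.\<close>
    define e where "e = 1 / (1 + 2 / \<epsilon>)"
    have e: "0 < e" "e \<le> \<epsilon>" using \<epsilon> by (auto simp: e_def field_simps)
    define F2 where "F2 = A1 * b1 * C * e powr - ?q * (1 + Kd)"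
    have F2: "0 < F2" using A1(1) b C0 e Kd by (simp add: F2_def)
    have "tau (pc J) V x y \<le> (F1 * \<epsilon> powr (1 - \<alpha>) * A + F2 * B) * real (sup_norm (x - y)) powr (\<alpha> - ?D)"
      if J: "lr_kernel \<alpha> c C J" and V: "finite V" "x \<in> V" "y \<in> V" and A: "0 \<le> A" "decay J V A" and B: "0 \<le> B"
        and T: "\<And>\<rho>. 1 \<le> \<rho> \<Longrightarrow> (\<Sum>b\<in>{b\<in>V. real (sup_norm (b - y)) \<le> \<rho>}. tau (pc J) V y b) \<le> B * \<rho> powr \<alpha>"
        and N4: "4 \<le> sup_norm (x - y)"
      for J :: "int ^ 'd \<Rightarrow> int ^ 'd \<Rightarrow> real" and V x y A B
    proof -
      let ?bc = "critical_value J"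
      have bc: "?bc \<le> b1" "0 \<le> ?bc" using b J by fastforce+
      have p: "probs (pc J)" by (rule probs_pc[OF J])
      have J0: "0 \<le> J a b" for a b using lr_good[OF J] by (simp add: good_kernel_def)
      define N where "N = real (sup_norm (x - y))"
      have N: "4 \<le> N" using N4 by (simp add: N_def)
      define r where "r = sup_norm (x - y) div 4"
      have r: "4 * r \<le> sup_norm (x - y)" "sup_norm (x - y) \<le> 8 * r" "2 * r + 1 \<le> sup_norm (x - y)" "1 \<le> r"
        using N4 unfolding r_def by presburger+
      have r8: "N \<le> 8 * real r" using of_nat_mono[OF r(2), where 'a = real] by (simp add: N_def)
      let ?B = "lball (2 * r) x"
      let ?t = "tau (pc J) ?B x"
      let ?Y = "\<lambda>a. {b\<in>V. b \<noteq> a}"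
      let ?g = "\<lambda>a b. J a b * real (min r (sup_norm (b - a))) * tau (pc J) V b y"
      let ?near = "K1 * (\<epsilon> * N) powr (1 - \<alpha>) * (A * (N / 4) powr (\<alpha> - ?D))"
      let ?far = "real r * (C * e powr - ?q * (1 + Kd) * B * N powr - ?D)"
      have sumt: "(\<Sum>a\<in>V \<inter> ?B. ?t a) \<le> A1 * N powr \<alpha>"
      proof -
        have "(\<Sum>a\<in>V \<inter> ?B. ?t a) \<le> (\<Sum>a\<in>?B. ?t a)" using tau_nonneg[OF p] by (intro sum_mono2) auto
        also have "\<dots> \<le> A1 * real (2 * r + 1) powr \<alpha>"
          using A1(2)[OF J, of "2 * r"] susceptibility_translate[OF J, where r = "2 * r" and u = x and \<beta> = ?bc] by linarith
        also have "\<dots> \<le> A1 * N powr \<alpha>"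
          unfolding N_def using A1(1) \<alpha>0 of_nat_mono[OF r(3), where 'a = real] by (intro mult_left_mono powr_mono2) auto
        finally show ?thesis .
      qed
      have inner: "(\<Sum>b\<in>?Y a. ?g a b) \<le> ?near + ?far" if a: "a \<in> V \<inter> ?B" for a
      proof -
        have ax: "sup_norm (a - x) \<le> 2 * r" using a by (simp add: lball_def)
        have ay: "N / 2 \<le> real (sup_norm (a - y))" "real (sup_norm (a - y)) \<le> 2 * N"
        proof -
          have "sup_norm (x - y) \<le> sup_norm (x - a) + sup_norm (a - y)" "sup_norm (a - y) \<le> sup_norm (a - x) + sup_norm (x - y)"
            by (rule sup_norm_triangle)+
          then have "sup_norm (x - y) \<le> 2 * sup_norm (a - y)" "sup_norm (a - y) \<le> 2 * sup_norm (x - y)"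
            using ax r(1) sup_norm_minus[of x a] by linarith+
          then show "N / 2 \<le> real (sup_norm (a - y))" "real (sup_norm (a - y)) \<le> 2 * N" unfolding N_def by linarith+
        qed
        let ?Nr = "{b\<in>V. b \<noteq> a \<and> real (sup_norm (b - a)) \<le> \<epsilon> * N}"
        let ?Fr = "{b\<in>V. \<epsilon> * N < real (sup_norm (b - a))}"
        have eN: "0 < \<epsilon> * N" "\<epsilon> * N \<le> N / 4" using \<epsilon> N by auto
        have "(\<Sum>b\<in>?Y a. ?g a b) \<le> (\<Sum>b\<in>?Nr \<union> ?Fr. ?g a b)"
          using V J0 tau_nonneg[OF p] by (intro sum_mono2) auto
        also have "\<dots> = (\<Sum>b\<in>?Nr. ?g a b) + (\<Sum>b\<in>?Fr. ?g a b)"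
          using V by (intro sum.union_disjoint) auto
        also have "(\<Sum>b\<in>?Nr. ?g a b) \<le> (\<Sum>b\<in>?Nr. J a b * real (sup_norm (b - a)) * (A * (N / 4) powr (\<alpha> - ?D)))"
        proof (rule sum_mono)
          fix b assume b: "b \<in> ?Nr"
          have "sup_norm (a - y) \<le> sup_norm (a - b) + sup_norm (b - y)" by (rule sup_norm_triangle)
          then have "real (sup_norm (a - y)) \<le> real (sup_norm (b - a)) + real (sup_norm (b - y))" using sup_norm_minus[of a b] by linarith
          moreover have "real (sup_norm (b - a)) \<le> \<epsilon> * N" using b by simp
          ultimately have q4: "N / 4 \<le> real (sup_norm (b - y))" using ay(1) eN(2) by linarith
          then have "b \<noteq> y" using N by auto
          then have "tau (pc J) V b y \<le> A * real (sup_norm (b - y)) powr (\<alpha> - ?D)"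
            using A(2) b V unfolding decay_def by blast
          also have "\<dots> \<le> A * (N / 4) powr (\<alpha> - ?D)"
            using q4 A(1) N \<alpha>d[where 'd = 'd] by (intro mult_left_mono powr_mono2') auto
          finally show "?g a b \<le> J a b * real (sup_norm (b - a)) * (A * (N / 4) powr (\<alpha> - ?D))"
            using J0 tau_nonneg[OF p] by (intro mult_mono mult_left_mono) auto
        qed
        also have "\<dots> = (\<Sum>b\<in>?Nr. J a b * real (sup_norm (b - a))) * (A * (N / 4) powr (\<alpha> - ?D))"
          by (simp only: sum_distrib_right)
        also have "\<dots> \<le> ?near"
          using A(1) eN(1) by (intro mult_right_mono K1(2)[OF J V(1)]) auto
        also have "(\<Sum>b\<in>?Fr. ?g a b) \<le> ?far"
        proof -
          \<comment> \<open>The kernel is now measured from \<open>y\<close>: it is constant up to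
            distance \<open>N\<close>, where the sum bound is used directly, and decays beyond,
            where \<open>dyadic_tail\<close> applies with the two-point function as weight.\<close>
          let ?h = "\<lambda>b. tau (pc J) V y b * (max N (real (sup_norm (b - y)))) powr - ?q"
          let ?M = "{b\<in>V. real (sup_norm (b - y)) \<le> N}" and ?L = "{b\<in>V. N \<le> real (sup_norm (b - y))}"
          have "(\<Sum>b\<in>?Fr. ?g a b) \<le> (\<Sum>b\<in>?Fr. real r * (C * e powr - ?q) * ?h b)"
          proof (rule sum_mono)
            fix b assume b: "b \<in> ?Fr"
            then have bN: "\<epsilon> * N < real (sup_norm (b - a))" by simp
            then have ne: "a \<noteq> b" using eN(1) by auto
            have "sup_norm (b - y) \<le> sup_norm (b - a) + sup_norm (a - y)" by (rule sup_norm_triangle)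
            then have "real (sup_norm (b - y)) \<le> real (sup_norm (b - a)) + 2 * N" using ay(2) by linarith
            moreover have "2 * N \<le> 2 / \<epsilon> * real (sup_norm (b - a))" using bN \<epsilon> by (simp add: field_simps)
            ultimately have "real (sup_norm (b - y)) \<le> (1 + 2 / \<epsilon>) * real (sup_norm (b - a))" by (simp add: algebra_simps)
            moreover have "0 < 1 + 2 / \<epsilon>" using \<epsilon> by (simp add: add_pos_pos)
            ultimately have "e * real (sup_norm (b - y)) \<le> real (sup_norm (b - a))"
              unfolding e_def by (simp add: pos_divide_le_eq mult.commute)
            moreover have "e * N \<le> real (sup_norm (b - a))" using bN mult_right_mono[OF e(2), of N] N by linarith
            ultimately have mx: "e * max N (real (sup_norm (b - y))) \<le> real (sup_norm (b - a))" by (simp add: max_def)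
            have mpos: "0 < e * max N (real (sup_norm (b - y)))" using e N by (intro mult_pos_pos) auto
            have "J a b \<le> C * real (sup_norm (b - a)) powr - ?q"
              using lr_upper[OF J ne] unfolding sup_norm_minus[of a b] .
            also have "\<dots> \<le> C * (e * max N (real (sup_norm (b - y)))) powr - ?q"
              using mx mpos C0 D0 \<alpha>0 by (intro mult_left_mono powr_mono2') auto
            also have "\<dots> = C * e powr - ?q * (max N (real (sup_norm (b - y)))) powr - ?q"
              by (simp only: powr_mult mult.assoc)
            finally have Jle: "J a b \<le> C * e powr - ?q * (max N (real (sup_norm (b - y)))) powr - ?q" .
            have "?g a b \<le> (C * e powr - ?q * (max N (real (sup_norm (b - y)))) powr - ?q) * real r * tau (pc J) V b y"
              using Jle J0 tau_nonneg[OF p] C0 by (intro mult_mono mult_right_mono) auto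
            then show "?g a b \<le> real r * (C * e powr - ?q) * ?h b"
              unfolding tau_sym[of _ V b y] by (simp only: mult_ac)
          qed
          also have "\<dots> = real r * (C * e powr - ?q) * (\<Sum>b\<in>?Fr. ?h b)" by (simp only: sum_distrib_left)
          also have "(\<Sum>b\<in>?Fr. ?h b) \<le> (\<Sum>b\<in>?M \<union> ?L. ?h b)"
            using V tau_nonneg[OF p] by (intro sum_mono2) auto
          also have "\<dots> \<le> (\<Sum>b\<in>?M. ?h b) + (\<Sum>b\<in>?L. ?h b)"
          proof -
            have "0 \<le> (\<Sum>b\<in>?M \<inter> ?L. ?h b)" using tau_nonneg[OF p] by (intro sum_nonneg) auto
            then show ?thesis using sum.union_inter[of ?M ?L ?h] V by simp
          qed
          also have "(\<Sum>b\<in>?M. ?h b) \<le> B * N powr - ?D"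
          proof -
            have "(\<Sum>b\<in>?M. ?h b) = (\<Sum>b\<in>?M. tau (pc J) V y b * N powr - ?q)"
              by (intro sum.cong) (auto simp: max_def)
            also have "\<dots> = (\<Sum>b\<in>?M. tau (pc J) V y b) * N powr - ?q" by (simp only: sum_distrib_right)
            also have "\<dots> \<le> (B * N powr \<alpha>) * N powr - ?q" using N by (intro mult_right_mono T) auto
            also have "\<dots> = B * N powr - ?D" unfolding mult.assoc powr_add[symmetric] by simp
            finally show ?thesis .
          qed
          also have "(\<Sum>b\<in>?L. ?h b) \<le> Kd * B * N powr - ?D"
          proof -
            have "(\<Sum>b\<in>?L. ?h b) = (\<Sum>b\<in>?L. tau (pc J) V y b * real (sup_norm (b - y)) powr - ?q)"
              by (intro sum.cong) (auto simp: max_def)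
            also have "\<dots> \<le> 2 powr \<alpha> / (1 - 2 powr (\<alpha> - ?q)) * B * N powr (\<alpha> - ?q)"
              using V N B T D0 \<alpha>0 tau_nonneg[OF p] by (intro dyadic_tail) auto
            finally show ?thesis by (simp add: Kd_def)
          qed
          finally have "(\<Sum>b\<in>?Fr. ?g a b) \<le> real r * (C * e powr - ?q) * (B * N powr - ?D + Kd * B * N powr - ?D)"
            using C0 by (simp add: mult_left_mono)
          then show ?thesis by (simp only: distrib_left distrib_right mult_ac mult_1_right mult_1_left)
        qed
        finally show ?thesis by simp
      qed
      have near0: "0 \<le> ?near" "0 \<le> ?far" using A(1) K1(1) B C0 Kd by auto
      \<comment> \<open>\<open>y\<close> lies outside the ball of radius \<open>2 * r\<close>, so
        every connection has to use an exit edge.\<close>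
      have t0: "?t y = 0"
        using r N4 by (intro tau_outside) (auto simp: lball_def sup_norm_minus[of y x])
      have "real r * tau (pc J) V x y \<le> real r * ?t y + (\<Sum>a\<in>V \<inter> ?B. \<Sum>b\<in>{b\<in>V. b \<noteq> a \<and> r < sup_norm (b - x)}.
          ?t a * (?bc * (J a b * real (min r (sup_norm (b - a)))) * tau (pc J) V b y))"
        by (intro averaged_decomposition J bc V)
      also have "\<dots> = (\<Sum>a\<in>V \<inter> ?B. \<Sum>b\<in>{b\<in>V. b \<noteq> a \<and> r < sup_norm (b - x)}. ?t a * (?bc * ?g a b))"
        unfolding t0 by (simp add: mult.assoc)
      also have "\<dots> \<le> (\<Sum>a\<in>V \<inter> ?B. \<Sum>b\<in>?Y a. ?t a * (?bc * ?g a b))"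
        using V bc J0 tau_nonneg[OF p] by (intro sum_mono sum_mono2) auto
      also have "\<dots> = (\<Sum>a\<in>V \<inter> ?B. ?t a * (?bc * (\<Sum>b\<in>?Y a. ?g a b)))" by (simp only: sum_distrib_left)
      also have "\<dots> \<le> (\<Sum>a\<in>V \<inter> ?B. ?t a * (b1 * (?near + ?far)))"
        using inner bc b tau_nonneg[OF p] J0
        by (intro sum_mono mult_left_mono mult_mono) (auto intro!: sum_nonneg)
      also have "\<dots> = (\<Sum>a\<in>V \<inter> ?B. ?t a) * (b1 * (?near + ?far))" by (simp only: sum_distrib_right)
      also have "\<dots> \<le> (A1 * N powr \<alpha>) * (b1 * (?near + ?far))"
        by (rule mult_right_mono[OF sumt mult_nonneg_nonneg[OF less_imp_le[OF b(2)] add_nonneg_nonneg[OF near0]]])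
      also have "?near = \<epsilon> powr (1 - \<alpha>) * K1 * A * (1 / 4) powr (\<alpha> - ?D) * (N powr (1 - \<alpha>) * N powr (\<alpha> - ?D))"
      proof -
        have "N / 4 = 1 / 4 * N" by simp
        then show ?thesis by (simp only: powr_mult mult_ac)
      qed
      also have "N powr (1 - \<alpha>) * N powr (\<alpha> - ?D) = N * N powr - ?D"
      proof -
        have "N powr (1 - \<alpha>) * N powr (\<alpha> - ?D) = N powr 1 * N powr - ?D" unfolding powr_add[symmetric] by simp
        then show ?thesis using N by simp
      qed
      \<comment> \<open>By \<open>N \<le> 8 * r\<close> the near term also acquires a factor
        \<open>r\<close>, which is cancelled against the number of averaged radii.\<close>
      also have "A1 * N powr \<alpha> * (b1 * (\<epsilon> powr (1 - \<alpha>) * K1 * A * (1 / 4) powr (\<alpha> - ?D) * (N * N powr - ?D) + ?far))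
         \<le> A1 * N powr \<alpha> * (b1 * (\<epsilon> powr (1 - \<alpha>) * K1 * A * (1 / 4) powr (\<alpha> - ?D) * (8 * real r * N powr - ?D) + ?far))"
        using r8 A1(1) b K1(1) A(1) by (intro mult_left_mono add_right_mono mult_right_mono) auto
      also have "\<dots> = real r * ((F1 * \<epsilon> powr (1 - \<alpha>) * A + F2 * B) * (N powr \<alpha> * N powr - ?D))"
        unfolding F1_def F2_def by (simp only: distrib_left distrib_right mult_ac)
      also have "N powr \<alpha> * N powr - ?D = N powr (\<alpha> - ?D)" unfolding powr_add[symmetric] by simp
      finally have "real r * tau (pc J) V x y \<le> real r * ((F1 * \<epsilon> powr (1 - \<alpha>) * A + F2 * B) * N powr (\<alpha> - ?D))" .
      then show ?thesis unfolding N_def using r(4) by (subst (asm) mult_le_cancel_left_pos) auto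
    qed
    then show ?thesis using F2 by (intro exI[of _ F2]) blast
  qed
  then show ?thesis using F1 by blast
qed

lemma powr_neg_arbitrarily_small:
  fixes s \<eta> :: real
  assumes "s < 0" "0 < \<eta>"
  shows "\<exists>K\<ge>2::nat. real K powr s \<le> \<eta>"
proof -
  define K where "K = max 2 (nat \<lceil>\<eta> powr (1 / s)\<rceil>)"
  have "\<eta> powr (1 / s) \<le> real K" unfolding K_def by linarith
  then have "real K powr s \<le> (\<eta> powr (1 / s)) powr s"
    using assms by (intro powr_mono2') auto
  also have "\<dots> = \<eta>" using assms by (simp add: powr_powr)
  finally show ?thesis by (intro exI[of _ K]) (simp add: K_def)
qed

text \<open>The best constant \<open>A\<close> in the decay estimate on a finite vertex set satisfies
  \<open>A \<le> A / 2 + const\<close>; finiteness is what makes this conclusive.\<close>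

lemma finite_volume_decay:
  "\<exists>A>0. \<forall>(J :: int ^ 'd::finite \<Rightarrow> int ^ 'd \<Rightarrow> real) V. lr_kernel \<alpha> c C J \<longrightarrow> finite V \<longrightarrow> decay J V A"
proof -
  let ?D = "real CARD('d)"
  obtain E1 E2 where E: "0 < E1" "0 < E2" "\<And>(J :: int ^ 'd \<Rightarrow> int ^ 'd \<Rightarrow> real) V x A K \<rho>.
     lr_kernel \<alpha> c C J \<Longrightarrow> finite V \<Longrightarrow> x \<in> V \<Longrightarrow> 0 \<le> A \<Longrightarrow> decay J V A \<Longrightarrow> (2::nat) \<le> K \<Longrightarrow> 1 \<le> \<rho> \<Longrightarrow>
     (\<Sum>y\<in>{y\<in>V. real (sup_norm (y - x)) \<le> \<rho>}. tau (pc J) V x y)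
       \<le> (E1 * real K powr \<alpha> + E2 * real K powr (\<alpha> - ?D) * A) * \<rho> powr \<alpha>"
    using local_sum_bound[where 'd = 'd] by blast
  obtain F1 where F1: "0 < F1" "\<And>\<epsilon>. 0 < \<epsilon> \<Longrightarrow> \<epsilon> \<le> 1 / 4 \<Longrightarrow> (\<exists>F2>0. \<forall>(J :: int ^ 'd \<Rightarrow> int ^ 'd \<Rightarrow> real) V x y A B.
     lr_kernel \<alpha> c C J \<longrightarrow> finite V \<longrightarrow> x \<in> V \<longrightarrow> y \<in> V \<longrightarrow> 0 \<le> A \<longrightarrow> decay J V A \<longrightarrow> 0 \<le> B \<longrightarrow>
     (\<forall>\<rho>\<ge>1. (\<Sum>b\<in>{b\<in>V. real (sup_norm (b - y)) \<le> \<rho>}. tau (pc J) V y b) \<le> B * \<rho> powr \<alpha>) \<longrightarrow>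
     4 \<le> sup_norm (x - y) \<longrightarrow>
     tau (pc J) V x y \<le> (F1 * \<epsilon> powr (1 - \<alpha>) * A + F2 * B) * real (sup_norm (x - y)) powr (\<alpha> - ?D))"
    using decay_step[where 'd = 'd] by blast
  \<comment> \<open>Makes the short-edge coefficient at most 1/4; it must come first because
    \<open>F2\<close> depends on \<epsilon>.\<close>
  define \<epsilon> where "\<epsilon> = min (1 / 4) ((1 / (4 * F1)) powr (1 / (1 - \<alpha>)))"
  have \<epsilon>: "0 < \<epsilon>" "\<epsilon> \<le> 1 / 4" using F1(1) by (auto simp: \<epsilon>_def)
  have "\<epsilon> powr (1 - \<alpha>) \<le> ((1 / (4 * F1)) powr (1 / (1 - \<alpha>))) powr (1 - \<alpha>)"
    using \<epsilon> \<alpha>1 by (intro powr_mono2) (auto simp: \<epsilon>_def)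
  also have "\<dots> = 1 / (4 * F1)" using F1(1) \<alpha>1 by (simp add: powr_powr)
  finally have F\<epsilon>: "F1 * \<epsilon> powr (1 - \<alpha>) \<le> 1 / 4" using F1(1) by (simp add: field_simps)
  obtain F2 where F2: "0 < F2" "\<And>(J :: int ^ 'd \<Rightarrow> int ^ 'd \<Rightarrow> real) V x y A B.
     lr_kernel \<alpha> c C J \<Longrightarrow> finite V \<Longrightarrow> x \<in> V \<Longrightarrow> y \<in> V \<Longrightarrow> 0 \<le> A \<Longrightarrow> decay J V A \<Longrightarrow> 0 \<le> B \<Longrightarrow>
     (\<And>\<rho>. 1 \<le> \<rho> \<Longrightarrow> (\<Sum>b\<in>{b\<in>V. real (sup_norm (b - y)) \<le> \<rho>}. tau (pc J) V y b) \<le> B * \<rho> powr \<alpha>) \<Longrightarrow>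
     4 \<le> sup_norm (x - y) \<Longrightarrow>
     tau (pc J) V x y \<le> (F1 * \<epsilon> powr (1 - \<alpha>) * A + F2 * B) * real (sup_norm (x - y)) powr (\<alpha> - ?D)"
    using F1(2)[OF \<epsilon>] by blast
  \<comment> \<open>Makes the second coefficient of \<open>A\<close>, which enters through the sums
    around \<open>y\<close>, at most another 1/4.\<close>
  obtain K :: nat where K: "2 \<le> K" "real K powr (\<alpha> - ?D) \<le> 1 / (4 * F2 * E2)"
    using powr_neg_arbitrarily_small[of "\<alpha> - ?D" "1 / (4 * F2 * E2)"] \<alpha>d[where 'd = 'd] F2(1) E(2) by auto
  define G where "G = F2 * (E1 * real K powr \<alpha>)"
  have G: "0 < G" using F2(1) E(1) K by (simp add: G_def)
  have FK: "F2 * (E2 * real K powr (\<alpha> - ?D)) \<le> 1 / 4"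
  proof -
    have "F2 * (E2 * real K powr (\<alpha> - ?D)) \<le> F2 * (E2 * (1 / (4 * F2 * E2)))"
      using K F2(1) E(2) by (intro mult_left_mono) auto
    then show ?thesis using F2(1) E(2) by simp
  qed
  \<comment> \<open>The term \<open>2 * G\<close> solves \<open>A \<le> A / 2 + G\<close>; the other
    covers distances below 4, where only the trivial bound 1 is used.\<close>
  define A0 where "A0 = 2 * G + 4 powr (?D - \<alpha>)"
  have A0: "0 < A0" using G by (simp add: A0_def add_pos_pos)
  have "decay J V A0" if J: "lr_kernel \<alpha> c C J" and V: "finite V" for J :: "int ^ 'd \<Rightarrow> int ^ 'd \<Rightarrow> real" and V
  proof -
    have p: "probs (pc J)" by (rule probs_pc[OF J])
    let ?f = "\<lambda>(u, v). tau (pc J) V u v * real (sup_norm (u - v)) powr (?D - \<alpha>)"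
    define A where "A = Max (insert 0 (?f ` (V \<times> V)))"
    have A_ge: "0 \<le> A" "\<And>u v. u \<in> V \<Longrightarrow> v \<in> V \<Longrightarrow> ?f (u, v) \<le> A"
      unfolding A_def using V by (auto intro!: Max_ge)
    have inv: "real (sup_norm (u - v)) powr (?D - \<alpha>) * real (sup_norm (u - v)) powr (\<alpha> - ?D) = 1" if "u \<noteq> v" for u v :: "int ^ 'd"
      using that unfolding powr_add[symmetric] by simp
    have conv: "tau (pc J) V u v \<le> X * real (sup_norm (u - v)) powr (\<alpha> - ?D)"
      if "?f (u, v) \<le> X" "u \<noteq> v" for u v X
    proof -
      have "tau (pc J) V u v = ?f (u, v) * real (sup_norm (u - v)) powr (\<alpha> - ?D)"
        using inv[OF that(2)] by simp
      also have "\<dots> \<le> X * real (sup_norm (u - v)) powr (\<alpha> - ?D)" using that(1) by (rule mult_right_mono) simp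
      finally show ?thesis .
    qed
    have dec: "decay J V A" unfolding decay_def using A_ge conv by blast
    let ?B = "E1 * real K powr \<alpha> + E2 * real K powr (\<alpha> - ?D) * A"
    have B0: "0 \<le> ?B" using E A_ge by simp
    have bound: "?f (u, v) \<le> max (A / 2 + G) (4 powr (?D - \<alpha>))" if uv: "u \<in> V" "v \<in> V" for u v
    proof (cases "4 \<le> sup_norm (u - v)")
      case True
      then have ne: "u \<noteq> v" by auto
      have "tau (pc J) V u v \<le> (F1 * \<epsilon> powr (1 - \<alpha>) * A + F2 * ?B) * real (sup_norm (u - v)) powr (\<alpha> - ?D)"
        using E(3)[OF J V uv(2) A_ge(1) dec K(1)]
        by (intro F2(2)[OF J V uv A_ge(1) dec B0 _ True]) auto
      then have "?f (u, v) \<le> (F1 * \<epsilon> powr (1 - \<alpha>) * A + F2 * ?B) * real (sup_norm (u - v)) powr (\<alpha> - ?D) * real (sup_norm (u - v)) powr (?D - \<alpha>)"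
        by (simp add: mult_right_mono)
      also have "\<dots> = F1 * \<epsilon> powr (1 - \<alpha>) * A + F2 * ?B"
        using inv[OF ne] by (simp add: mult.assoc mult.commute)
      also have "\<dots> = (F1 * \<epsilon> powr (1 - \<alpha>)) * A + G + (F2 * (E2 * real K powr (\<alpha> - ?D))) * A"
        unfolding G_def by (simp add: algebra_simps)
      also have "\<dots> \<le> 1 / 4 * A + G + 1 / 4 * A"
        using F\<epsilon> FK A_ge(1) by (intro add_mono mult_right_mono) auto
      finally show ?thesis by simp
    next
      case False
      then have "real (sup_norm (u - v)) powr (?D - \<alpha>) \<le> 4 powr (?D - \<alpha>)"
        using \<alpha>d[where 'd = 'd] by (intro powr_mono2) auto
      then have "?f (u, v) \<le> 1 * 4 powr (?D - \<alpha>)"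
        using tau_le_1[OF p V] tau_nonneg[OF p] by (simp only: prod.case) (intro mult_mono, auto)
      then show ?thesis by simp
    qed
    have "A \<le> max (A / 2 + G) (4 powr (?D - \<alpha>))"
      unfolding A_def[of] 
    proof (rule Max.boundedI)
      fix z assume z: "z \<in> insert 0 (?f ` (V \<times> V))"
      show "z \<le> max (Max (insert 0 (?f ` (V \<times> V))) / 2 + G) (4 powr (?D - \<alpha>))"
      proof (cases "z = 0")
        case True
        have "0 \<le> (4 :: real) powr (?D - \<alpha>)" by simp
        then show ?thesis using True by (simp add: le_max_iff_disj)
      next
        case False
        then obtain u v where "u \<in> V" "v \<in> V" "z = ?f (u, v)" using z by blast
        then show ?thesis using bound[of u v] unfolding A_def by blast
      qed
    qed (use V in auto)
    then have "A \<le> A / 2 + G \<or> A \<le> 4 powr (?D - \<alpha>)" by (simp add: le_max_iff_disj)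
    moreover have "0 \<le> (4 :: real) powr (?D - \<alpha>)" by simp
    ultimately have "A \<le> A0" unfolding A0_def using G by linarith
    then show ?thesis unfolding decay_def using A_ge(2) conv by (meson order_trans)
  qed
  then show ?thesis using A0 by blast
qed

lemma two_point_upper:
  "\<exists>A>0. \<forall>(J :: int ^ 'd::finite \<Rightarrow> int ^ 'd \<Rightarrow> real) x. lr_kernel \<alpha> c C J \<longrightarrow> x \<noteq> 0 \<longrightarrow>
     two_point J (critical_value J) 0 x \<le> A * real (sup_norm x) powr (\<alpha> - real CARD('d))"
proof -
  obtain A where A: "0 < A" "\<And>(J :: int ^ 'd \<Rightarrow> int ^ 'd \<Rightarrow> real) V. lr_kernel \<alpha> c C J \<Longrightarrow> finite V \<Longrightarrow> decay J V A"
    using finite_volume_decay[where 'd = 'd] by blast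
  have "two_point J (critical_value J) 0 x \<le> A * real (sup_norm x) powr (\<alpha> - real CARD('d))"
    if J: "lr_kernel \<alpha> c C J" and x: "x \<noteq> 0" for J :: "int ^ 'd \<Rightarrow> int ^ 'd \<Rightarrow> real" and x
  proof (rule two_point_le[OF lr_good[OF J]])
    show "0 \<le> critical_value J" by (rule critical_value_ge_0[OF J])
    have p: "probs (pc J)" by (rule probs_pc[OF J])
    fix n
    \<comment> \<open>Enlarged so as to contain \<open>x\<close>, since \<open>decay\<close> speaks
      only of points of the set.\<close>
    let ?V = "lball (max n (sup_norm x)) (0 :: int ^ 'd)"
    have "tau (pc J) (lball n 0) 0 x \<le> tau (pc J) ?V 0 x"
      by (intro tau_mono p lball_mono) auto
    also have "\<dots> \<le> A * real (sup_norm (0 - x)) powr (\<alpha> - real CARD('d))"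
    proof -
      have "decay J ?V A" by (rule A(2)[OF J finite_lball])
      then show ?thesis unfolding decay_def by (elim ballE[of _ _ 0] ballE[of _ _ x]) (use x in \<open>auto simp: lball_def\<close>)
    qed
    finally show "tau (pc J) (lball n 0) 0 x \<le> A * real (sup_norm x) powr (\<alpha> - real CARD('d))"
      using sup_norm_minus[of 0 x] by simp
  qed
  then show ?thesis using A(1) by blast
qed

end

section \<open>Assembly of the two bounds\<close>

theorem theorem1p4:
  fixes \<alpha> c C :: real
  assumes "0 < \<alpha>" and "\<alpha> < real CARD('d::finite)" and "0 < c" and "\<alpha> < 1"
  shows "\<exists>A>0. \<exists>B>0. \<forall>J :: int ^ 'd \<Rightarrow> int ^ 'd \<Rightarrow> real.
    (\<forall>x y. 0 \<le> J x y) \<and> symmetric_kernel J \<and> integrable_kernel J \<and> translation_invariant J \<and>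
    (\<forall>x y. x \<noteq> y \<longrightarrow>
       c * linf_norm (x - y) powr (- real CARD('d) - \<alpha>) \<le> J x y \<and>
       J x y \<le> C * linf_norm (x - y) powr (- real CARD('d) - \<alpha>)) \<longrightarrow>
    (\<forall>x. x \<noteq> 0 \<longrightarrow>
       two_point J (critical_value J) 0 x \<le> A * linf_norm x powr (- real CARD('d) + \<alpha>) \<and>
       linf_norm x powr (- real CARD('d) + \<alpha>) \<le> B * two_point J (critical_value J) 0 x)"
proof -
  \<comment> \<open>Replacing \<open>C\<close> by \<open>max C c\<close> preserves the upper bound
    and provides the positive constant that \<open>lr_params\<close> asks for, whatever the sign of
    \<open>C\<close>.\<close>
  have lr: "lr_kernel \<alpha> c (max C c) J"
    if "(\<forall>x y. 0 \<le> J x y) \<and> symmetric_kernel J \<and> integrable_kernel J \<and> translation_invariant J \<and>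
      (\<forall>x y. x \<noteq> y \<longrightarrow>
         c * linf_norm (x - y) powr (- real CARD('d) - \<alpha>) \<le> J x y \<and>
         J x y \<le> C * linf_norm (x - y) powr (- real CARD('d) - \<alpha>))" for J :: "int ^ 'd \<Rightarrow> int ^ 'd \<Rightarrow> real"
  proof -
    have "J x y \<le> max C c * real (sup_norm (x - y)) powr - (real CARD('d) + \<alpha>)" if "x \<noteq> y" for x y
    proof -
      have "J x y \<le> C * real (sup_norm (x - y)) powr - (real CARD('d) + \<alpha>)"
        using \<open>_ \<and> _\<close> that by (simp add: linf_norm_eq)
      also have "\<dots> \<le> max C c * real (sup_norm (x - y)) powr - (real CARD('d) + \<alpha>)"
        by (intro mult_right_mono) auto
      finally show ?thesis .
    qed
    then show ?thesis using that by (simp add: lr_kernel_def good_kernel_def linf_norm_eq)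
  qed
  interpret lr_params \<alpha> c "max C c" by unfold_locales (use assms in auto)
  obtain A where A: "0 < A" "\<And>(J :: int ^ 'd \<Rightarrow> int ^ 'd \<Rightarrow> real) x. lr_kernel \<alpha> c (max C c) J \<Longrightarrow> x \<noteq> 0 \<Longrightarrow>
     two_point J (critical_value J) 0 x \<le> A * real (sup_norm x) powr (\<alpha> - real CARD('d))"
    using two_point_upper[where 'd = 'd] by blast
  obtain B where B: "0 < B" "\<And>(J :: int ^ 'd \<Rightarrow> int ^ 'd \<Rightarrow> real) x. lr_kernel \<alpha> c (max C c) J \<Longrightarrow> x \<noteq> 0 \<Longrightarrow>
     B * real (sup_norm x) powr (\<alpha> - real CARD('d)) \<le> two_point J (critical_value J) 0 x"
    using two_point_lower[where 'd = 'd] by blast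
  have exponent: "- real CARD('d) + \<alpha> = \<alpha> - real CARD('d)" by simp
  have "real (sup_norm x) powr (\<alpha> - real CARD('d)) \<le> 1 / B * two_point J (critical_value J) 0 x"
    if "lr_kernel \<alpha> c (max C c) J" "x \<noteq> 0" for J :: "int ^ 'd \<Rightarrow> int ^ 'd \<Rightarrow> real" and x
    using B(2)[OF that] B(1) by (simp add: field_simps)
  then show ?thesis
    unfolding exponent linf_norm_eq[symmetric]
    using A(1,2) B(1) lr by (intro exI[of _ A] conjI exI[of _ "1 / B"]) (auto simp: linf_norm_eq)
qed

end
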